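(* Let $\mathbb{K}$ be a field of characteristic zero, $V$ a $\mathbb{K}$-vector space of finite dimension $n\ge2$, $\mathcal{K}_{-2}$ a proper vector subspace of $\mathfrak{f}_{-2}(V)=\Lambda^2(V)$, and $\mathcal{K}=\mathcal{K}_{-2}\oplus\mathfrak{f}_{[3]}(V)$. Let $\mathfrak{m}(\mathcal{K})=\mathfrak{f}(V)/\mathcal{K}=V\oplus(\Lambda^2(V)/\mathcal{K}_{-2})$. Then the maximal $\mathfrak{gl}_{\mathbb{K}}(V)$-prolongation $\mathfrak{g}(\mathcal{K})$ of $\mathfrak{m}(\mathcal{K})$ is finite dimensional if and only if $\mathfrak{m}(\mathcal{K})$ has algebraic minimum rank $\ell\ge2$, where $$\ell=\inf\{\dim_{\mathbb{F}}([z,V_{(\mathbb{F})}])\mid0\ne z\in V_{(\mathbb{F})}\},$$ $\mathbb{F}$ is the algebraic closure of $\mathbb{K}$, $V_{(\mathbb{F})}=\mathbb{F}\otimes_{\mathbb{K}}V$, and $[\,\cdot\,,\cdot\,]$ is the $\mathbb{F}$-bilinear extension of the Lie bracket $V\times V\to\mathfrak{g}_{-2}(\mathcal{K})=\Lambda^2(V)/\mathcal{K}_{-2}$.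
   Context: $\mathfrak{f}(V)=\sum_{p\ge1}\mathfrak{f}_{-p}(V)$ is the free Lie $\mathbb{K}$-algebra generated by $V$, graded so that $\mathfrak{f}_{-1}(V)=V$; $\mathfrak{f}_{[3]}(V)=\sum_{p\ge3}\mathfrak{f}_{-p}(V)$. A $\mathbb{Z}$-graded Lie algebra $\mathfrak{g}=\sum_{p\in\mathbb{Z}}\mathfrak{g}_p$ is an effective prolongation of $\mathfrak{m}(\mathcal{K})$ if $\sum_{p<0}\mathfrak{g}_p=\mathfrak{m}(\mathcal{K})$ and $\{X\in\sum_{p\ge0}\mathfrak{g}_p\mid[X,\mathfrak{g}_{-1}]=\{0\}\}=\{0\}$. The maximal $\mathfrak{gl}_{\mathbb{K}}(V)$-prolongation $\mathfrak{g}(\mathcal{K})$ is the effective prolongation (which exists and is unique up to isomorphism) into which every effective prolongation of $\mathfrak{m}(\mathcal{K})$ embeds by an injective graded Lie algebra homomorphism that is the identity on $\mathfrak{m}(\mathcal{K})$. *)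

theory Defs
  imports "HOL-Algebra.Algebraic_Closure_Type"
begin

text \<open>
  All vector spaces below are subspaces (given as sets) of an ambient type that is a vector space
  in the sense of the locale \<^locale>\<open>vector_space\<close>. Maps between them are total functions of
  which only the values on the relevant subspace matter.
\<close>

definition finite_dimensional :: "('k::field \<Rightarrow> 'a::ab_group_add \<Rightarrow> 'a) \<Rightarrow> 'a set \<Rightarrow> bool" where
  "finite_dimensional s U \<longleftrightarrow> (\<exists>B. finite B \<and> Modules.module.span s B = U)"

text \<open>Additive maps on \<open>U\<close> that are linear along a homomorphism \<open>\<sigma>\<close> of the scalars.\<close>

definition semilinear_on ::
  "('k \<Rightarrow> 'l) \<Rightarrow> ('k::field \<Rightarrow> 'a::ab_group_add \<Rightarrow> 'a) \<Rightarrow> ('l::field \<Rightarrow> 'b::ab_group_add \<Rightarrow> 'b)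
    \<Rightarrow> 'a set \<Rightarrow> ('a \<Rightarrow> 'b) \<Rightarrow> bool" where
  "semilinear_on \<sigma> s s' U \<phi> \<longleftrightarrow>
     (\<forall>x\<in>U. \<forall>y\<in>U. \<phi> (x + y) = \<phi> x + \<phi> y) \<and> (\<forall>c. \<forall>x\<in>U. \<phi> (s c x) = s' (\<sigma> c) (\<phi> x))"

abbreviation linear_map_on ::
  "('k::field \<Rightarrow> 'a::ab_group_add \<Rightarrow> 'a) \<Rightarrow> ('k \<Rightarrow> 'b::ab_group_add \<Rightarrow> 'b)
    \<Rightarrow> 'a set \<Rightarrow> ('a \<Rightarrow> 'b) \<Rightarrow> bool" where
  "linear_map_on \<equiv> semilinear_on (\<lambda>c. c)"

definition bilinear_map_on ::
  "('k::field \<Rightarrow> 'a::ab_group_add \<Rightarrow> 'a) \<Rightarrow> ('k \<Rightarrow> 'b::ab_group_add \<Rightarrow> 'b)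
    \<Rightarrow> 'a set \<Rightarrow> ('a \<Rightarrow> 'a \<Rightarrow> 'b) \<Rightarrow> bool" where
  "bilinear_map_on s s' U \<beta> \<longleftrightarrow>
     (\<forall>x\<in>U. linear_map_on s s' U (\<beta> x)) \<and> (\<forall>y\<in>U. linear_map_on s s' U (\<lambda>x. \<beta> x y))"

locale lie_algebra = vector_space s
  for s :: "'k::field \<Rightarrow> 'a::ab_group_add \<Rightarrow> 'a" +
  fixes br :: "'a \<Rightarrow> 'a \<Rightarrow> 'a" and L :: "'a set"
  assumes subspace_L: "subspace L"
    and closed: "x \<in> L \<Longrightarrow> y \<in> L \<Longrightarrow> br x y \<in> L"
    and bilinear: "bilinear_map_on s s L br"
    and alternating: "x \<in> L \<Longrightarrow> br x x = 0"
    and jacobi: "x \<in> L \<Longrightarrow> y \<in> L \<Longrightarrow> z \<in> L \<Longrightarrow>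
      br x (br y z) + br y (br z x) + br z (br x y) = 0"

definition lie_hom ::
  "('k::field \<Rightarrow> 'a::ab_group_add \<Rightarrow> 'a) \<Rightarrow> ('a \<Rightarrow> 'a \<Rightarrow> 'a) \<Rightarrow> 'a set
    \<Rightarrow> ('k \<Rightarrow> 'b::ab_group_add \<Rightarrow> 'b) \<Rightarrow> ('b \<Rightarrow> 'b \<Rightarrow> 'b) \<Rightarrow> 'b set \<Rightarrow> ('a \<Rightarrow> 'b) \<Rightarrow> bool" where
  "lie_hom s br L s' br' L' \<phi> \<longleftrightarrow>
     \<phi> ` L \<subseteq> L' \<and> linear_map_on s s' L \<phi> \<and> (\<forall>x\<in>L. \<forall>y\<in>L. \<phi> (br x y) = br' (\<phi> x) (\<phi> y))"

text \<open>\<open>(L', q)\<close> is the quotient of \<open>L\<close> by the ideal \<open>I\<close>.\<close>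

definition lie_quotient ::
  "('k::field \<Rightarrow> 'a::ab_group_add \<Rightarrow> 'a) \<Rightarrow> ('a \<Rightarrow> 'a \<Rightarrow> 'a) \<Rightarrow> 'a set \<Rightarrow> 'a set
    \<Rightarrow> ('k \<Rightarrow> 'b::ab_group_add \<Rightarrow> 'b) \<Rightarrow> ('b \<Rightarrow> 'b \<Rightarrow> 'b) \<Rightarrow> 'b set \<Rightarrow> ('a \<Rightarrow> 'b) \<Rightarrow> bool" where
  "lie_quotient s br L I s' br' L' q \<longleftrightarrow>
     lie_algebra s br L \<and> lie_algebra s' br' L' \<and> lie_hom s br L s' br' L' q \<and>
     q ` L = L' \<and> {x \<in> L. q x = 0} = I"

definition sum_cmp :: "('k::field \<Rightarrow> 'a::ab_group_add \<Rightarrow> 'a) \<Rightarrow> int set \<Rightarrow> (int \<Rightarrow> 'a set) \<Rightarrow> 'a set" where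
  "sum_cmp s P G = Modules.module.span s (\<Union>p\<in>P. G p)"

text \<open>A \<open>\<int>\<close>-graded Lie algebra, the internal direct sum of the subspaces \<open>G p\<close>.\<close>

locale graded_lie_algebra = lie_algebra s br "sum_cmp s UNIV G"
  for s :: "'k::field \<Rightarrow> 'a::ab_group_add \<Rightarrow> 'a" and br and G :: "int \<Rightarrow> 'a set" +
  assumes subspace_cmp: "subspace (G p)"
    and direct: "finite {p. c p \<noteq> 0} \<Longrightarrow> (\<And>p. c p \<in> G p) \<Longrightarrow> (\<Sum>p | c p \<noteq> 0. c p) = 0 \<Longrightarrow> c p = 0"
    and bracket_cmp: "x \<in> G p \<Longrightarrow> y \<in> G q \<Longrightarrow> br x y \<in> G (p + q)"

definition graded_lie_hom ::
  "('k::field \<Rightarrow> 'a::ab_group_add \<Rightarrow> 'a) \<Rightarrow> ('a \<Rightarrow> 'a \<Rightarrow> 'a) \<Rightarrow> (int \<Rightarrow> 'a set)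
    \<Rightarrow> ('k \<Rightarrow> 'b::ab_group_add \<Rightarrow> 'b) \<Rightarrow> ('b \<Rightarrow> 'b \<Rightarrow> 'b) \<Rightarrow> (int \<Rightarrow> 'b set) \<Rightarrow> ('a \<Rightarrow> 'b) \<Rightarrow> bool" where
  "graded_lie_hom s br G s' br' G' \<phi> \<longleftrightarrow>
     lie_hom s br (sum_cmp s UNIV G) s' br' (sum_cmp s' UNIV G') \<phi> \<and> (\<forall>p. \<phi> ` G p \<subseteq> G' p)"

text \<open>
  A universal property quantifies over algebras of arbitrary size, which a formula of HOL can only
  do within a fixed type. Below this type is \<open>'k poly\<close> with the scalar multiplication \<open>Polynomial.smult\<close>,
  used merely as a \<open>'k\<close>-vector space of countably infinite dimension: every \<open>'k\<close>-vector space of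
  countable dimension is isomorphic to a subspace of it, and only objects of countable dimension
  have to be tested.
\<close>

text \<open>
  The free Lie algebra on a subspace \<open>V\<close> of countable dimension, with its grading in which
  \<open>F (- 1) = V\<close>. A linear map from \<open>V\<close> into any Lie algebra takes values in the subalgebra generated
  by its image, which has countable dimension; so it suffices to test on \<open>'k poly\<close>. Uniqueness of
  the extensions is the statement that \<open>V\<close> generates.
\<close>

definition free_lie_algebra ::
  "('k::field \<Rightarrow> 'a::ab_group_add \<Rightarrow> 'a) \<Rightarrow> ('a \<Rightarrow> 'a \<Rightarrow> 'a) \<Rightarrow> (int \<Rightarrow> 'a set) \<Rightarrow> 'a set \<Rightarrow> bool" where
  "free_lie_algebra s br F V \<longleftrightarrow>
     graded_lie_algebra s br F \<and> F (- 1) = V \<and> (\<forall>p\<ge>0. F p = {0}) \<and>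
     (\<forall>S. Modules.module.subspace s S \<and> V \<subseteq> S \<and> (\<forall>x\<in>S. \<forall>y\<in>S. br x y \<in> S)
        \<longrightarrow> sum_cmp s UNIV F \<subseteq> S) \<and>
     (\<forall>(br' :: 'k poly \<Rightarrow> 'k poly \<Rightarrow> 'k poly) L' \<phi>.
        lie_algebra Polynomial.smult br' L' \<and> linear_map_on s Polynomial.smult V \<phi> \<and> \<phi> ` V \<subseteq> L'
        \<longrightarrow> (\<exists>\<psi>. lie_hom s br (sum_cmp s UNIV F) Polynomial.smult br' L' \<psi> \<and> (\<forall>x\<in>V. \<psi> x = \<phi> x)))"

text \<open>
  \<open>M\<close> is the graded Lie algebra to be prolonged; \<open>\<iota>\<close> identifies it with the negative part of \<open>G\<close>.
\<close>

definition effective_prolongation ::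
  "('k::field \<Rightarrow> 'm::ab_group_add \<Rightarrow> 'm) \<Rightarrow> ('m \<Rightarrow> 'm \<Rightarrow> 'm) \<Rightarrow> (int \<Rightarrow> 'm set)
    \<Rightarrow> ('k \<Rightarrow> 'g::ab_group_add \<Rightarrow> 'g) \<Rightarrow> ('g \<Rightarrow> 'g \<Rightarrow> 'g) \<Rightarrow> (int \<Rightarrow> 'g set) \<Rightarrow> ('m \<Rightarrow> 'g) \<Rightarrow> bool" where
  "effective_prolongation sM brM M s br G \<iota> \<longleftrightarrow>
     graded_lie_algebra s br G \<and>
     graded_lie_hom sM brM M s br G \<iota> \<and> inj_on \<iota> (sum_cmp sM UNIV M) \<and>
     \<iota> ` sum_cmp sM UNIV M = sum_cmp s {..<0} G \<and>
     {x \<in> sum_cmp s {0..} G. \<forall>y\<in>G (- 1). br x y = 0} = {0}"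

text \<open>
  When \<open>M\<close> is finite dimensional, effectiveness embeds \<open>G p\<close> into
  the linear maps from \<open>G (- 1)\<close> to \<open>G (p - 1)\<close> for every \<open>p \<ge> 0\<close>, so effective prolongations have
  countable dimension, and testing those carried by \<open>'k poly\<close> is testing all of them.
\<close>

definition maximal_prolongation ::
  "('k::field \<Rightarrow> 'm::ab_group_add \<Rightarrow> 'm) \<Rightarrow> ('m \<Rightarrow> 'm \<Rightarrow> 'm) \<Rightarrow> (int \<Rightarrow> 'm set)
    \<Rightarrow> ('k \<Rightarrow> 'g::ab_group_add \<Rightarrow> 'g) \<Rightarrow> ('g \<Rightarrow> 'g \<Rightarrow> 'g) \<Rightarrow> (int \<Rightarrow> 'g set) \<Rightarrow> ('m \<Rightarrow> 'g) \<Rightarrow> bool" where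
  "maximal_prolongation sM brM M s br G \<iota> \<longleftrightarrow>
     effective_prolongation sM brM M s br G \<iota> \<and>
     (\<forall>(brH :: 'k poly \<Rightarrow> 'k poly \<Rightarrow> 'k poly) H \<kappa>.
        effective_prolongation sM brM M Polynomial.smult brH H \<kappa> \<longrightarrow>
        (\<exists>\<phi>. graded_lie_hom Polynomial.smult brH H s br G \<phi> \<and>
             inj_on \<phi> (sum_cmp Polynomial.smult UNIV H) \<and>
             (\<forall>x\<in>sum_cmp sM UNIV M. \<phi> (\<kappa> x) = \<iota> x)))"

text \<open>
  \<open>(W, j)\<close> is the extension of scalars of a vector space \<open>U\<close> of countable dimension to the algebraic
  closure of \<open>'k\<close>, where \<open>j x\<close> stands for \<open>1 \<otimes> x\<close>: every \<open>'k\<close>-linear map from \<open>U\<close> to a vector space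
  over the closure factors uniquely through \<open>j\<close>. Uniqueness is the statement that \<open>j ` U\<close> spans \<open>W\<close>.
\<close>

definition scalar_extension ::
  "('k::field \<Rightarrow> 'a::ab_group_add \<Rightarrow> 'a) \<Rightarrow> 'a set
    \<Rightarrow> ('k alg_closure \<Rightarrow> 'w::ab_group_add \<Rightarrow> 'w) \<Rightarrow> 'w set \<Rightarrow> ('a \<Rightarrow> 'w) \<Rightarrow> bool" where
  "scalar_extension s U sW W j \<longleftrightarrow>
     vector_space sW \<and> semilinear_on to_ac s sW U j \<and> Modules.module.span sW (j ` U) = W \<and>
     (\<forall>\<phi> :: 'a \<Rightarrow> 'k alg_closure poly. semilinear_on to_ac s Polynomial.smult U \<phi>
        \<longrightarrow> (\<exists>\<psi>. linear_map_on sW Polynomial.smult W \<psi> \<and> (\<forall>x\<in>U. \<psi> (j x) = \<phi> x)))"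

definition minimum_rank ::
  "('l::field \<Rightarrow> 'u::ab_group_add \<Rightarrow> 'u) \<Rightarrow> 'w::ab_group_add set \<Rightarrow> ('w \<Rightarrow> 'w \<Rightarrow> 'u) \<Rightarrow> nat" where
  "minimum_rank sU W \<beta> = Inf {vector_space.dim sU (\<beta> z ` W) | z. z \<in> W \<and> z \<noteq> 0}"

end

theory Submission
  imports Defs "HOL-Library.Function_Algebras" "HOL-Library.Countable_Set"
begin

text \<open>
  Write \<open>g\<close> for the prolongation and \<open>\<omega>\<close> for the bracket \<open>V \<times> V \<rightarrow> g\<^sub>-\<^sub>2\<close>.

  If \<open>g\<close> is infinite dimensional, extend scalars to the closure. Commuting operators of degree \<open>-1\<close> on
  an infinite dimensional graded space with finite dimensional components all annihilate an infinite
  dimensional subspace, up to passing to a hyperplane of operators: otherwise two of them are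
  isomorphisms in high degrees and an eigenvalue of their quotient yields a degenerate combination.
  Applied to \<open>g\<^sub>-\<^sub>2\<close>, this leaves either infinitely many degrees annihilated by \<open>g\<^sub>-\<^sub>2\<close>, or a
  representation of the Heisenberg algebra with invertible center on finite dimensional spaces,
  impossible in characteristic zero. Applied then to \<open>V\<close> it gives \<open>x \<in> g\<^sub>0\<close> annihilating \<open>g\<^sub>-\<^sub>2\<close> and a
  hyperplane of \<open>V\<close>, and \<open>z = [x, v] \<noteq> 0\<close> satisfies \<open>dim [z, V] \<le> 1\<close>.

  Conversely, if \<open>[z, y] = \<xi>(y) u\<close> over the closure, then the polynomial vector fields \<open>\<xi>\<^sup>p\<^sup>+\<^sup>1 z\<close> on \<open>V\<close>
  preserve \<open>\<omega>\<close>. Preserving \<open>\<omega>\<close> is a linear condition over the ground field, so it has nonzero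
  solutions there in every degree \<open>p \<ge> 0\<close>, and the central extension by \<open>\<omega>\<close> of the Lie algebra of
  these solutions is an effective prolongation, which embeds into \<open>g\<close>.
\<close>

subsection \<open>Linear algebra on subspaces\<close>

text \<open>The pencil argument needs commuting operators, but V commutes on the prolongation only
  modulo degree -2. Hence the detour: degree -2 is central in the negative part and can be treated
  on its own, and on its kernel V does commute. The detour could fail only if a bracket w = [a, b]
  stayed injective in high degrees. Then the pencil a b - c w has an eigenvalue, \<open>b\<close>
  raises it by one, \<open>a\<close> lowers it by one, and in characteristic zero one of the two
  chains is too long for the dimension available. In the end an element x of degree 0 is killed by
  degree -2 and by a hyperplane S of V; therefore [v, x] is still killed by S, and its brackets fill
  at most a line.

  In the other direction \<omega> is constant, so a field P preserves it exactly when the one-form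
  i_P \<omega> is closed; for a power of \<xi> times a degenerate vector this is the symmetry of a
  product of values of \<xi>. The missing degree -2 is supplied by the cocycle \<omega>(P(0), Q(0)).
  Rank zero is covered by the same fields, with u = 0 and any nonzero \<xi>.\<close>

lemma semilinear_onD:
  assumes "semilinear_on \<sigma> s s' U f"
  shows "x \<in> U \<Longrightarrow> y \<in> U \<Longrightarrow> f (x + y) = f x + f y"
    and "x \<in> U \<Longrightarrow> f (s c x) = s' (\<sigma> c) (f x)"
  using assms unfolding semilinear_on_def by auto

lemma semilinear_on_subset: "semilinear_on \<sigma> s s' U f \<Longrightarrow> T \<subseteq> U \<Longrightarrow> semilinear_on \<sigma> s s' T f"
  unfolding semilinear_on_def by blast

lemma semilinear_on_zero:
  assumes "semilinear_on \<sigma> s s' U f" "(0::'a::ab_group_add) \<in> U"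
  shows "f 0 = (0::'b::ab_group_add)"
proof -
  have "f (0 + 0) = f 0 + f 0" using assms unfolding semilinear_on_def by blast
  then show ?thesis by simp
qed

lemma semilinear_on_sum:
  assumes f: "semilinear_on \<sigma> s s' U f" and "vector_space s" "module.subspace s U"
    and "finite A" "\<And>a. a \<in> A \<Longrightarrow> g a \<in> U"
  shows "f (\<Sum>a\<in>A. s (c a) (g a)) = (\<Sum>a\<in>A. s' (\<sigma> (c a)) (f (g a)))"
proof -
  interpret vector_space s by fact
  show ?thesis
    using assms(4,5)
  proof (induction A)
    case empty
    then show ?case using semilinear_on_zero[OF f subspace_0[OF assms(3)]] by simp
  next
    case (insert a A)
    have "s (c a) (g a) \<in> U" "(\<Sum>a\<in>A. s (c a) (g a)) \<in> U"
      using insert assms(3) by (auto intro!: subspace_scale subspace_sum)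
    then show ?case using insert semilinear_onD[OF f] by simp
  qed
qed

lemma semilinear_on_diff:
  fixes f :: "'a::ab_group_add \<Rightarrow> 'b::ab_group_add"
  assumes f: "semilinear_on \<sigma> s s' U f" and "vector_space s" "module.subspace s U"
    and "x \<in> U" "y \<in> U"
  shows "f (x - y) = f x - f y"
proof -
  interpret vector_space s by fact
  have "x - y \<in> U" using assms subspace_diff by blast
  from semilinear_onD(1)[OF f this \<open>y \<in> U\<close>] show ?thesis by simp
qed

text \<open>The definitions constrain a map only on a subspace. A basis of that subspace determines
  a total linear map with the same values there, so that results about
  \<open>Vector_Spaces.linear\<close> become applicable.\<close>

lemma linear_map_on_extend:
  assumes "vector_space s1" "vector_space s2" "module.subspace s1 E" "linear_map_on s1 s2 E f"
  obtains g where "Vector_Spaces.linear s1 s2 g" "\<And>x. x \<in> E \<Longrightarrow> g x = f x"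
proof -
  interpret vs1: vector_space s1 by fact
  interpret vs2: vector_space s2 by fact
  interpret vector_space_pair s1 s2 ..
  obtain A where A: "A \<subseteq> E" "vs1.independent A" "E \<subseteq> vs1.span A"
    using vs1.maximal_independent_subset[of E] by auto
  obtain g where g: "Vector_Spaces.linear s1 s2 g" "\<forall>x\<in>A. g x = f x"
    using linear_independent_extend[OF A(2)] by blast
  interpret g: Vector_Spaces.linear s1 s2 g by fact
  have "g x = f x" if "x \<in> E" for x
  proof -
    have "x \<in> vs1.span A" using that A by blast
    then have "x \<in> E \<and> g x = f x"
    proof (induction rule: vs1.span_induct_alt)
      case base
      then show ?case using semilinear_on_zero[OF assms(4)] vs1.subspace_0[OF assms(3)]
        by (simp add: g.zero)
    next
      case (step c a y)
      then have "a \<in> E" "s1 c a \<in> E" using A assms(3) vs1.subspace_scale by auto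
      then show ?case using step assms(3,4) g(2)
        by (auto simp: g.add g.scale semilinear_onD[OF assms(4)] vs1.subspace_add)
    qed
    then show ?thesis by simp
  qed
  with g that show ?thesis by blast
qed

context vector_space
begin

lemma finite_dimensional_basis:
  assumes "finite_dimensional scale S"
  obtains B where "finite B" "independent B" "B \<subseteq> S" "span B = S" "card B = dim S"
proof -
  obtain C where C: "finite C" "span C = S" using assms unfolding finite_dimensional_def by blast
  obtain B where B: "B \<subseteq> C" "independent B" "C \<subseteq> span B"
    using maximal_independent_subset[of C] by auto
  have "span B = S" using B C by (metis span_eq span_superset subset_trans)
  then show ?thesis
    using that[of B] B C finite_subset[OF B(1)] dim_span_eq_card_independent[OF B(2)] span_superset
    by auto
qed

lemma finite_dimensional_subspace: "finite_dimensional scale S \<Longrightarrow> subspace S"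
  unfolding finite_dimensional_def using subspace_span by blast

lemma independent_card_bound:
  assumes "finite_dimensional scale S" "independent A" "A \<subseteq> S"
  shows "finite A" "card A \<le> dim S"
proof -
  obtain B where B: "finite B" "independent B" "span B = S" "card B = dim S"
    using finite_dimensional_basis[OF assms(1)] by metis
  have "A \<subseteq> span B" using assms B by simp
  from independent_span_bound[OF B(1) assms(2) this] B(4) show "finite A" "card A \<le> dim S" by auto
qed

lemma finite_dimensional_subset:
  assumes "finite_dimensional scale S" "subspace T" "T \<subseteq> S"
  shows "finite_dimensional scale T"
proof -
  obtain B where B: "B \<subseteq> T" "independent B" "T \<subseteq> span B"
    using maximal_independent_subset[of T] by auto
  have "finite B" using independent_card_bound(1)[OF assms(1) B(2)] B assms by blast
  moreover have "span B = T" using B assms span_subspace by blast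
  ultimately show ?thesis unfolding finite_dimensional_def by blast
qed

lemma independent_full_card_spans:
  assumes "finite_dimensional scale S" "independent A" "A \<subseteq> S" "dim S \<le> card A"
  shows "span A = S"
proof (rule ccontr)
  have S: "subspace S" using assms finite_dimensional_subspace by blast
  assume "span A \<noteq> S"
  then obtain x where x: "x \<in> S" "x \<notin> span A" using span_minimal[OF assms(3) S] by blast
  have i: "independent (insert x A)" using x assms independent_insertI by blast
  have "card (insert x A) \<le> dim S" using independent_card_bound(2)[OF assms(1) i] x assms by auto
  moreover have "x \<notin> A" using x span_base by blast
  ultimately show False
    using assms independent_card_bound(1)[OF assms(1-3)] by simp
qed

lemma dim_eq_0_imp:
  assumes "finite_dimensional scale S" "dim S = 0"
  shows "S = {0}"
proof -
  obtain B where B: "finite B" "span B = S" "card B = dim S"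
    using finite_dimensional_basis[OF assms(1)] by metis
  then have "B = {}" using assms by simp
  with B show ?thesis by auto
qed

text \<open>The second claim is the form in which equal dimensions in different degrees turn an
  injective operator into an invertible one.\<close>

lemma injective_map_dim:
  assumes E: "finite_dimensional scale E" and E': "finite_dimensional scale E'"
    and f: "linear_map_on scale scale E f" "f ` E \<subseteq> E'" "\<And>x. x \<in> E \<Longrightarrow> f x = 0 \<Longrightarrow> x = 0"
  shows "dim E \<le> dim E'" "dim E' \<le> dim E \<Longrightarrow> f ` E = E'"
proof -
  have sE: "subspace E" using E finite_dimensional_subspace by blast
  have vs: "vector_space scale" by (rule vector_space_axioms)
  obtain g where g: "Vector_Spaces.linear scale scale g" "\<And>x. x \<in> E \<Longrightarrow> g x = f x"
    using linear_map_on_extend[OF vs vs sE f(1)] by blast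
  interpret g: Vector_Spaces.linear scale scale g by fact
  obtain B where B: "finite B" "independent B" "B \<subseteq> E" "span B = E" "card B = dim E"
    using finite_dimensional_basis[OF E] by blast
  have inj: "inj_on g (span B)"
    unfolding B using g f(3) by (subst g.inj_on_iff_eq_0[OF sE]) auto
  have i: "independent (g ` B)" using g.independent_injective_image[OF B(2) inj] .
  have c: "card (g ` B) = dim E"
    using B inj card_image[of g B] inj_on_subset[OF inj span_superset] by simp
  have sub: "g ` B \<subseteq> E'" using B g f by fastforce
  show "dim E \<le> dim E'" using independent_card_bound(2)[OF E' i sub] c by simp
  assume "dim E' \<le> dim E"
  then have "span (g ` B) = E'" using independent_full_card_spans[OF E' i sub] c by simp
  then have "g ` E = E'" using g.span_image[of B] B by simp
  then show "f ` E = E'" using g(2) by (metis image_cong)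
qed

end

subsection \<open>Pencils of linear maps over an algebraically closed field\<close>

lemma vector_space_poly_smult: "vector_space (Polynomial.smult :: 'k::field \<Rightarrow> 'k poly \<Rightarrow> 'k poly)"
  by unfold_locales (auto simp: smult_add_right smult_add_left)

lemma independent_monoms:
  "\<not> module.dependent (Polynomial.smult :: 'k::field \<Rightarrow> 'k poly \<Rightarrow> 'k poly) (range (monom 1))"
proof -
  interpret vector_space "Polynomial.smult :: 'k \<Rightarrow> 'k poly \<Rightarrow> 'k poly"
    by (rule vector_space_poly_smult)
  show ?thesis
    unfolding independent_explicit_module
  proof (intro allI impI)
    fix t :: "'k poly set" and u v
    assume t: "finite t" "t \<subseteq> range (monom 1)" "(\<Sum>v\<in>t. Polynomial.smult (u v) v) = 0" "v \<in> t"
    then obtain i where v: "v = monom 1 i" by auto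
    have "coeff w i = 0" if "w \<in> t - {v}" for w
      using that t(2) v by (auto simp: coeff_monom)
    then have "(\<Sum>w\<in>t. u w * coeff w i) = u v * coeff v i"
      using t(1,4) by (subst sum.remove[of _ v]) auto
    moreover have "(\<Sum>w\<in>t. u w * coeff w i) = coeff (\<Sum>v\<in>t. Polynomial.smult (u v) v) i"
      by (simp add: coeff_sum)
    ultimately show "u v = 0" using t(3) v by simp
  qed
qed

text \<open>Among the nonzero polynomials p with p(T) x0 = 0, one of least degree has a root c.
  Writing p = (X - c) q, the vector q(T) x0 is nonzero by minimality and is killed by T - c.\<close>

lemma eigenvector_exists:
  fixes s :: "'l::alg_closed_field \<Rightarrow> 'e::ab_group_add \<Rightarrow> 'e"
  assumes "vector_space s" and fd: "finite_dimensional s E" and ne: "E \<noteq> {0}"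
    and T: "linear_map_on s s E T" "T ` E \<subseteq> E"
  obtains c x where "x \<in> E" "x \<noteq> 0" "T x = s c x"
proof -
  interpret vector_space s by fact
  have sE: "subspace E" using fd finite_dimensional_subspace by blast
  obtain g where g: "Vector_Spaces.linear s s g" "\<And>x. x \<in> E \<Longrightarrow> g x = T x"
    using linear_map_on_extend[OF assms(1) assms(1) sE T(1)] by blast
  interpret g: Vector_Spaces.linear s s g by fact
  obtain x0 where x0: "x0 \<in> E" "x0 \<noteq> 0" using ne subspace_0[OF sE] by blast
  \<comment> \<open>\<open>act p\<close> is p(T) x0, evaluated by Horner's scheme.\<close>
  define act where "act p = fold_coeffs (\<lambda>a r. s a x0 + g r) p 0" for p
  have act_0 [simp]: "act 0 = 0" by (simp add: act_def)
  have act_pCons [simp]: "act (pCons a p) = s a x0 + g (act p)" for a p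
    unfolding act_def by (cases "a = 0 \<and> p = 0") (auto simp: g.zero)
  have act_add: "act (p + q) = act p + act q" for p q
    by (induction p q rule: poly_induct2) (auto simp: g.add scale_left_distrib)
  have act_smult: "act (Polynomial.smult c p) = s c (act p)" for c p
    by (induction p) (auto simp: g.scale scale_right_distrib)
  have act_E: "act p \<in> E" for p
    using T(2) by (induction p) (auto simp: g(2) subspace_0[OF sE] x0 intro!: subspace_add[OF sE] subspace_scale[OF sE])
  \<comment> \<open>Otherwise \<open>act\<close> would embed the infinite dimensional space of
    polynomials into E.\<close>
  have "\<exists>p. p \<noteq> 0 \<and> act p = 0"
  proof (rule ccontr)
    assume inj: "\<not> ?thesis"
    interpret p: vector_space "Polynomial.smult :: 'l \<Rightarrow> 'l poly \<Rightarrow> 'l poly"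
      by (rule vector_space_poly_smult)
    interpret act: Vector_Spaces.linear Polynomial.smult s act
      by unfold_locales (auto simp: act_add act_smult)
    have "inj act" using inj act.inj_iff_eq_0 by blast
    then have "independent (act ` range (monom 1))"
      using act.independent_injective_image[OF independent_monoms] inj_on_subset by blast
    then have "finite (act ` range (monom 1))"
      using independent_card_bound(1)[OF fd] act_E by blast
    then have "finite (range (monom (1::'l)))"
      using \<open>inj act\<close> by (metis finite_imageD inj_on_subset subset_UNIV)
    moreover have "inj (monom (1::'l))"
      by (simp add: inj_def monom_eq_iff')
    ultimately show False using finite_imageD infinite_UNIV_nat by blast
  qed
  then obtain p where p: "p \<noteq> 0 \<and> act p = 0"
    and min: "\<And>q. q \<noteq> 0 \<and> act q = 0 \<Longrightarrow> degree p \<le> degree q"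
    using ex_has_least_nat[of "\<lambda>p. p \<noteq> 0 \<and> act p = 0" _ degree] by blast
  have "degree p > 0"
  proof (rule ccontr)
    assume "\<not> degree p > 0"
    then obtain a where "p = [:a:]" using degree_eq_zeroE by blast
    then show False using p x0 by (auto simp: g.zero)
  qed
  then obtain c where "poly p c = 0" using alg_closed_imp_poly_has_root by blast
  then obtain q where q: "p = [:-c, 1:] * q" using poly_eq_0_iff_dvd by (metis dvdE)
  with p have "q \<noteq> 0" by auto
  have "degree p = Suc (degree q)"
    unfolding q using \<open>q \<noteq> 0\<close> by (subst degree_mult_eq) auto
  then have "act q \<noteq> 0" using min[of q] \<open>q \<noteq> 0\<close> by auto
  have "p = pCons 0 q + Polynomial.smult (- c) q" using q by simp
  then have "act p = g (act q) - s c (act q)" by (simp only: act_add act_pCons act_smult) simp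
  then have "T (act q) = s c (act q)" using p g(2)[OF act_E] by simp
  then show ?thesis using that act_E \<open>act q \<noteq> 0\<close> by blast
qed

text \<open>The dimensions force the injective B to be bijective, so an eigenvector of
  \<open>B\<^sup>-\<^sup>1 A\<close> does it.\<close>

lemma pencil_eigenvector:
  fixes s :: "'l::alg_closed_field \<Rightarrow> 'e::ab_group_add \<Rightarrow> 'e"
  assumes vs: "vector_space s" and fd: "finite_dimensional s E" "finite_dimensional s E'"
    and dim: "vector_space.dim s E' \<le> vector_space.dim s E" and ne: "E \<noteq> {0}"
    and A: "linear_map_on s s E A" "A ` E \<subseteq> E'"
    and B: "linear_map_on s s E B" "B ` E \<subseteq> E'" "\<And>x. x \<in> E \<Longrightarrow> B x = 0 \<Longrightarrow> x = 0"
  obtains c x where "x \<in> E" "x \<noteq> 0" "A x = s c (B x)"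
proof -
  interpret vector_space s by fact
  have sE: "subspace E" using fd finite_dimensional_subspace by blast
  have img: "B ` E = E'" using injective_map_dim(2)[OF fd B dim] .
  have inj: "inj_on B E"
  proof (rule inj_onI)
    fix x y assume "x \<in> E" "y \<in> E" "B x = B y"
    then have "x - y \<in> E" "B (x - y) = 0"
      using subspace_diff[OF sE] semilinear_on_diff[OF B(1) vs sE] by auto
    then show "x = y" using B(3) by fastforce
  qed
  define T where "T = (\<lambda>x. inv_into E B (A x))"
  have T_E: "T x \<in> E" and BT: "B (T x) = A x" if "x \<in> E" for x
    using that A(2) img inv_into_into[of "A x" B E] f_inv_into_f[of "A x" B E]
    unfolding T_def by blast+
  have "linear_map_on s s E T"
    unfolding semilinear_on_def
  proof (intro conjI ballI allI)
    fix x y c assume x: "x \<in> E"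
    have "B (T (s c x)) = B (s c (T x))" "s c x \<in> E" "s c (T x) \<in> E"
      using x BT T_E semilinear_onD[OF A(1)] semilinear_onD[OF B(1)] subspace_scale[OF sE] by simp_all
    then show "T (s c x) = s c (T x)" using inj T_E inj_onD by metis
    assume y: "y \<in> E"
    have "B (T (x + y)) = B (T x + T y)" "x + y \<in> E" "T x + T y \<in> E"
      using x y BT T_E semilinear_onD[OF A(1)] semilinear_onD[OF B(1)] subspace_add[OF sE] by simp_all
    then show "T (x + y) = T x + T y" using inj T_E inj_onD by metis
  qed
  moreover have "T ` E \<subseteq> E" using T_E by blast
  ultimately obtain c x where x: "x \<in> E" "x \<noteq> 0" "T x = s c x"
    using eigenvector_exists[OF vs fd(1) ne] by metis
  then have "A x = s c (B x)" using BT semilinear_onD(2)[OF B(1)] by metis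
  with x that show ?thesis by blast
qed

text \<open>Eigenvectors for distinct eigenvalues are independent. Here B takes the place of the
  identity, and its injectivity allows cancelling it from a relation.\<close>

lemma pencil_eigenvalues_finite:
  fixes s :: "'l::field \<Rightarrow> 'e::ab_group_add \<Rightarrow> 'e"
  assumes vs: "vector_space s" and fd: "finite_dimensional s E"
    and A: "linear_map_on s s E A"
    and B: "linear_map_on s s E B" "\<And>x. x \<in> E \<Longrightarrow> B x = 0 \<Longrightarrow> x = 0"
    and M: "finite M" "\<And>c. c \<in> M \<Longrightarrow> \<exists>x\<in>E. x \<noteq> 0 \<and> A x = s c (B x)"
  shows "card M \<le> vector_space.dim s E"
proof -
  interpret vector_space s by fact
  have sE: "subspace E" using fd finite_dimensional_subspace by blast
  obtain y where y: "\<And>c. c \<in> M \<Longrightarrow> y c \<in> E \<and> y c \<noteq> 0 \<and> A (y c) = s c (B (y c))"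
    using M(2) by metis
  have "independent (y ` N) \<and> inj_on y N" if "finite N" "N \<subseteq> M" for N
    using that
  proof (induction N)
    case empty
    then show ?case by (simp add: independent_empty)
  next
    case (insert m N)
    then have IH: "independent (y ` N)" "inj_on y N" by auto
    have yN: "\<And>c. c \<in> N \<Longrightarrow> y c \<in> E" using insert y by blast
    have "y m \<notin> span (y ` N)"
    proof
      assume "y m \<in> span (y ` N)"
      then obtain u where u: "y m = (\<Sum>v\<in>y ` N. s (u v) v)"
        using span_finite[of "y ` N"] insert by auto
      then have ym: "y m = (\<Sum>c\<in>N. s (u (y c)) (y c))"
        using IH by (simp add: sum.reindex)
      \<comment> \<open>A (y m) is computed in two ways, termwise and through the eigenvalue m; the
        difference is a relation with coefficients u (c - m).\<close>
      have "A (y m) = (\<Sum>c\<in>N. s (u (y c)) (s c (B (y c))))"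
        unfolding ym using insert y yN by (subst semilinear_on_sum[OF A vs sE]) (auto intro!: sum.cong)
      moreover have "A (y m) = (\<Sum>c\<in>N. s (u (y c)) (s m (B (y c))))"
      proof -
        have "A (y m) = s m (B (y m))" using y insert by blast
        also have "B (y m) = (\<Sum>c\<in>N. s (u (y c)) (B (y c)))"
          unfolding ym using insert y yN by (subst semilinear_on_sum[OF B(1) vs sE]) auto
        finally show ?thesis by (simp add: scale_sum_right mult.commute)
      qed
      ultimately have "(\<Sum>c\<in>N. s (u (y c) * (c - m)) (B (y c))) = 0"
        by (simp add: sum_subtractf scale_left_diff_distrib right_diff_distrib)
      then have "B (\<Sum>c\<in>N. s (u (y c) * (c - m)) (y c)) = 0"
        using insert yN by (subst semilinear_on_sum[OF B(1) vs sE]) auto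
      moreover have "(\<Sum>c\<in>N. s (u (y c) * (c - m)) (y c)) \<in> E"
        using yN by (intro subspace_sum[OF sE] subspace_scale[OF sE])
      ultimately have "(\<Sum>c\<in>N. s (u (y c) * (c - m)) (y c)) = 0" using B(2) by blast
      \<comment> \<open>\<open>independentD\<close> expects coefficients indexed by vectors, so the
        eigenvalue of v is recovered as \<open>inv_into N y v\<close>.\<close>
      moreover have "(\<Sum>v\<in>y ` N. s (u v * (inv_into N y v - m)) v) = (\<Sum>c\<in>N. s (u (y c) * (c - m)) (y c))"
        using IH(2) by (simp add: sum.reindex)
      ultimately have "(\<Sum>v\<in>y ` N. s (u v * (inv_into N y v - m)) v) = 0" by simp
      then have "u (y c) * (c - m) = 0" if "c \<in> N" for c
        using independentD[OF IH(1), of "y ` N" "\<lambda>v. u v * (inv_into N y v - m)" "y c"]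
          insert that IH(2) by auto
      then have "u (y c) = 0" if "c \<in> N" for c using that insert by auto
      then have "y m = 0" unfolding ym by simp
      then show False using y insert by blast
    qed
    moreover from this have "y m \<notin> y ` N" using span_base by blast
    ultimately show ?case using IH insert(2) independent_insertI by (auto simp: inj_on_insert)
  qed
  from this[OF M(1)] have i: "independent (y ` M)" "inj_on y M" by auto
  have "y ` M \<subseteq> E" using y by blast
  from independent_card_bound(2)[OF fd i(1) this] i(2) show ?thesis by (simp add: card_image)
qed

text \<open>
  The elementary substitute for the Nullstellensatz: on large degrees \<open>B\<close> is an isomorphism, and an
  eigenvalue \<open>c\<close> of \<open>B\<^sup>-\<^sup>1 A\<close> in one degree is one in all higher degrees.
\<close>

lemma commuting_pencil_degenerates:
  fixes s :: "'l::alg_closed_field \<Rightarrow> 'e::ab_group_add \<Rightarrow> 'e" and D :: "nat \<Rightarrow> 'e set"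
  assumes vs: "vector_space s" and fd: "\<And>p. finite_dimensional s (D p)"
    and A: "\<And>p. linear_map_on s s (D (Suc p)) A" "\<And>p. A ` D (Suc p) \<subseteq> D p"
    and B: "\<And>p. linear_map_on s s (D (Suc p)) B" "\<And>p. B ` D (Suc p) \<subseteq> D p"
    and comm: "\<And>p x. x \<in> D (Suc (Suc p)) \<Longrightarrow> A (B x) = B (A x)"
    and inf: "\<And>N. \<exists>p\<ge>N. D p \<noteq> {0}"
    and inj: "\<And>p x. p \<ge> N \<Longrightarrow> x \<in> D (Suc p) \<Longrightarrow> B x = 0 \<Longrightarrow> x = 0"
  shows "\<exists>c. \<forall>N. \<exists>p\<ge>N. \<exists>x\<in>D (Suc p). x \<noteq> 0 \<and> A x = s c (B x)"
proof -
  interpret vector_space s by fact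
  have sD: "\<And>p. subspace (D p)" using fd finite_dimensional_subspace by blast
  \<comment> \<open>B is injective from degree N on, so dimensions cannot grow with the degree. From
    the degree P of least dimension on they are constant and B is bijective.\<close>
  have dec: "dim (D (Suc p)) \<le> dim (D p)" if "p \<ge> N" for p
    using injective_map_dim(1)[OF fd fd B(1) B(2)] inj that by blast
  have dec': "dim (D q) \<le> dim (D p)" if "p \<ge> N" "q \<ge> p" for p q
    using that(2,1) by (induction q rule: dec_induct) (auto intro: order_trans[OF dec])
  obtain P where P: "P \<ge> N" and minP: "\<And>q. q \<ge> N \<Longrightarrow> dim (D P) \<le> dim (D q)"
    using ex_has_least_nat[of "\<lambda>p. p \<ge> N" N "\<lambda>p. dim (D p)"] by blast
  have eq: "dim (D q) = dim (D P)" if "q \<ge> P" for q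
    using dec'[OF P that] minP[of q] P that by auto
  have surj: "B ` D (Suc q) = D q" if "q \<ge> P" for q
  proof -
    have "q \<ge> N" "dim (D q) \<le> dim (D (Suc q))" using that P eq[of q] eq[of "Suc q"] by auto
    then show ?thesis using injective_map_dim(2)[OF fd fd B(1) B(2), of q] inj[of q] by blast
  qed
  have ne: "D q \<noteq> {0}" if "q \<ge> P" for q
  proof
    assume "D q = {0}"
    then have "dim (D P) = 0" using eq[OF that] dim_eq_card_independent[of "{}"] dim_span[of "{}"]
      by (simp add: independent_empty)
    moreover obtain q' where "q' \<ge> P" "D q' \<noteq> {0}" using inf by blast
    ultimately show False using eq[of q'] dim_eq_0_imp[OF fd, of q'] by simp
  qed
  obtain c x where cx: "x \<in> D (Suc P)" "x \<noteq> 0" "A x = s c (B x)"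
  proof (rule pencil_eigenvector[OF vs fd fd _ _ A B])
    show "dim (D P) \<le> dim (D (Suc P))" using eq[of "Suc P"] by simp
    show "D (Suc P) \<noteq> {0}" using ne[of "Suc P"] by simp
    show "x = 0" if "x \<in> D (Suc P)" "B x = 0" for x using inj[OF P that] .
  qed blast
  have "\<exists>x\<in>D (Suc q). x \<noteq> 0 \<and> A x = s c (B x)" if "q \<ge> P" for q
    using that
  proof (induction q rule: dec_induct)
    case base
    then show ?case using cx by blast
  next
    case (step q)
    then obtain x where x: "x \<in> D (Suc q)" "x \<noteq> 0" "A x = s c (B x)" by blast
    then obtain y where y: "y \<in> D (Suc (Suc q))" "x = B y" using surj[of "Suc q"] step by force
    have By: "B y \<in> D (Suc q)" "A y \<in> D (Suc q)" using y A B by blast+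
    \<comment> \<open>The eigenvector x has been pulled back to y with B y = x. Commutation shows
      that B kills A y - c B y, and B is injective.\<close>
    have "B (A y - s c (B y)) = B (A y) - s c (B (B y))"
      using By semilinear_on_diff[OF B(1) vs sD] semilinear_onD(2)[OF B(1)] subspace_scale[OF sD]
      by metis
    also have "\<dots> = 0" using comm[OF y(1)] x y by simp
    finally have "A y - s c (B y) = 0"
      using inj[of q] step P By subspace_diff[OF sD] subspace_scale[OF sD] by (meson le_trans)
    moreover have "y \<noteq> 0" using y x semilinear_on_zero[OF B(1)] subspace_0[OF sD] by metis
    ultimately show ?case using y by auto
  qed
  then show ?thesis by (metis nat_le_linear)
qed

text \<open>Take a maximal independent S whose common kernel is nonzero in arbitrarily high degrees.
  Were two directions l, m left modulo S, then l would be injective on that kernel in high degrees,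
  and the pencil of m and l would yield a combination that can be added to S.\<close>

lemma commuting_operators_hyperplane:
  fixes s :: "'l::alg_closed_field \<Rightarrow> 'e::ab_group_add \<Rightarrow> 'e" and D :: "nat \<Rightarrow> 'e set"
    and t :: "'l \<Rightarrow> 'v::ab_group_add \<Rightarrow> 'v" and act :: "'v \<Rightarrow> 'e \<Rightarrow> 'e"
  assumes vs: "vector_space s" and vt: "vector_space t" and fd: "\<And>p. finite_dimensional s (D p)"
    and fdL: "finite_dimensional t L"
    and act: "\<And>p v. v \<in> L \<Longrightarrow> linear_map_on s s (D (Suc p)) (act v)"
      "\<And>p v x. v \<in> L \<Longrightarrow> x \<in> D (Suc p) \<Longrightarrow> act v x \<in> D p"
      "\<And>p x. x \<in> D (Suc p) \<Longrightarrow> linear_map_on t s L (\<lambda>v. act v x)"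
    and comm: "\<And>p x u v. u \<in> L \<Longrightarrow> v \<in> L \<Longrightarrow> x \<in> D (Suc (Suc p)) \<Longrightarrow> act u (act v x) = act v (act u x)"
    and inf: "\<And>N. \<exists>p\<ge>N. D p \<noteq> {0}"
  obtains S v where "S \<subseteq> L" "v \<in> L" "L = module.span t (insert v S)"
    "\<And>N. \<exists>p\<ge>N. \<exists>x\<in>D (Suc p). x \<noteq> 0 \<and> (\<forall>u\<in>S. act u x = 0)"
proof -
  interpret vector_space s by fact
  interpret t: vector_space t by fact
  have sD: "\<And>p. subspace (D p)" using fd finite_dimensional_subspace by blast
  have sL: "t.subspace L" using fdL t.finite_dimensional_subspace by blast
  define Inf where "Inf S \<longleftrightarrow> (\<forall>N. \<exists>p\<ge>N. \<exists>x\<in>D (Suc p). x \<noteq> 0 \<and> (\<forall>u\<in>S. act u x = 0))" for S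
  define Q where "Q S \<longleftrightarrow> S \<subseteq> L \<and> t.independent S \<and> Inf S" for S
  have "Q {}"
    unfolding Q_def Inf_def
  proof (intro conjI allI)
    fix N
    obtain p where p: "p \<ge> Suc N" "D p \<noteq> {0}" using inf by blast
    then obtain p' where "p = Suc p'" "p' \<ge> N" by (cases p) auto
    then show "\<exists>p\<ge>N. \<exists>x\<in>D (Suc p). x \<noteq> 0 \<and> (\<forall>u\<in>{}. act u x = 0)"
      using p subspace_0[OF sD] by fastforce
  qed (use t.independent_empty in auto)
  moreover have "\<forall>S. Q S \<longrightarrow> card S < Suc (t.dim L)"
    using t.independent_card_bound(2)[OF fdL] unfolding Q_def by (simp add: less_Suc_eq_le)
  ultimately obtain S where S: "Q S" and max: "\<And>S'. Q S' \<Longrightarrow> card S' \<le> card S"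
    using ex_has_greatest_nat[of Q "{}" card] by blast
  have fS: "finite S" using t.independent_card_bound(1)[OF fdL] S unfolding Q_def by blast
  have spanS: "t.span S \<subseteq> L" using S sL t.span_minimal unfolding Q_def by blast
  have big: "\<not> Inf (insert l S)" if "l \<in> L" "l \<notin> t.span S" for l
  proof
    assume "Inf (insert l S)"
    then have "Q (insert l S)" using S that t.independent_insertI unfolding Q_def by blast
    moreover have "l \<notin> S" using that t.span_base by blast
    ultimately show False using max[of "insert l S"] fS by simp
  qed
  show ?thesis
  proof (cases "L = t.span S")
    case True
    \<comment> \<open>If S already spans L, the extra vector v = 0 fits the conclusion.\<close>
    then have "L = t.span (insert 0 S)" by simp
    then show ?thesis using that[of S 0] S t.subspace_0[OF sL] unfolding Q_def Inf_def by blast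
  next
    case False
    then obtain l where l: "l \<in> L" "l \<notin> t.span S" using spanS by blast
    show ?thesis
    proof (cases "L = t.span (insert l S)")
      case True
      then show ?thesis using that[of S l] S l unfolding Q_def Inf_def by blast
    next
      case False
      moreover have "t.span (insert l S) \<subseteq> L" using l S sL t.span_minimal unfolding Q_def by blast
      ultimately obtain m where m: "m \<in> L" "m \<notin> t.span (insert l S)" by blast
      define E where "E p = {x \<in> D (Suc p). \<forall>u\<in>S. act u x = 0}" for p
      have SL: "\<And>u. u \<in> S \<Longrightarrow> u \<in> L" using S unfolding Q_def by blast
      have ED: "\<And>p. E p \<subseteq> D (Suc p)" unfolding E_def by blast
      have sE: "subspace (E p)" for p
        unfolding subspace_def E_def
        using SL subspace_0[OF sD] subspace_add[OF sD] subspace_scale[OF sD]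
          semilinear_onD[OF act(1)] semilinear_on_zero[OF act(1)] by (auto; metis add_0 scale_zero_right)
      have fdE: "finite_dimensional s (E p)" for p
        using finite_dimensional_subset[OF fd sE] ED by blast
      have Elin: "linear_map_on s s (E (Suc p)) (act v)" if "v \<in> L" for p v
        using act(1)[OF that] ED semilinear_on_subset by blast
      have Emap: "act v ` E (Suc p) \<subseteq> E p" if "v \<in> L" for p v
        unfolding E_def using act(2)[OF that] comm[OF SL that]
          semilinear_on_zero[OF act(1)[OF that] subspace_0[OF sD]] by force
      have Einf: "\<exists>p\<ge>N. E p \<noteq> {0}" for N
        using S unfolding Q_def Inf_def E_def by blast
      \<comment> \<open>Maximality of S, applied to l, is exactly the eventual injectivity that the
        pencil argument asks for.\<close>
      obtain N where N: "\<And>p x. p \<ge> N \<Longrightarrow> x \<in> D (Suc p) \<Longrightarrow> (\<forall>u\<in>insert l S. act u x = 0) \<Longrightarrow> x = 0"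
        using big[OF l] unfolding Inf_def by blast
      have "\<exists>c. \<forall>N. \<exists>p\<ge>N. \<exists>x\<in>E (Suc p). x \<noteq> 0 \<and> act m x = s c (act l x)"
      proof (rule commuting_pencil_degenerates[OF vs fdE Elin[OF m(1)] Emap[OF m(1)] Elin[OF l(1)] Emap[OF l(1)] _ Einf])
        show "act m (act l x) = act l (act m x)" if "x \<in> E (Suc (Suc p))" for p x
          using comm[OF m(1) l(1)] that ED by blast
        show "x = 0" if "p \<ge> N" "x \<in> E (Suc p)" "act l x = 0" for p x
          using that N[of "Suc p" x] unfolding E_def by simp
      qed
      then obtain c where c: "\<And>N. \<exists>p\<ge>N. \<exists>x\<in>E (Suc p). x \<noteq> 0 \<and> act m x = s c (act l x)" by blast
      \<comment> \<open>This is the degenerate member of the pencil. It lies outside the span of S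
        because m lies outside the span of S and l.\<close>
      define k where "k = m - t c l"
      have k: "k \<in> L" using m l sL t.subspace_diff t.subspace_scale unfolding k_def by blast
      have "k \<notin> t.span S"
        using m(2) t.span_breakdown_eq[of m l S] unfolding k_def by blast
      moreover have "Inf (insert k S)"
        unfolding Inf_def
      proof
        fix N
        obtain p x where p: "p \<ge> N" "x \<in> E (Suc p)" "x \<noteq> 0" "act m x = s c (act l x)" using c by blast
        have x: "x \<in> D (Suc (Suc p))" using p ED by blast
        have "act k x = 0" unfolding k_def
          using p(4) semilinear_on_diff[OF act(3)[OF x] vt sL m(1) t.subspace_scale[OF sL l(1)]]
            semilinear_onD(2)[OF act(3)[OF x] l(1)] by simp
        then show "\<exists>p\<ge>N. \<exists>x\<in>D (Suc p). x \<noteq> 0 \<and> (\<forall>u\<in>insert k S. act u x = 0)"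
          using p x unfolding E_def by (intro exI[of _ "Suc p"]) auto
      qed
      ultimately show ?thesis using big[OF k] by blast
    qed
  qed
qed

text \<open>
  If \<open>b\<^sup>i x\<close> is the last nonzero term of its sequence, then \<open>l = - i\<close>; if \<open>a\<^sup>j x\<close> is, then \<open>l = j + 1\<close>.
  In characteristic zero this cannot happen to both sequences.
\<close>

lemma heisenberg_chain:
  fixes s :: "'l::field_char_0 \<Rightarrow> 'e::ab_group_add \<Rightarrow> 'e" and D :: "nat \<Rightarrow> 'e set"
  assumes vs: "vector_space s" and sD: "\<And>p. module.subspace s (D p)"
    and a: "\<And>p. linear_map_on s s (D (Suc p)) a" "\<And>p x. x \<in> D (Suc p) \<Longrightarrow> a x \<in> D p"
    and b: "\<And>p. linear_map_on s s (D (Suc p)) b" "\<And>p x. x \<in> D (Suc p) \<Longrightarrow> b x \<in> D p"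
    and w: "\<And>p. linear_map_on s s (D (Suc (Suc p))) w" "\<And>p x. x \<in> D (Suc (Suc p)) \<Longrightarrow> w x \<in> D p"
    and ab: "\<And>p x. x \<in> D (Suc (Suc p)) \<Longrightarrow> a (b x) = b (a x) + w x"
    and wa: "\<And>p x. x \<in> D (Suc (Suc (Suc p))) \<Longrightarrow> w (a x) = a (w x)"
    and wb: "\<And>p x. x \<in> D (Suc (Suc (Suc p))) \<Longrightarrow> w (b x) = b (w x)"
    and inj: "\<And>p x. p \<ge> N \<Longrightarrow> x \<in> D (Suc (Suc p)) \<Longrightarrow> w x = 0 \<Longrightarrow> x = 0"
    and x: "x \<in> D p" "x \<noteq> 0" "a (b x) = s l (w x)" and p: "p \<ge> N + m + 2"
  shows "(\<forall>k\<le>m. (b ^^ k) x \<in> D (p - k) \<and> (b ^^ k) x \<noteq> 0 \<and>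
              a (b ((b ^^ k) x)) = s (l + of_nat k) (w ((b ^^ k) x))) \<or>
         (\<forall>k\<le>m. (a ^^ k) x \<in> D (p - k) \<and> (a ^^ k) x \<noteq> 0 \<and>
              a (b ((a ^^ k) x)) = s (l - of_nat k) (w ((a ^^ k) x)))"
proof -
  interpret vector_space s by fact
  have B: "(b ^^ k) x \<in> D (p - k) \<and> a (b ((b ^^ k) x)) = s (l + of_nat k) (w ((b ^^ k) x))"
    if "k \<le> m" for k
    using that
  proof (induction k)
    case 0
    then show ?case using x by simp
  next
    case (Suc k)
    let ?y = "(b ^^ k) x"
    obtain q where q: "p - k = Suc (Suc (Suc q))"
      using p Suc.prems that[of "p - k - 3"] by auto
    have y: "?y \<in> D (Suc (Suc (Suc q)))" "a (b ?y) = s (l + of_nat k) (w ?y)" using Suc q by auto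
    have "p - Suc k = Suc (Suc q)" using q by simp
    \<comment> \<open>Moving a past one more b adds one w, so the eigenvalue rises by one.\<close>
    have "a (b (b ?y)) = b (a (b ?y)) + w (b ?y)" using ab[of "b ?y" q] b(2)[OF y(1)] by simp
    also have "\<dots> = s (l + of_nat k) (b (w ?y)) + w (b ?y)"
      unfolding y(2) using semilinear_onD(2)[OF b(1)] w(2)[OF y(1)] by simp
    also have "\<dots> = s (l + of_nat (Suc k)) (w (b ?y))"
      using wb[OF y(1)] by (simp add: scale_left_distrib algebra_simps)
    finally show ?case using b(2)[OF y(1)] \<open>p - Suc k = _\<close> by simp
  qed
  have A: "(a ^^ k) x \<in> D (p - k) \<and> a (b ((a ^^ k) x)) = s (l - of_nat k) (w ((a ^^ k) x))"
    if "k \<le> m" for k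
    using that
  proof (induction k)
    case 0
    then show ?case using x by simp
  next
    case (Suc k)
    let ?y = "(a ^^ k) x"
    obtain q where q: "p - k = Suc (Suc (Suc q))"
      using p Suc.prems that[of "p - k - 3"] by auto
    have y: "?y \<in> D (Suc (Suc (Suc q)))" "a (b ?y) = s (l - of_nat k) (w ?y)" using Suc q by auto
    have "p - Suc k = Suc (Suc q)" using q by simp
    \<comment> \<open>Here b a y = a b y - w y, so the eigenvalue drops by one.\<close>
    have "b (a ?y) = s (l - of_nat k - 1) (w ?y)" using ab[OF y(1)] y(2)
      by (simp add: scale_left_diff_distrib)
    then have "a (b (a ?y)) = s (l - of_nat k - 1) (a (w ?y))"
      using semilinear_onD(2)[OF a(1)] w(2)[OF y(1)] by simp
    also have "\<dots> = s (l - of_nat (Suc k)) (w (a ?y))"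
      using wa[OF y(1)] by (simp add: algebra_simps)
    finally show ?case using a(2)[OF y(1)] \<open>p - Suc k = _\<close> by simp
  qed
  \<comment> \<open>The summand 2 in the bound on p lets w, which lowers degrees by two, still land
    in degree at least N, where it is injective.\<close>
  have deg: "\<exists>q\<ge>N. p - k = Suc (Suc q)" if "k \<le> m" for k
    using p that by (intro exI[of _ "p - k - 2"]) auto
  show ?thesis
  proof (rule ccontr)
    assume "\<not> ?thesis"
    then obtain k k' where "k \<le> m" "(b ^^ k) x = 0" "k' \<le> m" "(a ^^ k') x = 0" using A B by blast
    then have ex: "\<exists>i. (b ^^ i) x = 0" "\<exists>i. (a ^^ i) x = 0" by blast+
    define i where "i = (LEAST i. (b ^^ i) x = 0)"
    define j where "j = (LEAST i. (a ^^ i) x = 0)"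
    have i0: "(b ^^ i) x = 0" "i \<le> m" and j0: "(a ^^ j) x = 0" "j \<le> m"
      unfolding i_def j_def using LeastI_ex[OF ex(1)] LeastI_ex[OF ex(2)]
        Least_le[of "\<lambda>i. (b ^^ i) x = 0"] Least_le[of "\<lambda>i. (a ^^ i) x = 0"]
        \<open>k \<le> m\<close> \<open>(b ^^ k) x = 0\<close> \<open>k' \<le> m\<close> \<open>(a ^^ k') x = 0\<close> le_trans by blast+
    obtain i' j' where ij: "i = Suc i'" "j = Suc j'" using i0 j0 x by (cases i; cases j) auto
    have ni: "(b ^^ i') x \<noteq> 0" and nj: "(a ^^ j') x \<noteq> 0"
      using not_less_Least[of i' "\<lambda>i. (b ^^ i) x = 0"] not_less_Least[of j' "\<lambda>i. (a ^^ i) x = 0"] ij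
      unfolding i_def j_def by simp_all
    have mi: "i' \<le> m" and mj: "j' \<le> m" using ij i0 j0 by auto
    obtain q where q: "q \<ge> N" "p - i' = Suc (Suc q)" using deg mi by blast
    have "w ((b ^^ i') x) \<noteq> 0" using inj[OF q(1)] B[OF mi] ni q(2) by auto
    moreover have "b ((b ^^ i') x) = 0" "a 0 = 0"
      using i0 ij semilinear_on_zero[OF a(1) subspace_0[OF sD]] by auto
    ultimately have l1: "l + of_nat i' = 0" using B[OF mi] by auto
    obtain q where q: "q \<ge> N" "p - j' = Suc (Suc q)" using deg mj by blast
    have "w ((a ^^ j') x) \<noteq> 0" using inj[OF q(1)] A[OF mj] nj q(2) by auto
    moreover have "a ((a ^^ j') x) = 0" "b 0 = 0"
      using j0 ij semilinear_on_zero[OF b(1) subspace_0[OF sD]] by auto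
    moreover have "a (b ((a ^^ j') x)) = b (a ((a ^^ j') x)) + w ((a ^^ j') x)"
      using ab A[OF mj] q(2) by auto
    ultimately have "s (l - of_nat j' - 1) (w ((a ^^ j') x)) = 0" "w ((a ^^ j') x) \<noteq> 0"
      using A[OF mj] by (auto simp: scale_left_diff_distrib)
    then have "l - of_nat j' - 1 = 0" using scale_eq_0_iff by blast
    then have "l = of_nat j' + 1" by (simp add: algebra_simps)
    with l1 have "of_nat (Suc (i' + j')) = (0::'l)" by (simp add: algebra_simps)
    then show False by (metis of_nat_eq_0_iff nat.distinct(1))
  qed
qed

text \<open>Were every D p with p \<ge> N nonzero, injectivity of w would make the dimensions
  nonincreasing along steps of two, hence eventually constant, say r. The pencil a b - c w then has
  an eigenvalue, and \<open>heisenberg_chain\<close> shifts it often enough: powers of w carry r + 1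
  distinct eigenvalues into one space of dimension r, which admits only r.\<close>

lemma heisenberg_finite:
  fixes s :: "'l::{alg_closed_field, field_char_0} \<Rightarrow> 'e::ab_group_add \<Rightarrow> 'e" and D :: "nat \<Rightarrow> 'e set"
  assumes vs: "vector_space s" and fd: "\<And>p. finite_dimensional s (D p)"
    and a: "\<And>p. linear_map_on s s (D (Suc p)) a" "\<And>p x. x \<in> D (Suc p) \<Longrightarrow> a x \<in> D p"
    and b: "\<And>p. linear_map_on s s (D (Suc p)) b" "\<And>p x. x \<in> D (Suc p) \<Longrightarrow> b x \<in> D p"
    and w: "\<And>p. linear_map_on s s (D (Suc (Suc p))) w" "\<And>p x. x \<in> D (Suc (Suc p)) \<Longrightarrow> w x \<in> D p"
    and ab: "\<And>p x. x \<in> D (Suc (Suc p)) \<Longrightarrow> a (b x) = b (a x) + w x"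
    and wa: "\<And>p x. x \<in> D (Suc (Suc (Suc p))) \<Longrightarrow> w (a x) = a (w x)"
    and wb: "\<And>p x. x \<in> D (Suc (Suc (Suc p))) \<Longrightarrow> w (b x) = b (w x)"
    and inj: "\<And>p x. p \<ge> N \<Longrightarrow> x \<in> D (Suc (Suc p)) \<Longrightarrow> w x = 0 \<Longrightarrow> x = 0"
  shows "\<exists>p\<ge>N. D p = {0}"
proof (rule ccontr)
  assume "\<not> ?thesis"
  then have ne: "\<And>p. p \<ge> N \<Longrightarrow> D p \<noteq> {0}" by blast
  interpret vector_space s by fact
  have sD: "\<And>p. subspace (D p)" using fd finite_dimensional_subspace by blast
  define e where "e k = dim (D (N + 2 * k))" for k
  have dec: "e (Suc k) \<le> e k" for k
    unfolding e_def using injective_map_dim(1)[OF fd fd w(1), of "N + 2 * k" "N + 2 * k"] w(2) inj[of "N + 2 * k"]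
    by (simp add: image_subset_iff)
  obtain k0 where k0: "\<And>k. e k0 \<le> e k" using ex_has_least_nat[of "\<lambda>_. True" 0 e] by blast
  have "e k \<le> e k0" if "k \<ge> k0" for k
    using that by (induction k rule: dec_induct) (auto intro: order_trans[OF dec])
  then have eq: "e k = e k0" if "k \<ge> k0" for k using k0 that by (simp add: le_antisym)
  define r where "r = e k0"
  define q where "q = N + 2 * k0"
  \<comment> \<open>The chain must have 2 r steps: only every second term has the parity of q + 2,
    and r + 1 such terms are wanted.\<close>
  define p where "p = q + 2 * r + 2"
  have p: "p = Suc (Suc (q + 2 * r))" "p = N + 2 * Suc (k0 + r)" "q + 2 * r = N + 2 * (k0 + r)"
    unfolding p_def q_def by simp_all
  have dims: "dim (D (q + 2 * r)) \<le> dim (D p)"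
    using eq[of "k0 + r"] eq[of "Suc (k0 + r)"] unfolding e_def p(2) p(3) by simp
  have Np: "N \<le> q + 2 * r" "N \<le> p" "N \<le> q" unfolding p_def q_def by auto
  have A: "linear_map_on s s (D (Suc (Suc i))) (\<lambda>x. a (b x))" for i
    unfolding semilinear_on_def using semilinear_onD[OF b(1)[of "Suc i"]] semilinear_onD[OF a(1)[of i]] b(2)[of _ "Suc i"] by simp
  obtain l x where x: "x \<in> D p" "x \<noteq> 0" "a (b x) = s l (w x)"
    unfolding p(1)
  proof (rule pencil_eigenvector[OF vs fd fd])
    show "dim (D (q + 2 * r)) \<le> dim (D (Suc (Suc (q + 2 * r))))" using dims unfolding p(1) .
    show "D (Suc (Suc (q + 2 * r))) \<noteq> {0}" using ne Np unfolding p(1) by blast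
    show "linear_map_on s s (D (Suc (Suc (q + 2 * r)))) (\<lambda>x. a (b x))" by (rule A)
    show "(\<lambda>x. a (b x)) ` D (Suc (Suc (q + 2 * r))) \<subseteq> D (q + 2 * r)" using a(2) b(2) by blast
    show "linear_map_on s s (D (Suc (Suc (q + 2 * r)))) w" by (rule w)
    show "w ` D (Suc (Suc (q + 2 * r))) \<subseteq> D (q + 2 * r)" using w(2) by blast
    show "\<And>x. x \<in> D (Suc (Suc (q + 2 * r))) \<Longrightarrow> w x = 0 \<Longrightarrow> x = 0" using inj Np by blast
  qed blast
  define ev where "ev i c \<longleftrightarrow> (\<exists>x\<in>D (Suc (Suc (q + i))). x \<noteq> 0 \<and> a (b x) = s c (w x))" for i c
  \<comment> \<open>w commutes with a b and is injective here, so it carries an eigenvector two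
    degrees down with the same eigenvalue.\<close>
  have ev_down: "ev i c" if ev: "ev (Suc (Suc i)) c" for i c
  proof -
    obtain y where y: "y \<in> D (Suc (Suc (Suc (Suc (q + i)))))" "y \<noteq> 0" "a (b y) = s c (w y)"
      using ev unfolding ev_def by auto
    have "a (b (w y)) = s c (w (w y))"
    proof -
      have "b (w y) = w (b y)" using wb[OF y(1)] by simp
      also have "a \<dots> = w (a (b y))" using wa b(2)[OF y(1)] by simp
      also have "\<dots> = s c (w (w y))" unfolding y(3) using semilinear_onD(2)[OF w(1)] w(2)[OF y(1)] by simp
      finally show ?thesis .
    qed
    moreover have "w y \<noteq> 0" using inj[of "Suc (Suc (q + i))"] y Np by auto
    ultimately show ?thesis unfolding ev_def using w(2)[OF y(1)] by blast
  qed
  have ev_0: "ev 0 c" if "ev (2 * i) c" for i c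
    using that by (induction i) (auto dest: ev_down)
  have pN: "N + 2 * r + 2 \<le> p" unfolding p_def q_def by simp
  have ch: "(\<forall>k\<le>2 * r. (b ^^ k) x \<in> D (p - k) \<and> (b ^^ k) x \<noteq> 0 \<and>
              a (b ((b ^^ k) x)) = s (l + of_nat k) (w ((b ^^ k) x))) \<or>
         (\<forall>k\<le>2 * r. (a ^^ k) x \<in> D (p - k) \<and> (a ^^ k) x \<noteq> 0 \<and>
              a (b ((a ^^ k) x)) = s (l - of_nat k) (w ((a ^^ k) x)))"
    by (rule heisenberg_chain[where N = N and w = w, OF vs sD]; fact a b w ab wa wb inj x pN)
  have pd: "p - 2 * k = Suc (Suc (q + 2 * (r - k)))" if "k \<le> r" for k
    using that unfolding p_def by simp
  have "\<exists>f. inj_on f {..r} \<and> (\<forall>k\<le>r. ev 0 (f k))"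
    using ch
  proof (elim disjE)
    assume H: "\<forall>k\<le>2 * r. (b ^^ k) x \<in> D (p - k) \<and> (b ^^ k) x \<noteq> 0 \<and>
              a (b ((b ^^ k) x)) = s (l + of_nat k) (w ((b ^^ k) x))"
    have "ev 0 (l + of_nat (2 * k))" if "k \<le> r" for k
      using ev_0[of "r - k"] H[rule_format, of "2 * k"] that pd[OF that] unfolding ev_def by auto
    \<comment> \<open>Characteristic zero enters again: the shifts by 2 k are distinct.\<close>
    moreover have "inj_on (\<lambda>k. l + of_nat (2 * k)) {..r}" by (auto simp: inj_on_def)
    ultimately show ?thesis by blast
  next
    assume H: "\<forall>k\<le>2 * r. (a ^^ k) x \<in> D (p - k) \<and> (a ^^ k) x \<noteq> 0 \<and>
              a (b ((a ^^ k) x)) = s (l - of_nat k) (w ((a ^^ k) x))"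
    have "ev 0 (l - of_nat (2 * k))" if "k \<le> r" for k
      using ev_0[of "r - k"] H[rule_format, of "2 * k"] that pd[OF that] unfolding ev_def by auto
    moreover have "inj_on (\<lambda>k. l - of_nat (2 * k)) {..r}" by (auto simp: inj_on_def)
    ultimately show ?thesis by blast
  qed
  then obtain f where f: "inj_on f {..r}" "\<And>k. k \<le> r \<Longrightarrow> ev 0 (f k)" by blast
  have "card (f ` {..r}) \<le> dim (D (Suc (Suc q)))"
  proof (rule pencil_eigenvalues_finite[OF vs fd A w(1)])
    show "x = 0" if "x \<in> D (Suc (Suc q))" "w x = 0" for x using inj Np that by blast
    show "\<exists>x\<in>D (Suc (Suc q)). x \<noteq> 0 \<and> a (b x) = s c (w x)" if "c \<in> f ` {..r}" for c
      using f(2) that unfolding ev_def by auto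
  qed simp
  also have "\<dots> = r"
    using eq[of "Suc k0"] unfolding e_def r_def q_def by simp
  finally show False using f(1) by (simp add: card_image)
qed

subsection \<open>Graded Lie algebras of depth two\<close>

context lie_algebra
begin

lemma linear_right: "x \<in> L \<Longrightarrow> linear_map_on s s L (br x)"
  and linear_left: "y \<in> L \<Longrightarrow> linear_map_on s s L (\<lambda>x. br x y)"
  using bilinear unfolding bilinear_map_on_def by auto

lemmas add_right = semilinear_onD(1)[OF linear_right]
  and add_left = semilinear_onD(1)[OF linear_left]
  and scale_right = semilinear_onD(2)[OF linear_right]
  and scale_left = semilinear_onD(2)[OF linear_left]

lemma zero_right: "x \<in> L \<Longrightarrow> br x 0 = 0"
  and zero_left: "x \<in> L \<Longrightarrow> br 0 x = 0"
  using semilinear_on_zero[OF linear_right] semilinear_on_zero[OF linear_left] subspace_0[OF subspace_L]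
  by auto

lemma anticommute: "x \<in> L \<Longrightarrow> y \<in> L \<Longrightarrow> br x y = - br y x"
proof -
  assume x: "x \<in> L" and y: "y \<in> L"
  have "br (x + y) (x + y) = 0" using alternating subspace_add[OF subspace_L] x y by blast
  then have "br x y + br y x = 0"
    using add_left[of "x + y" x y] add_right[of x x y] add_right[of y x y] x y
      subspace_add[OF subspace_L] alternating by simp
  then show ?thesis using eq_neg_iff_add_eq_0 by blast
qed

lemma minus_right: "x \<in> L \<Longrightarrow> y \<in> L \<Longrightarrow> br x (- y) = - br x y"
  using scale_right[of x y "-1"] by simp

lemma derivation:
  assumes "u \<in> L" "v \<in> L" "x \<in> L"
  shows "br u (br v x) = br (br u v) x + br v (br u x)"
proof -
  have "br x (br u v) = - br (br u v) x" "br v (br x u) = - br v (br u x)"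
    using assms closed anticommute[of x "br u v"] anticommute[of x u] minus_right by auto
  then have "br u (br v x) + - br v (br u x) + - br (br u v) x = 0" using jacobi[OF assms] by simp
  then show ?thesis by (simp add: algebra_simps)
qed

lemma annihilates_span:
  assumes "x \<in> L" "S \<subseteq> L" "\<And>u. u \<in> S \<Longrightarrow> br u x = 0" "v \<in> span S"
  shows "br v x = 0"
proof -
  have "span S \<subseteq> {u \<in> L. br u x = 0}"
    using assms(1-3) subspace_L
    by (intro span_minimal) (auto simp: subspace_def zero_left add_left scale_left)
  then show ?thesis using assms(4) by blast
qed

end

context graded_lie_algebra
begin

lemma cmp_subset: "x \<in> G p \<Longrightarrow> x \<in> sum_cmp s UNIV G"
  unfolding sum_cmp_def by (intro span_base) auto

lemma bracket_cmp': "x \<in> G p \<Longrightarrow> y \<in> G q \<Longrightarrow> p + q = r \<Longrightarrow> br x y \<in> G r"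
  using bracket_cmp by blast

lemma linear_cmp: "v \<in> G q \<Longrightarrow> linear_map_on s s (G p) (br v)"
  using linear_right[OF cmp_subset] by (rule semilinear_on_subset) (auto intro: cmp_subset)

lemma linear_cmp': "v \<in> G q \<Longrightarrow> linear_map_on s s (G p) (\<lambda>x. br x v)"
  using linear_left[OF cmp_subset] by (rule semilinear_on_subset) (auto intro: cmp_subset)

lemmas derivation_cmp = derivation[OF cmp_subset cmp_subset cmp_subset]

definition annihilator where
  "annihilator S p = {x \<in> G p. \<forall>u\<in>S. br u x = 0}"

lemma annihilator_subset: "annihilator S p \<subseteq> G p"
  unfolding annihilator_def by blast

lemma subspace_annihilator:
  assumes "S \<subseteq> G q"
  shows "subspace (annihilator S p)"
proof -
  have "linear_map_on s s (G p) (br u)" if "u \<in> S" for u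
    using linear_cmp assms that by blast
  from semilinear_onD[OF this] semilinear_on_zero[OF this] show ?thesis
    using subspace_cmp[of p]
    unfolding annihilator_def subspace_def by auto
qed

lemma finite_dimensional_annihilator:
  assumes "S \<subseteq> G q" "finite_dimensional s (G p)"
  shows "finite_dimensional s (annihilator S p)"
  using finite_dimensional_subset[OF assms(2) subspace_annihilator[OF assms(1)] annihilator_subset] .

lemma annihilator_span:
  assumes "S \<subseteq> G q"
  shows "annihilator (span S) p = annihilator S p"
proof -
  have "br v x = 0" if "\<forall>u\<in>S. br u x = 0" "x \<in> G p" "v \<in> span S" for v x
    using annihilates_span[of x S v] that assms cmp_subset by blast
  then show ?thesis unfolding annihilator_def using span_base by blast
qed

end

text \<open>These properties of a prolongation survive extension of scalars. They mention neither
  \<open>M\<close> nor its embedding, so the eigenvalue arguments can be run on the extended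
  algebra.\<close>

locale transitive_depth_two = graded_lie_algebra s br G
  for s :: "'l::field \<Rightarrow> 'a::ab_group_add \<Rightarrow> 'a" and br and G :: "int \<Rightarrow> 'a set" +
  assumes finite_cmp: "finite_dimensional s (G p)"
    and depth: "p < - 2 \<Longrightarrow> G p = {0}"
    and fundamental: "G (- 2) \<subseteq> span {br x y | x y. x \<in> G (- 1) \<and> y \<in> G (- 1)}"
    and transitive: "p \<ge> 0 \<Longrightarrow> x \<in> G p \<Longrightarrow> (\<And>v. v \<in> G (- 1) \<Longrightarrow> br v x = 0) \<Longrightarrow> x = 0"
begin

lemma bracket_minus_two:
  assumes "u \<in> G (- 2)" "v \<in> G q" "q < 0"
  shows "br u v = 0"
  using bracket_cmp[OF assms(1,2)] depth[of "- 2 + q"] assms(3) by simp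

lemma commute_minus_two:
  assumes "u \<in> G (- 2)" "v \<in> G q" "q < 0" "x \<in> G p"
  shows "br u (br v x) = br v (br u x)"
  using derivation_cmp[OF assms(1,2,4)] bracket_minus_two[OF assms(1-3)] zero_left[OF cmp_subset[OF assms(4)]]
  by simp

text \<open>Transitivity provides some v that moves a nonzero element of degree at least 0 to a
  nonzero element one degree lower, and stability keeps it in E. Nonvanishing in a high degree thus
  reaches every degree down to -1.\<close>

lemma descend:
  assumes sub: "\<And>p. E p \<subseteq> G p"
    and stable: "\<And>p v x. p \<ge> 0 \<Longrightarrow> v \<in> G (- 1) \<Longrightarrow> x \<in> E p \<Longrightarrow> br v x \<in> E (p - 1)"
    and "E p \<noteq> {0}" "0 \<in> E p" "- 1 \<le> q" "q \<le> p"
  shows "\<exists>x\<in>E q. x \<noteq> 0"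
proof -
  have "\<exists>x\<in>E (q + int (nat (p - q) - k)). x \<noteq> 0" if "k \<le> nat (p - q)" for k
    using that
  proof (induction k)
    case 0
    then show ?case using assms(3-6) by auto
  next
    case (Suc k)
    then obtain x where x: "x \<in> E (q + int (nat (p - q) - k))" "x \<noteq> 0" by auto
    moreover have ge: "q + int (nat (p - q) - k) \<ge> 0" using Suc.prems assms(5) by auto
    ultimately obtain v where v: "v \<in> G (- 1)" "br v x \<noteq> 0" using transitive sub by blast
    have "q + int (nat (p - q) - Suc k) = q + int (nat (p - q) - k) - 1" using Suc.prems by auto
    then have "br v x \<in> E (q + int (nat (p - q) - Suc k))" using stable[OF ge v(1) x(1)] by metis
    then show ?case using v(2) by blast
  qed
  from this[of "nat (p - q)"] show ?thesis by simp
qed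

text \<open>Brackets of total degree below -2 vanish, so degree -2 commutes with the negative part
  and its kernels are stable under that part.\<close>

lemma annihilator_stable_minus_two:
  assumes "S \<subseteq> G (- 2)" "v \<in> G q" "q < 0" "x \<in> annihilator S p"
  shows "br v x \<in> annihilator S (p + q)"
proof -
  have x: "x \<in> G p" using assms(4) annihilator_subset by blast
  have "br u (br v x) = 0" if "u \<in> S" for u
    using commute_minus_two[of u v q x p] assms that x zero_right[OF cmp_subset[OF assms(2)]]
    unfolding annihilator_def by auto
  then show ?thesis unfolding annihilator_def using bracket_cmp'[OF assms(2) x] by (simp add: add.commute)
qed

end

text \<open>The hyperplane lemma is applied twice: to degree -2, in order to see that its
  annihilator is nonzero in arbitrarily high degrees, and to V, which acts on this annihilator by
  commuting operators.\<close>

theorem transitive_depth_two_rank_one: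
  fixes s :: "'l::{alg_closed_field, field_char_0} \<Rightarrow> 'a::ab_group_add \<Rightarrow> 'a"
  assumes "transitive_depth_two s br G" and inf: "\<And>N. \<exists>p\<ge>N. G p \<noteq> {0}"
  obtains z u where "z \<in> G (- 1)" "z \<noteq> 0" "u \<in> G (- 2)"
    "\<And>y. y \<in> G (- 1) \<Longrightarrow> br z y \<in> module.span s {u}"
proof -
  interpret transitive_depth_two s br G by fact
  have vs: "vector_space s" by unfold_locales
  have zero: "0 \<in> G p" for p using subspace_0[OF subspace_cmp] .
  have G_ne: "G (int p) \<noteq> {0}" for p
  proof -
    obtain p' where p': "p' \<ge> int p" "G p' \<noteq> {0}" using inf by blast
    have "\<exists>x\<in>G (int p). x \<noteq> 0"
      by (rule descend[of G p']) (use p' zero bracket_cmp' in auto)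
    then show ?thesis by blast
  qed
  define h where "h = annihilator (G (- 2))"
  have h_inf: "\<exists>p\<ge>N. h p \<noteq> {0}" for N
  proof (rule ccontr)
    assume "\<not> ?thesis"
    then have h0: "h p = {0}" if "p \<ge> N" for p using that by blast
    \<comment> \<open>Degree -2 lowers degrees by two, so the hyperplane lemma is fed with the even
      degrees only.\<close>
    obtain S w where S: "S \<subseteq> G (- 2)" "w \<in> G (- 2)" "G (- 2) = span (insert w S)"
      and S_inf: "\<And>N. \<exists>p\<ge>N. \<exists>x\<in>G (2 * int (Suc p)). x \<noteq> 0 \<and> (\<forall>u\<in>S. br u x = 0)"
    proof (rule commuting_operators_hyperplane[where D = "\<lambda>k. G (2 * int k)" and act = br and L = "G (- 2)",
          OF vs vs finite_cmp finite_cmp])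
      show "linear_map_on s s (G (2 * int (Suc p))) (br v)" if "v \<in> G (- 2)" for p v
        using linear_cmp that .
      show "br v x \<in> G (2 * int p)" if "v \<in> G (- 2)" "x \<in> G (2 * int (Suc p))" for p v x
        using bracket_cmp'[OF that] by simp
      show "linear_map_on s s (G (- 2)) (\<lambda>v. br v x)" if "x \<in> G (2 * int (Suc p))" for p x
        using linear_cmp' that .
      show "br u (br v x) = br v (br u x)" if "u \<in> G (- 2)" "v \<in> G (- 2)" "x \<in> G (2 * int (Suc (Suc p)))" for p x u v
        using commute_minus_two that by simp
      show "\<exists>p\<ge>N. G (2 * int p) \<noteq> {0}" for N using G_ne[of "2 * N"] by auto
    qed blast
    define C where "C = annihilator S"
    have C_sub: "\<And>p. C p \<subseteq> G p" unfolding C_def by (rule annihilator_subset)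
    have fdC: "finite_dimensional s (C p)" for p
      unfolding C_def using finite_dimensional_annihilator[OF S(1) finite_cmp] .
    have zeroC: "0 \<in> C p" for p using subspace_0 finite_dimensional_subspace[OF fdC] by blast
    have C_stable: "br v x \<in> C (p + q)" if "v \<in> G q" "q < 0" "x \<in> C p" for v q x p
      using annihilator_stable_minus_two[OF S(1)] that unfolding C_def by blast
    have C_ne: "C p \<noteq> {0}" if "p \<ge> 0" for p
    proof -
      obtain p' x where p': "p' \<ge> nat p" "x \<in> G (2 * int (Suc p'))" "x \<noteq> 0" "\<forall>u\<in>S. br u x = 0"
        using S_inf by blast
      then have "C (2 * int (Suc p')) \<noteq> {0}" unfolding C_def annihilator_def by auto
      then have "\<exists>x\<in>C p. x \<noteq> 0"
        using descend[of C "2 * int (Suc p')" p] C_sub zeroC C_stable[of _ "- 1"] p'(1) that by fastforce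
      then show ?thesis by blast
    qed
    \<comment> \<open>Brackets of V span degree -2. Either they all lie in the span of S, and then C
      is annihilated by all of degree -2, or one of them can replace w as the missing direction and
      generates a Heisenberg algebra with its two factors.\<close>
    show False
    proof (cases "\<forall>a\<in>G (- 1). \<forall>b\<in>G (- 1). br a b \<in> span S")
      case True
      then have "span {br x y | x y. x \<in> G (- 1) \<and> y \<in> G (- 1)} \<subseteq> span S"
        by (intro span_minimal) auto
      then have "G (- 2) \<subseteq> span S" using fundamental by blast
      then have "C p \<subseteq> h p" for p
        using annihilator_span[OF S(1)] unfolding C_def h_def annihilator_def by blast
      then show False using C_ne[of "max 0 N"] h0[of "max 0 N"] zeroC[of "max 0 N"] by auto
    next
      case False
      then obtain a b where ab: "a \<in> G (- 1)" "b \<in> G (- 1)" "br a b \<notin> span S" by blast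
      define w' where "w' = br a b"
      have w': "w' \<in> G (- 2)" unfolding w'_def using bracket_cmp'[OF ab(1,2)] by simp
      have "w \<in> span (insert w' S)" using in_span_insert[of w' w S] w' S ab w'_def by auto
      then have "insert w S \<subseteq> span (insert w' S)" using span_superset[of "insert w' S"] by auto
      then have G2: "G (- 2) \<subseteq> span (insert w' S)" using S(3) span_minimal[OF _ subspace_span] by blast
      \<comment> \<open>An element of C killed by w' is annihilated by all of degree -2, and
        \<open>h\<close> vanishes from degree N on.\<close>
      have inj: "x = 0" if "p \<ge> nat N" "x \<in> C (int (Suc (Suc p)))" "br w' x = 0" for p x
      proof -
        have "x \<in> annihilator (insert w' S) (int (Suc (Suc p)))"
          using that unfolding C_def annihilator_def by auto
        then have "x \<in> h (int (Suc (Suc p)))"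
          using annihilator_span[of "insert w' S" "- 2"] S(1) w' G2 unfolding h_def annihilator_def by blast
        then show ?thesis using h0 that(1) by force
      qed
      have C_lin: "linear_map_on s s (C p) (br v)" if "v \<in> G q" for v p q
        using semilinear_on_subset[OF linear_cmp[OF that] C_sub] .
      have "\<exists>p\<ge>nat N. C (int p) = {0}"
      proof (rule heisenberg_finite[where D = "\<lambda>p. C (int p)" and a = "br a" and b = "br b" and w = "br w'",
            OF vs fdC C_lin[OF ab(1)] _ C_lin[OF ab(2)] _ C_lin[OF w']])
        show "br a x \<in> C (int p)" "br b x \<in> C (int p)" if "x \<in> C (int (Suc p))" for p x
          using C_stable[OF ab(1) _ that] C_stable[OF ab(2) _ that] by auto
        show "br w' x \<in> C (int p)" if "x \<in> C (int (Suc (Suc p)))" for p x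
          using C_stable[OF w' _ that] by auto
        show "br a (br b x) = br b (br a x) + br w' x" if "x \<in> C (int (Suc (Suc p)))" for p x
          using derivation_cmp[OF ab(1,2)] that C_sub unfolding w'_def by (auto simp: add.commute)
        show "br w' (br a x) = br a (br w' x)" "br w' (br b x) = br b (br w' x)"
          if "x \<in> C (int (Suc (Suc (Suc p))))" for p x
          using commute_minus_two[OF w' ab(1)] commute_minus_two[OF w' ab(2)] subsetD[OF C_sub that] by auto
      qed (use inj in blast)
      then show False using C_ne by auto
    qed
  qed
  have h_sub: "\<And>p. h p \<subseteq> G p" unfolding h_def by (rule annihilator_subset)
  have fdh: "finite_dimensional s (h p)" for p
    unfolding h_def using finite_dimensional_annihilator[OF order_refl finite_cmp] .
  have zeroh: "0 \<in> h p" for p using subspace_0 finite_dimensional_subspace[OF fdh] by blast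
  have h_stable: "br v x \<in> h (p - 1)" if "v \<in> G (- 1)" "x \<in> h p" for v x p
    using annihilator_stable_minus_two[OF order_refl that(1)] that(2) unfolding h_def by force
  have h_comm: "br u (br v x) = br v (br u x)" if "u \<in> G (- 1)" "v \<in> G (- 1)" "x \<in> h p" for u v x p
  proof -
    have "br (br u v) x = 0"
      using bracket_cmp'[OF that(1,2), of "- 2"] that(3) unfolding h_def annihilator_def by simp
    then show ?thesis using derivation_cmp[OF that(1,2) subsetD[OF h_sub that(3)]] by simp
  qed
  obtain S v where S: "S \<subseteq> G (- 1)" "v \<in> G (- 1)" "G (- 1) = span (insert v S)"
    and S_inf: "\<And>N. \<exists>p\<ge>N. \<exists>x\<in>h (int (Suc p)). x \<noteq> 0 \<and> (\<forall>u\<in>S. br u x = 0)"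
  proof (rule commuting_operators_hyperplane[where D = "\<lambda>p. h (int p)" and act = br and L = "G (- 1)",
          OF vs vs fdh finite_cmp])
    show "linear_map_on s s (h (int (Suc p))) (br v)" if "v \<in> G (- 1)" for p v
      using semilinear_on_subset[OF linear_cmp[OF that] h_sub] .
    show "br v x \<in> h (int p)" if "v \<in> G (- 1)" "x \<in> h (int (Suc p))" for p v x
      using h_stable[OF that] by simp
    show "linear_map_on s s (G (- 1)) (\<lambda>v. br v x)" if "x \<in> h (int (Suc p))" for p x
      using linear_cmp' that h_sub by blast
    show "br u (br v x) = br v (br u x)" if "u \<in> G (- 1)" "v \<in> G (- 1)" "x \<in> h (int (Suc (Suc p)))" for p x u v
      using h_comm that by simp
    show "\<exists>p\<ge>N. h (int p) \<noteq> {0}" for N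
      using h_inf[of "int N"] by (metis nat_0_le nat_le_iff of_nat_0_le_iff order_trans zle_int)
  qed blast
  define E where "E p = {x \<in> h p. \<forall>u\<in>S. br u x = 0}" for p
  have E_sub: "E p \<subseteq> h p" for p unfolding E_def by blast
  have v_stable: "br y x \<in> E (p - 1)" if "y \<in> G (- 1)" "x \<in> E p" for x p y
  proof -
    have "br u (br y x) = 0" if "u \<in> S" for u
      using h_comm[of u y x p] that S \<open>x \<in> E p\<close> \<open>y \<in> _\<close> zero_right[OF cmp_subset[OF \<open>y \<in> _\<close>]] unfolding E_def by auto
    then show ?thesis using h_stable[OF that(1)] that(2) unfolding E_def by blast
  qed
  obtain p x where "x \<in> h (int (Suc p))" "x \<noteq> 0" "\<forall>u\<in>S. br u x = 0" using S_inf by blast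
  then have "E (int (Suc p)) \<noteq> {0}" unfolding E_def by auto
  moreover have "0 \<in> E (int (Suc p))"
    unfolding E_def using zeroh S zero_right cmp_subset by blast
  ultimately have "\<exists>x\<in>E 0. x \<noteq> 0"
    using descend[of E "int (Suc p)" 0] E_sub h_sub v_stable by fastforce
  then obtain x0 where x0: "x0 \<in> E 0" "x0 \<noteq> 0" by blast
  have x0G: "x0 \<in> G 0" using x0 E_sub h_sub by blast
  \<comment> \<open>S kills x0, so by transitivity the remaining direction v cannot kill it as
    well.\<close>
  define z where "z = br v x0"
  have kill: "br u y = 0" if "y \<in> E q" "u \<in> span S" for y q u
    using annihilates_span[of y S u] that S cmp_subset h_sub unfolding E_def by blast
  have zE: "z \<in> E (- 1)" unfolding z_def using v_stable[OF S(2) x0(1)] by simp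
  then have zG: "z \<in> G (- 1)" using E_sub h_sub by blast
  have "z \<noteq> 0"
  proof
    assume "z = 0"
    then have "br u x0 = 0" if "u \<in> insert v S" for u
      using that x0 unfolding z_def E_def by auto
    then have "br u x0 = 0" if "u \<in> G (- 1)" for u
      using annihilates_span[of x0 "insert v S" u] S that cmp_subset x0G by blast
    then show False using transitive[OF _ x0G] x0 by auto
  qed
  moreover have "br z y \<in> span {br z v}" if y: "y \<in> G (- 1)" for y
  proof -
    \<comment> \<open>S kills z, so only the component of y along v contributes to [z, y].\<close>
    obtain c where c: "y - s c v \<in> span S" using S(3) y span_breakdown_eq by blast
    have yv: "y - s c v \<in> G (- 1)" "s c v \<in> G (- 1)"
      using subspace_diff[OF subspace_cmp] subspace_scale[OF subspace_cmp] S(2) y by auto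
    have "br z (y - s c v) = - br (y - s c v) z"
      using anticommute cmp_subset[OF yv(1)] cmp_subset[OF zG] by blast
    also have "\<dots> = 0" using kill[OF zE c] by simp
    finally have "br z y = s c (br z v)"
      using add_right[of z "y - s c v" "s c v"] cmp_subset[OF yv(1)] cmp_subset[OF yv(2)] cmp_subset[OF zG]
        scale_right[OF cmp_subset[OF zG] cmp_subset[OF S(2)]] by simp
    then show ?thesis by (simp add: span_base span_scale)
  qed
  moreover have "br z v \<in> G (- 2)" using bracket_cmp'[OF zG S(2)] by simp
  ultimately show ?thesis using that zG by blast
qed

subsection \<open>Extension of scalars to the algebraic closure\<close>

text \<open>The tool for descending to K: applied to all coefficients, such a functional carries a
  solution over the closure of a K-linear system to one over K, and the normalization at c keeps it
  nonzero.\<close>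

lemma ac_functional:
  fixes c :: "'k::field alg_closure"
  assumes "c \<noteq> 0"
  obtains l :: "'k alg_closure \<Rightarrow> 'k" where "\<And>x y. l (x + y) = l x + l y"
    "\<And>a x. l (to_ac a * x) = a * l x" "l 0 = 0" "l c = 1"
proof -
  interpret F: vector_space "\<lambda>a x. to_ac a * x :: 'k alg_closure"
    by unfold_locales (auto simp: algebra_simps)
  interpret K: vector_space "(*) :: 'k \<Rightarrow> 'k \<Rightarrow> 'k"
    by unfold_locales (auto simp: algebra_simps)
  interpret vector_space_pair "\<lambda>a x. to_ac a * x :: 'k alg_closure" "(*) :: 'k \<Rightarrow> 'k \<Rightarrow> 'k" ..
  have "F.independent {c}" using assms by simp
  then obtain l where l: "Vector_Spaces.linear (\<lambda>a x. to_ac a * x) (*) l" "\<forall>x\<in>{c}. l x = 1"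
    using linear_independent_extend[of "{c}" "\<lambda>_. 1"] by blast
  interpret l: Vector_Spaces.linear "\<lambda>a x. to_ac a * x :: 'k alg_closure" "(*) :: 'k \<Rightarrow> 'k \<Rightarrow> 'k" l
    by fact
  show ?thesis using that[of l] l l.add l.scale l.zero by blast
qed

lemma ac_functional_sum:
  fixes l :: "'k::field alg_closure \<Rightarrow> 'k"
  assumes "\<And>x y. l (x + y) = l x + l y" "l 0 = 0"
  shows "l (\<Sum>a\<in>A. f a) = (\<Sum>a\<in>A. l (f a))"
  by (induction A rule: infinite_finite_induct) (auto simp: assms)

text \<open>The extended bracket is understood on images of basis vectors, so the axioms have to be
  reduced to a spanning set. Skew symmetry is linear in each argument, which [x, x] = 0 is not; the
  latter is recovered at the end by dividing by 2.\<close>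

lemma lie_algebra_spanI:
  fixes s :: "'k::field_char_0 \<Rightarrow> 'a::ab_group_add \<Rightarrow> 'a"
  assumes vs: "vector_space s" and bil: "bilinear_map_on s s (module.span s A) br"
    and closed: "\<And>x y. x \<in> A \<Longrightarrow> y \<in> A \<Longrightarrow> br x y \<in> module.span s A"
    and anti: "\<And>x y. x \<in> A \<Longrightarrow> y \<in> A \<Longrightarrow> br x y = - br y x"
    and jac: "\<And>x y z. x \<in> A \<Longrightarrow> y \<in> A \<Longrightarrow> z \<in> A \<Longrightarrow> br x (br y z) + br y (br z x) + br z (br x y) = 0"
  shows "lie_algebra s br (module.span s A)"
proof -
  interpret vector_space s by fact
  have right: "linear_map_on s s (span A) (br x)" and left: "linear_map_on s s (span A) (\<lambda>y. br y x)"
    if "x \<in> span A" for x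
    using bil that unfolding bilinear_map_on_def by auto
  have sub: "P x"
    if "x \<in> span A" "\<And>x. x \<in> A \<Longrightarrow> P x" "P 0"
      "\<And>x y. x \<in> span A \<Longrightarrow> y \<in> span A \<Longrightarrow> P x \<Longrightarrow> P y \<Longrightarrow> P (x + y)"
      "\<And>c x. x \<in> span A \<Longrightarrow> P x \<Longrightarrow> P (s c x)" for P x
  proof -
    have "span A \<subseteq> {x. x \<in> span A \<and> P x}"
      using that(2-) by (intro span_minimal) (auto simp: subspace_def span_zero span_add span_scale span_base)
    then show ?thesis using that(1) by blast
  qed
  have zr: "br x 0 = 0" and zl: "br 0 x = 0" if "x \<in> span A" for x
    using semilinear_on_zero[OF right[OF that] span_zero] semilinear_on_zero[OF left[OF that] span_zero] by auto
  have ladd: "br (x + y) z = br x z + br y z" and radd: "br z (x + y) = br z x + br z y"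
    if "x \<in> span A" "y \<in> span A" "z \<in> span A" for x y z
    using semilinear_onD(1)[OF left[OF that(3)] that(1,2)] semilinear_onD(1)[OF right[OF that(3)] that(1,2)] by auto
  have lsc: "br (s c x) z = s c (br x z)" and rsc: "br z (s c x) = s c (br z x)"
    if "x \<in> span A" "z \<in> span A" for c x z
    using semilinear_onD(2)[OF left[OF that(2)] that(1)] semilinear_onD(2)[OF right[OF that(2)] that(1)] by auto
  have c1: "br x y \<in> span A" if "x \<in> span A" "y \<in> A" for x y
    using that(1)
    by (rule sub) (use that(2) in \<open>simp_all add: closed span_base span_zero span_add span_scale zl ladd lsc\<close>)
  have c2: "br x y \<in> span A" if "x \<in> span A" "y \<in> span A" for x y
    using that(2)
    by (rule sub) (use that(1) in \<open>simp_all add: c1 span_zero span_add span_scale zr radd rsc\<close>)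
  have a1: "br x y = - br y x" if "x \<in> span A" "y \<in> A" for x y
    using that(1)
    by (rule sub) (use that(2) in \<open>simp_all add: anti[of _ y] span_base zl zr ladd radd lsc rsc\<close>)
  have a2: "br x y = - br y x" if "x \<in> span A" "y \<in> span A" for x y
    using that(2)
    by (rule sub) (use that(1) in \<open>simp_all add: a1[of x] zl zr ladd radd lsc rsc\<close>)
  \<comment> \<open>The Jacobi sum is cyclic, so extending linearly in the first argument, three
    times with a rotation in between, covers all arguments.\<close>
  define J where "J x y z = br x (br y z) + br y (br z x) + br z (br x y)" for x y z
  have J_cyc: "J x y z = J y z x" for x y z unfolding J_def by (simp add: algebra_simps)
  have J0: "J x y z = 0" if A: "\<And>x. x \<in> A \<Longrightarrow> J x y z = 0" and y: "y \<in> span A" and z: "z \<in> span A"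
    and x: "x \<in> span A" for x y z
  proof -
    have "J (x + x') y z = J x y z + J x' y z" if "x \<in> span A" "x' \<in> span A" for x x'
      unfolding J_def using that y z by (simp add: ladd radd c2 algebra_simps)
    moreover have "J (s c x) y z = s c (J x y z)" if "x \<in> span A" for c x
      unfolding J_def using that y z by (simp add: lsc rsc c2 scale_right_distrib)
    moreover have "J 0 y z = 0" unfolding J_def using zl zr c2 y z by simp
    ultimately show ?thesis using A by (intro sub[OF x, of "\<lambda>x. J x y z = 0"]) auto
  qed
  have J1: "J x y z = 0" if "x \<in> span A" "y \<in> A" "z \<in> A" for x y z
    using J0[of y z x] that jac span_base unfolding J_def by blast
  have J2: "J x y z = 0" if "x \<in> span A" "y \<in> A" "z \<in> span A" for x y z
  proof -
    have "J z x y = 0"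
    proof (rule J0)
      show "J z' x y = 0" if "z' \<in> A" for z'
        unfolding J_cyc[of z' x y] using J1 \<open>x \<in> _\<close> \<open>y \<in> _\<close> that by blast
    qed (use that span_base in auto)
    then show ?thesis unfolding J_cyc[of z x y] .
  qed
  have J3: "J x y z = 0" if "x \<in> span A" "y \<in> span A" "z \<in> span A" for x y z
  proof -
    have "J y z x = 0"
    proof (rule J0)
      show "J y' z x = 0" if "y' \<in> A" for y'
        unfolding J_cyc[of x y' z, symmetric] using J2 \<open>x \<in> _\<close> \<open>z \<in> _\<close> that by blast
    qed (use that in auto)
    then show ?thesis unfolding J_cyc[of x y z] .
  qed
  show ?thesis
  proof unfold_locales
    fix x y z assume x: "x \<in> span A"
    show "br x x = 0"
    proof -
      have "br x x + br x x = 0" using a2[OF x x] by (metis eq_neg_iff_add_eq_0)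
      then have "s 2 (br x x) = 0" using scale_left_distrib[of 1 1 "br x x"] by simp
      then show ?thesis by simp
    qed
    assume y: "y \<in> span A"
    show "br x y \<in> span A" using c2 x y .
    assume z: "z \<in> span A"
    show "br x (br y z) + br y (br z x) + br z (br x y) = 0" using J3[OF x y z] unfolding J_def .
  qed (use bil in auto)
qed

section \<open>Finitely supported functions as a model of extension of scalars\<close>

definition fun_scale :: "'l::field \<Rightarrow> ('b \<Rightarrow> 'l) \<Rightarrow> 'b \<Rightarrow> 'l" where
  "fun_scale c f = (\<lambda>b. c * f b)"

lemma fun_scale_apply [simp]: "fun_scale c f b = c * f b"
  by (simp add: fun_scale_def)

lemma vector_space_fun_scale: "vector_space (fun_scale :: 'l::field \<Rightarrow> ('b \<Rightarrow> 'l) \<Rightarrow> 'b \<Rightarrow> 'l)"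
  by unfold_locales (auto simp: fun_eq_iff algebra_simps)

lemma sum_fun_apply: "(\<Sum>a\<in>A. f a) b = (\<Sum>a\<in>A. f a b)"
  by (induction A rule: infinite_finite_induct) auto

definition finsupp :: "'b set \<Rightarrow> ('b \<Rightarrow> 'l::field) set" where
  "finsupp B = {f. finite {b. f b \<noteq> 0} \<and> {b. f b \<noteq> 0} \<subseteq> B}"

lemma subspace_finsupp:
  fixes B :: "'b set"
  shows "module.subspace fun_scale (finsupp B :: ('b \<Rightarrow> 'l::field) set)"
proof -
  interpret vector_space "fun_scale :: 'l \<Rightarrow> ('b \<Rightarrow> 'l) \<Rightarrow> 'b \<Rightarrow> 'l" by (rule vector_space_fun_scale)
  have "finite {b. f b + g b \<noteq> 0}" if "finite {b. f b \<noteq> 0}" "finite {b. g b \<noteq> 0}" for f g :: "'b \<Rightarrow> 'l"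
    by (rule finite_subset[of _ "{b. f b \<noteq> 0} \<union> {b. g b \<noteq> 0}"]) (use that in auto)
  moreover have "f b \<noteq> 0 \<or> g b \<noteq> 0" if "f b + g b \<noteq> 0" for f g :: "'b \<Rightarrow> 'l" and b using that by auto
  ultimately show ?thesis unfolding subspace_def finsupp_def by (auto; blast)
qed

definition lift :: "('l::field \<Rightarrow> 'y::ab_group_add \<Rightarrow> 'y) \<Rightarrow> ('b \<Rightarrow> 'y) \<Rightarrow> ('b \<Rightarrow> 'l) \<Rightarrow> 'y" where
  "lift t \<phi> f = (\<Sum>b | f b \<noteq> 0. t (f b) (\<phi> b))"

lemma lift_eq:
  assumes "vector_space t" "finite S" "{b. f b \<noteq> 0} \<subseteq> S"
  shows "lift t \<phi> f = (\<Sum>b\<in>S. t (f b) (\<phi> b))"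
proof -
  interpret vector_space t by fact
  show ?thesis unfolding lift_def using assms by (intro sum.mono_neutral_left) auto
qed

lemma linear_lift:
  fixes t :: "'a::field \<Rightarrow> 'b::ab_group_add \<Rightarrow> 'b" and \<phi> :: "'c \<Rightarrow> 'b"
  assumes "vector_space t"
  shows "linear_map_on fun_scale t (finsupp B) (lift t \<phi>)"
proof -
  interpret vector_space t by fact
  show ?thesis
    unfolding semilinear_on_def
  proof (intro conjI ballI allI)
    fix f g :: "'c \<Rightarrow> 'a" and c assume f: "f \<in> finsupp B"
    let ?S = "{b. f b \<noteq> 0}"
    show "lift t \<phi> (fun_scale c f) = t c (lift t \<phi> f)"
      using f assms by (subst (1 2) lift_eq[of t ?S]) (auto simp: finsupp_def scale_sum_right)
    assume g: "g \<in> finsupp B"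
    let ?S = "{b. f b \<noteq> 0} \<union> {b. g b \<noteq> 0}"
    show "lift t \<phi> (f + g) = lift t \<phi> f + lift t \<phi> g"
      using f g assms
      by (subst (1 2 3) lift_eq[of t ?S]) (auto simp: finsupp_def scale_left_distrib sum.distrib)
  qed
qed

lemma lift_mem:
  assumes "vector_space t" "module.subspace t Y" "\<And>b. b \<in> B \<Longrightarrow> \<phi> b \<in> Y" "f \<in> finsupp B"
  shows "lift t \<phi> f \<in> Y"
proof -
  interpret vector_space t by fact
  show ?thesis unfolding lift_def
    using assms by (intro subspace_sum[OF assms(2)] subspace_scale[OF assms(2)]) (auto simp: finsupp_def)
qed

text \<open>
  \<open>finsupp B\<close> serves as the tensor product of the closure with the span of an independent set \<open>B\<close>, and
  \<open>coordinates s B x\<close> as \<open>1 \<otimes> x\<close>.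
\<close>

definition coordinates :: "('k::field \<Rightarrow> 'a::ab_group_add \<Rightarrow> 'a) \<Rightarrow> 'a set \<Rightarrow> 'a \<Rightarrow> 'a \<Rightarrow> 'k alg_closure" where
  "coordinates s B x = (\<lambda>b. to_ac (module.representation s B x b))"

context vector_space
begin

lemma coordinates_finsupp: "coordinates scale B x \<in> finsupp B"
  unfolding finsupp_def coordinates_def
  using finite_representation[of B x] representation_ne_zero[of B x] by auto

lemma semilinear_coordinates:
  assumes "independent B"
  shows "semilinear_on to_ac scale fun_scale (span B) (coordinates scale B)"
  unfolding semilinear_on_def coordinates_def
  using assms by (auto simp: representation_add representation_scale fun_eq_iff)

lemma coordinates_basis:
  assumes "independent B" "b \<in> B"
  shows "coordinates scale B b = (\<lambda>c. if c = b then 1 else 0)"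
  unfolding coordinates_def using representation_basis[OF assms] by (auto simp: fun_eq_iff)

lemma finsupp_span:
  assumes "independent B"
  shows "finsupp B = module.span fun_scale (coordinates scale B ` B)"
proof -
  interpret F: vector_space "fun_scale :: 'a alg_closure \<Rightarrow> ('b \<Rightarrow> 'a alg_closure) \<Rightarrow> _"
    by (rule vector_space_fun_scale)
  show ?thesis
  proof
    show "F.span (coordinates scale B ` B) \<subseteq> finsupp B"
      using subspace_finsupp coordinates_finsupp by (intro F.span_minimal) auto
    show "finsupp B \<subseteq> F.span (coordinates scale B ` B)"
    proof
      fix f :: "'b \<Rightarrow> 'a alg_closure" assume f: "f \<in> finsupp B"
      have "f = (\<Sum>b | f b \<noteq> 0. fun_scale (f b) (coordinates scale B b))"
      proof
        fix c
        have *: "coordinates scale B b c = (if c = b then 1 else 0)" if "f b \<noteq> 0" for b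
          using f that coordinates_basis[OF assms, of b] by (auto simp: finsupp_def)
        have "(\<Sum>b | f b \<noteq> 0. fun_scale (f b) (coordinates scale B b)) c
            = (\<Sum>b | f b \<noteq> 0. if b = c then f b else 0)"
          unfolding sum_fun_apply fun_scale_apply by (intro sum.cong) (auto simp: *)
        also have "\<dots> = f c" using f by (auto simp: finsupp_def)
        finally show "f c = (\<Sum>b | f b \<noteq> 0. fun_scale (f b) (coordinates scale B b)) c" ..
      qed
      also have "\<dots> \<in> F.span (coordinates scale B ` B)"
        using f by (intro F.span_sum F.span_scale F.span_base) (auto simp: finsupp_def)
      finally show "f \<in> F.span (coordinates scale B ` B)" .
    qed
  qed
qed

text \<open>Both sides are the expansion of x in the basis with \<phi> applied termwise. This makes
  \<open>finsupp B\<close> with \<open>coordinates\<close> behave as a tensor product.\<close>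

lemma lift_coordinates:
  assumes B: "independent B" and t: "vector_space t" and \<phi>: "semilinear_on to_ac scale t (span B) \<phi>"
    and x: "x \<in> span B"
  shows "lift t \<phi> (coordinates scale B x) = \<phi> x"
proof -
  let ?S = "{b. representation B x b \<noteq> 0}"
  have S: "finite ?S" "?S \<subseteq> B" using finite_representation representation_ne_zero by auto
  have "lift t \<phi> (coordinates scale B x) = (\<Sum>b\<in>?S. t (to_ac (representation B x b)) (\<phi> b))"
    using S by (subst lift_eq[OF t, of ?S]) (auto simp: coordinates_def)
  also have "\<dots> = \<phi> (\<Sum>b\<in>?S. scale (representation B x b) b)"
    using S span_base by (subst semilinear_on_sum[OF \<phi> vector_space_axioms subspace_span]) auto
  also have "(\<Sum>b\<in>?S. scale (representation B x b) b) = x"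
    using sum_nonzero_representation_eq[OF B x] .
  finally show ?thesis .
qed

lemma semilinear_image_span:
  assumes t: "vector_space t" and \<phi>: "semilinear_on \<sigma> scale t (span A) \<phi>"
  shows "\<phi> ` span A \<subseteq> module.span t (\<phi> ` A)"
proof -
  interpret t: vector_space t by fact
  have "span A \<subseteq> {x \<in> span A. \<phi> x \<in> t.span (\<phi> ` A)}"
    by (intro span_minimal) (auto simp: subspace_def span_zero span_add span_scale span_base
        semilinear_on_zero[OF \<phi> span_zero] semilinear_onD[OF \<phi>] t.span_zero t.span_add t.span_scale t.span_base)
  then show ?thesis by blast
qed

end

section \<open>Bases adapted to a grading\<close>

context graded_lie_algebra
begin

lemma cmp_disjoint:
  assumes "x \<in> G p" "x \<in> G r" "p \<noteq> r"
  shows "x = 0"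
proof -
  define c where "c = (\<lambda>i. if i = p then x else if i = r then - x else 0)"
  have "{i. c i \<noteq> 0} = (if x = 0 then {} else {p, r})" unfolding c_def using assms(3) by auto
  moreover have "c i \<in> G i" for i
    unfolding c_def using assms subspace_neg[OF subspace_cmp] subspace_0[OF subspace_cmp] by auto
  moreover have "(\<Sum>i | c i \<noteq> 0. c i) = 0"
    using calculation(1) assms(3) by (auto simp: c_def)
  ultimately have "c p = 0" using direct[of c p] by auto
  then show ?thesis unfolding c_def by simp
qed

text \<open>A relation among the united bases sorts into homogeneous sums. Directness makes each of
  them zero, and independence within one degree does the rest.\<close>

lemma union_basis:
  assumes B: "\<And>p. independent (B p)" "\<And>p. span (B p) = G p"
  shows "independent (\<Union>p. B p)" "span (\<Union>p. B p) = sum_cmp s UNIV G"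
    "\<And>p q. p \<noteq> q \<Longrightarrow> B p \<inter> B q = {}"
proof -
  have BG: "B p \<subseteq> G p" for p using B(2) span_superset by blast
  have nz: "0 \<notin> B p" for p using B(1) dependent_zero by blast
  show disj: "B p \<inter> B q = {}" if "p \<noteq> q" for p q
    using cmp_disjoint that BG nz by blast
  show "span (\<Union>p. B p) = sum_cmp s UNIV G"
  proof
    show "span (\<Union>p. B p) \<subseteq> sum_cmp s UNIV G"
      unfolding sum_cmp_def using BG by (intro span_mono) auto
    have "G p \<subseteq> span (\<Union>p. B p)" for p using B(2) span_mono[of "B p" "\<Union>p. B p"] by auto
    then show "sum_cmp s UNIV G \<subseteq> span (\<Union>p. B p)"
      unfolding sum_cmp_def by (intro span_minimal) auto
  qed
  show "independent (\<Union>p. B p)"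
    unfolding independent_explicit_module
  proof (intro allI impI)
    fix t u v
    assume t: "finite t" "t \<subseteq> (\<Union>p. B p)" "(\<Sum>v\<in>t. s (u v) v) = 0" "v \<in> t"
    define c where "c p = (\<Sum>v\<in>t \<inter> B p. s (u v) v)" for p
    define P where "P = {p. t \<inter> B p \<noteq> {}}"
    \<comment> \<open>Only finitely many degrees meet the finite set t, because a vector of t
      determines the degree whose basis contains it.\<close>
    have "P \<subseteq> (\<lambda>v. THE p. v \<in> B p) ` t"
    proof
      fix p assume "p \<in> P"
      then obtain v where v: "v \<in> t" "v \<in> B p" unfolding P_def by blast
      then have "(THE p. v \<in> B p) = p" using disj by blast
      then show "p \<in> (\<lambda>v. THE p. v \<in> B p) ` t" using v by force
    qed
    then have fP: "finite P" using t(1) finite_surj by blast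
    have cP: "{p. c p \<noteq> 0} \<subseteq> P" unfolding c_def P_def by auto
    have "(\<Sum>p | c p \<noteq> 0. c p) = (\<Sum>p\<in>P. c p)"
      using fP cP by (intro sum.mono_neutral_left) auto
    also have "\<dots> = (\<Sum>v\<in>(\<Union>p\<in>P. t \<inter> B p). s (u v) v)"
      unfolding c_def using t(1) fP disj by (intro sum.UNION_disjoint[symmetric]) auto
    also have "(\<Union>p\<in>P. t \<inter> B p) = t"
    proof
      show "t \<subseteq> (\<Union>p\<in>P. t \<inter> B p)"
      proof
        fix x assume x: "x \<in> t"
        then obtain p where "x \<in> B p" using t(2) by blast
        then show "x \<in> (\<Union>p\<in>P. t \<inter> B p)" unfolding P_def using x by blast
      qed
    qed auto
    finally have "(\<Sum>p | c p \<noteq> 0. c p) = 0" using t by simp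
    moreover have "c p \<in> G p" for p
      unfolding c_def using BG by (intro subspace_sum subspace_scale subspace_cmp) auto
    ultimately have c0: "c p = 0" for p using direct[of c p] fP cP finite_subset by blast
    obtain p where "v \<in> B p" using t by blast
    then show "u v = 0"
      using independentD[OF B(1), of "t \<inter> B p" p u v] c0[of p] t unfolding c_def by auto
  qed
qed

end

text \<open>The algebra is extended to the closure on a homogeneous basis, where
  \<open>transitive_depth_two_rank_one\<close> applies; A is the support of the degenerate vector
  and c lists its coefficients. An arbitrary semilinear \<phi> appears in the conclusion so that it
  fits any given model of the extension of degree -2.\<close>

theorem transitive_depth_two_rank_one_closure:
  fixes s :: "'k::field_char_0 \<Rightarrow> 'a::ab_group_add \<Rightarrow> 'a"
    and t :: "'k alg_closure \<Rightarrow> 'y::ab_group_add \<Rightarrow> 'y"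
  assumes tr: "transitive_depth_two s br G" and inf: "\<And>N. \<exists>p\<ge>N. G p \<noteq> {0}"
    and t: "vector_space t" and \<phi>: "semilinear_on to_ac s t (G (- 2)) \<phi>"
  obtains A c u where "finite A" "A \<noteq> {}" "A \<subseteq> G (- 1)" "\<not> module.dependent s A"
    "\<And>a. a \<in> A \<Longrightarrow> c a \<noteq> 0"
    "\<And>x. x \<in> G (- 1) \<Longrightarrow> (\<Sum>a\<in>A. t (c a) (\<phi> (br a x))) \<in> module.span t {u}"
proof -
  interpret transitive_depth_two s br G by fact
  interpret F: vector_space "fun_scale :: 'k alg_closure \<Rightarrow> ('a \<Rightarrow> 'k alg_closure) \<Rightarrow> 'a \<Rightarrow> 'k alg_closure"
    by (rule vector_space_fun_scale)
  interpret t: vector_space t by fact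
  have "\<exists>B. finite B \<and> independent B \<and> span B = G p" for p
    using finite_dimensional_basis[OF finite_cmp] by metis
  then obtain B where B: "\<And>p. finite (B p)" "\<And>p. independent (B p)" "\<And>p. span (B p) = G p"
    by metis
  note U = union_basis[OF B(2,3)]
  define BB where "BB = (\<Union>p. B p)"
  have BB: "independent BB" "span BB = sum_cmp s UNIV G" unfolding BB_def using U by auto
  have BG: "B p \<subseteq> G p" "B p \<subseteq> BB" for p using B(3) span_superset unfolding BB_def by blast+
  define J where "J = coordinates s BB"
  have J_lin: "semilinear_on to_ac s fun_scale (span BB) J"
    unfolding J_def using semilinear_coordinates[OF BB(1)] .
  have J_cmp: "J x \<in> finsupp (B p)" if "x \<in> G p" for x p
  proof -
    have "representation BB x = representation (B p) x"
      using representation_extend[OF BB(1), of x "B p"] that B BG by auto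
    then show ?thesis unfolding J_def using coordinates_finsupp[of "B p" x] by (simp add: coordinates_def)
  qed
  have JE: "J x \<in> finsupp BB" for x unfolding J_def by (rule coordinates_finsupp)
  have GBB: "x \<in> span BB" if "x \<in> G p" for x p using cmp_subset[OF that] BB by simp
  define E where "E p = (finsupp (B p) :: ('a \<Rightarrow> 'k alg_closure) set)" for p
  \<comment> \<open>The bracket of basis vectors, with its scalars extended by \<open>J\<close>,
    continued bilinearly to the closure.\<close>
  define brE where "brE f g = lift fun_scale (\<lambda>a. lift fun_scale (\<lambda>b. J (br a b)) g) f" for f g
  have span_J: "finsupp BB = F.span (J ` BB)" unfolding J_def using finsupp_span[OF BB(1)] .
  have E_sub: "E p \<subseteq> finsupp BB" for p unfolding E_def using BG(2)[of p] by (auto simp: finsupp_def)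
  have brL: "br x y \<in> span BB" if "x \<in> span BB" "y \<in> span BB" for x y using closed that BB by simp
  have lin1: "semilinear_on to_ac s fun_scale (span BB) (\<lambda>b. J (br a b))" if "a \<in> span BB" for a
    using linear_right that brL semilinear_onD[OF J_lin] unfolding semilinear_on_def BB(2) by auto
  have brE_J: "brE f (J x) = lift fun_scale (\<lambda>a. J (br a x)) f" if "x \<in> span BB" "f \<in> finsupp BB" for f x
  proof -
    have "lift fun_scale (\<lambda>b. J (br a b)) (J x) = J (br a x)" if "f a \<noteq> 0" for a
      unfolding J_def
      using lift_coordinates[OF BB(1) F.vector_space_axioms lin1[unfolded J_def], of a x]
        that \<open>x \<in> _\<close> \<open>f \<in> _\<close> span_base by (auto simp: finsupp_def)
    then show ?thesis unfolding brE_def lift_def[of _ _ f] by (intro sum.cong) auto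
  qed
  have brE_JJ: "brE (J x) (J y) = J (br x y)" if "x \<in> span BB" "y \<in> span BB" for x y
  proof -
    have "semilinear_on to_ac s fun_scale (span BB) (\<lambda>a. J (br a y))"
      using linear_left that brL semilinear_onD[OF J_lin] unfolding semilinear_on_def BB(2) by auto
    then show ?thesis
      unfolding brE_J[OF that(2) JE] using lift_coordinates[OF BB(1) F.vector_space_axioms] that(1)
      unfolding J_def by blast
  qed
  have bil: "bilinear_map_on fun_scale fun_scale (finsupp BB) brE"
    unfolding bilinear_map_on_def
  proof (intro conjI ballI)
    fix g :: "'a \<Rightarrow> 'k alg_closure" assume g: "g \<in> finsupp BB"
    show "linear_map_on fun_scale fun_scale (finsupp BB) (\<lambda>f. brE f g)"
      unfolding brE_def by (rule linear_lift[OF F.vector_space_axioms])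
    note L = semilinear_onD[OF linear_lift[OF F.vector_space_axioms, of BB]]
    show "linear_map_on fun_scale fun_scale (finsupp BB) (brE g)"
      unfolding semilinear_on_def brE_def lift_def[of _ _ g]
      by (auto simp: L F.scale_right_distrib sum.distrib F.scale_sum_right F.scale_left_commute intro!: sum.cong)
  qed
  have "lie_algebra fun_scale brE (F.span (J ` BB))"
  proof (rule lie_algebra_spanI[OF F.vector_space_axioms])
    show "bilinear_map_on fun_scale fun_scale (F.span (J ` BB)) brE" using bil unfolding span_J .
    have BL: "x \<in> sum_cmp s UNIV G" if "x \<in> BB" for x using that span_base BB by blast
    show "brE x y \<in> F.span (J ` BB)" if "x \<in> J ` BB" "y \<in> J ` BB" for x y
      using that brE_JJ span_base JE unfolding span_J[symmetric] by auto
    show "brE x y = - brE y x" if xy: "x \<in> J ` BB" "y \<in> J ` BB" for x y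
    proof -
      obtain a b where ab: "a \<in> BB" "b \<in> BB" "x = J a" "y = J b" using xy by blast
      have "J (- br b a) = - J (br b a)"
        using semilinear_onD(2)[OF J_lin, of "br b a" "-1"] brL span_base ab
        by (auto simp: fun_eq_iff)
      then show ?thesis using brE_JJ span_base ab anticommute[OF BL BL, OF ab(1,2)] by simp
    qed
    show "brE x (brE y z) + brE y (brE z x) + brE z (brE x y) = 0"
      if xyz: "x \<in> J ` BB" "y \<in> J ` BB" "z \<in> J ` BB" for x y z
    proof -
      obtain a b c where abc: "a \<in> span BB" "b \<in> span BB" "c \<in> span BB" "x = J a" "y = J b" "z = J c"
        using xyz span_base by blast
      have *: "br a (br b c) \<in> span BB" "br b (br c a) \<in> span BB" "br c (br a b) \<in> span BB"
        using abc brL by auto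
      have "brE x (brE y z) + brE y (brE z x) + brE z (brE x y)
          = J (br a (br b c) + br b (br c a) + br c (br a b))"
        using abc brE_JJ brL * span_add semilinear_onD(1)[OF J_lin] by simp
      also have "\<dots> = 0"
        using jacobi[of a b c] abc(1-3) semilinear_on_zero[OF J_lin span_zero] BB(2) by simp
      finally show ?thesis .
    qed
  qed
  then have lieE: "lie_algebra fun_scale brE (finsupp BB)" unfolding span_J .
  have sumE: "sum_cmp fun_scale UNIV E = finsupp BB"
  proof
    show "sum_cmp fun_scale UNIV E \<subseteq> finsupp BB"
      unfolding sum_cmp_def using E_sub subspace_finsupp by (intro F.span_minimal) auto
    have "J b \<in> (\<Union>p. E p)" if "b \<in> BB" for b
      using that J_cmp BG(1) unfolding E_def BB_def by blast
    then show "finsupp BB \<subseteq> sum_cmp fun_scale UNIV E"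
      unfolding span_J sum_cmp_def by (intro F.span_mono) auto
  qed
  have brE_mem: "brE f g \<in> E (p + q)" if "f \<in> E p" "g \<in> E q" for f g p q
    unfolding brE_def
  proof (rule lift_mem[OF F.vector_space_axioms, where B = "B p"])
    show "lift fun_scale (\<lambda>b. J (br a b)) g \<in> E (p + q)" if "a \<in> B p" for a
      using \<open>g \<in> E q\<close> J_cmp bracket_cmp that BG(1) unfolding E_def
      by (intro lift_mem[OF F.vector_space_axioms subspace_finsupp, where B = "B q"]) blast+
  qed (use that subspace_finsupp in \<open>auto simp: E_def\<close>)
  \<comment> \<open>Being annihilated by V is a K-linear system for the coefficients of f. A
    functional that is 1 at some nonzero coefficient would turn f into a nonzero element of G
    annihilated by V.\<close>
  have E_trans: "f = 0" if p: "p \<ge> 0" and f: "f \<in> E p" and ann: "\<And>v. v \<in> E (- 1) \<Longrightarrow> brE v f = 0" for p f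
  proof (rule ccontr)
    assume "f \<noteq> 0"
    then obtain b0 where b0: "f b0 \<noteq> 0" by (auto simp: fun_eq_iff)
    obtain l :: "'k alg_closure \<Rightarrow> 'k" where l: "\<And>x y. l (x + y) = l x + l y"
      "\<And>a x. l (to_ac a * x) = a * l x" "l 0 = 0" "l (f b0) = 1"
      using ac_functional[OF b0] by metis
    have supp: "f b \<noteq> 0 \<Longrightarrow> b \<in> B p" for b using f unfolding E_def finsupp_def by blast
    define x where "x = (\<Sum>b\<in>B p. s (l (f b)) b)"
    have xG: "x \<in> G p" unfolding x_def B(3)[symmetric] by (intro span_sum span_scale span_base)
    have B_ann: "br v x = 0" if v: "v \<in> B (- 1)" for v
    proof -
      have vL: "v \<in> sum_cmp s UNIV G" "v \<in> G (- 1)" using v BG cmp_subset by blast+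
      have bp: "b \<in> sum_cmp s UNIV G" if "b \<in> B p" for b using that BG cmp_subset by blast
      have eq: "br v x = (\<Sum>b\<in>B p. s (l (f b)) (br v b))"
        unfolding x_def
        by (rule semilinear_on_sum[OF linear_right[OF vL(1)] vector_space_axioms subspace_L B(1)]) (rule bp)
      have "J v = (\<lambda>c. if c = v then 1 else 0)"
        unfolding J_def using coordinates_basis[OF BB(1)] v BG by blast
      then have "{c. J v c \<noteq> 0} = {v}" "J v v = 1" by auto
      then have "brE (J v) f = lift fun_scale (\<lambda>b. J (br v b)) f"
        unfolding brE_def lift_def[of _ _ "J v"] by simp
      also have "\<dots> = (\<Sum>b\<in>B p. fun_scale (f b) (J (br v b)))"
        using supp B(1) by (intro lift_eq[OF F.vector_space_axioms]) auto
      finally have z: "(\<Sum>b\<in>B p. fun_scale (f b) (J (br v b))) = 0"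
        using ann J_cmp vL unfolding E_def by metis
      have brvb: "br v b \<in> span BB" if "b \<in> B p" for b
        using brL bp that vL BB by simp
      have "representation BB (br v x) c = 0" for c
      proof -
        have "representation BB (br v x) c = (\<Sum>b\<in>B p. l (f b) * representation BB (br v b) c)"
          unfolding eq using brvb
          by (subst representation_sum[OF BB(1)]) (auto simp: representation_scale[OF BB(1)] span_scale intro!: sum.cong)
        also have "\<dots> = l ((\<Sum>b\<in>B p. fun_scale (f b) (J (br v b))) c)"
          unfolding sum_fun_apply ac_functional_sum[OF l(1,3)] J_def coordinates_def fun_scale_apply
          by (intro sum.cong refl) (metis l(2) mult.commute)
        also have "\<dots> = 0" unfolding z using l by simp
        finally show ?thesis .
      qed
      moreover have "br v x \<in> span BB" using brL vL xG GBB by blast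
      ultimately show ?thesis using sum_nonzero_representation_eq[OF BB(1), of "br v x"] by simp
    qed
    have "br v x = 0" if "v \<in> G (- 1)" for v
    proof (rule annihilates_span[OF cmp_subset[OF xG]])
      show "B (- 1) \<subseteq> sum_cmp s UNIV G" using BG(1) cmp_subset by blast
      show "v \<in> span (B (- 1))" using that B(3) by simp
      show "br u x = 0" if "u \<in> B (- 1)" for u using B_ann that .
    qed
    then have "x = 0" using transitive[OF p xG] by blast
    then have "l (f b0) = 0"
      using independentD[OF B(2) B(1) order_refl, of "\<lambda>b. l (f b)"] supp[OF b0] unfolding x_def by blast
    then show False using l by simp
  qed
  have "graded_lie_algebra fun_scale brE E"
  proof (rule graded_lie_algebra.intro[OF lieE[folded sumE]], unfold_locales)
    show "F.subspace (E p)" for p unfolding E_def by (rule subspace_finsupp)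
    show "c p = 0" if c: "finite {p. c p \<noteq> 0}" "\<And>p. c p \<in> E p" "(\<Sum>p | c p \<noteq> 0. c p) = 0" for c p
    proof
      fix b
      have *: "c q b = 0" if "b \<notin> B q" for q using c(2)[of q] that unfolding E_def finsupp_def by blast
      show "c p b = 0 b"
      proof (cases "b \<in> B p")
        case True
        then have "c q b = 0" if "q \<noteq> p" for q using * U(3)[OF that] by blast
        then have "(\<Sum>q | c q \<noteq> 0. c q b) = (\<Sum>q | c q \<noteq> 0. if q = p then c p b else 0)"
          by (intro sum.cong) auto
        also have "\<dots> = c p b" using c(1) by auto
        finally show ?thesis using c(3) sum_fun_apply[of c "{q. c q \<noteq> 0}" b] by simp
      qed (use * in auto)
    qed
    show "brE x y \<in> E (p + q)" if "x \<in> E p" "y \<in> E q" for x y p q using brE_mem that .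
  qed
  then interpret E: graded_lie_algebra fun_scale brE E .
  have "transitive_depth_two fun_scale brE E"
  proof unfold_locales
    show "finite_dimensional fun_scale (E p)" for p
      unfolding finite_dimensional_def E_def finsupp_span[OF B(2)] using B(1) by blast
    show "E p = {0}" if "p < - 2" for p
    proof -
      have "B p \<subseteq> {0}" using depth[OF that] BG by blast
      then have "B p = {}" using B(2)[of p] dependent_zero by auto
      then show ?thesis unfolding E_def finsupp_def by (auto simp: fun_eq_iff)
    qed
    show "f = 0" if "p \<ge> 0" "f \<in> E p" "\<And>v. v \<in> E (- 1) \<Longrightarrow> brE v f = 0" for p f
      using E_trans that .
    let ?A = "{br x y | x y. x \<in> G (- 1) \<and> y \<in> G (- 1)}"
    let ?AE = "{brE x y | x y. x \<in> E (- 1) \<and> y \<in> E (- 1)}"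
    have "span ?A \<subseteq> span BB" using brL GBB by (intro span_minimal) auto
    then have "J ` span ?A \<subseteq> F.span (J ` ?A)"
      using semilinear_image_span[OF F.vector_space_axioms semilinear_on_subset[OF J_lin]] by blast
    also have "\<dots> \<subseteq> F.span ?AE"
    proof (intro F.span_mono subsetI)
      fix f assume "f \<in> J ` ?A"
      then obtain x y where "f = J (br x y)" "x \<in> G (- 1)" "y \<in> G (- 1)" by blast
      then have "f = brE (J x) (J y)" "J x \<in> E (- 1)" "J y \<in> E (- 1)"
        using brE_JJ GBB J_cmp unfolding E_def by auto
      then show "f \<in> ?AE" by blast
    qed
    finally have "J ` G (- 2) \<subseteq> F.span ?AE" using fundamental by blast
    moreover have "coordinates s (B (- 2)) b = J b" if "b \<in> B (- 2)" for b
      unfolding J_def using coordinates_basis[OF B(2) that] coordinates_basis[OF BB(1) subsetD[OF BG(2) that]] by simp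
    ultimately have "coordinates s (B (- 2)) ` B (- 2) \<subseteq> F.span ?AE" using BG(1) by fastforce
    then show "E (- 2) \<subseteq> F.span ?AE"
      unfolding E_def finsupp_span[OF B(2)] by (intro F.span_minimal F.subspace_span)
  qed
  moreover have "\<exists>p\<ge>N. E p \<noteq> {0}" for N
  proof -
    obtain p where p: "p \<ge> N" "G p \<noteq> {0}" using inf by blast
    then have "B p \<noteq> {}" using B(3)[of p] by auto
    then obtain b where b: "b \<in> B p" by blast
    have "J b \<noteq> 0" unfolding J_def using coordinates_basis[OF BB(1) subsetD[OF BG(2) b]] by (auto simp: fun_eq_iff)
    moreover have "J b \<in> E p" using J_cmp b BG unfolding E_def by blast
    ultimately show ?thesis using p by blast
  qed
  ultimately obtain z u where z: "z \<in> E (- 1)" "z \<noteq> 0" "u \<in> E (- 2)"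
    "\<And>y. y \<in> E (- 1) \<Longrightarrow> brE z y \<in> F.span {u}"
    by (rule transitive_depth_two_rank_one) blast
  define A where "A = {a. z a \<noteq> 0}"
  have A: "finite A" "A \<subseteq> B (- 1)" using z(1) unfolding A_def E_def finsupp_def by auto
  \<comment> \<open>On degree -2 the lift of \<phi> undoes the passage to coordinates, so the
    rank-one statement can be read in the target of \<phi>.\<close>
  have \<phi>J: "lift t \<phi> (J x) = \<phi> x" if "x \<in> G (- 2)" for x
  proof -
    have "representation BB x = representation (B (- 2)) x"
      using representation_extend[OF BB(1), of x "B (- 2)"] that B BG by auto
    then have "J x = coordinates s (B (- 2)) x" unfolding J_def coordinates_def by simp
    then show ?thesis using lift_coordinates[OF B(2) t, of "- 2" \<phi> x] \<phi> that B(3) by simp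
  qed
  have lin\<phi>: "linear_map_on fun_scale t (finsupp (B (- 2))) (lift t \<phi>)" by (rule linear_lift[OF t])
  show ?thesis
  proof (rule that[of A z "lift t \<phi> u"])
    show "A \<noteq> {}" using z(2) unfolding A_def by (auto simp: fun_eq_iff)
    show "\<not> dependent A" using independent_mono[OF B(2) A(2)] .
    show "A \<subseteq> G (- 1)" using A BG by blast
    show "(\<Sum>a\<in>A. t (z a) (\<phi> (br a x))) \<in> t.span {lift t \<phi> u}" if x: "x \<in> G (- 1)" for x
    proof -
      have brG: "br a x \<in> G (- 2)" if "a \<in> A" for a using bracket_cmp'[of a "- 1" x "- 1"] that A x BG by auto
      have "brE z (J x) = (\<Sum>a\<in>A. fun_scale (z a) (J (br a x)))"
        using brE_J[OF GBB[OF x]] z(1) E_sub unfolding lift_def A_def by blast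
      moreover have "lift t \<phi> \<dots> = (\<Sum>a\<in>A. t (z a) (lift t \<phi> (J (br a x))))"
        using J_cmp brG A(1) by (intro semilinear_on_sum[OF lin\<phi> F.vector_space_axioms subspace_finsupp]) auto
      moreover have "\<dots> = (\<Sum>a\<in>A. t (z a) (\<phi> (br a x)))"
        using \<phi>J brG by (intro sum.cong) auto
      moreover obtain c where c: "brE z (J x) = fun_scale c u"
        using z(4)[of "J x"] J_cmp[OF x] unfolding F.span_singleton E_def by blast
      moreover have "lift t \<phi> (fun_scale c u) = t c (lift t \<phi> u)"
        using semilinear_onD(2)[OF lin\<phi>] z(3) unfolding E_def by blast
      ultimately show ?thesis unfolding t.span_singleton by auto
    qed
  qed (use A A_def in auto)
qed

subsection \<open>Formal vector fields preserving a constant two-form\<close>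

text \<open>
  A formal power series \<open>f\<close> in the variables \<open>'i\<close> is encoded by its derivatives at the origin:
  \<open>f [i\<^sub>1, \<dots>, i\<^sub>k]\<close> is the value of \<open>\<partial>\<^sub>i\<^sub>1 \<dots> \<partial>\<^sub>i\<^sub>k f\<close>. Partial derivatives become shifts, the product is
  determined by the Leibniz rule, and symmetry of \<open>f\<close> says that partial derivatives commute.
\<close>

definition pd :: "'i \<Rightarrow> ('i list \<Rightarrow> 'k) \<Rightarrow> 'i list \<Rightarrow> 'k" where
  "pd i f = (\<lambda>l. f (i # l))"

fun hmul :: "('i list \<Rightarrow> 'k::comm_ring_1) \<Rightarrow> ('i list \<Rightarrow> 'k) \<Rightarrow> 'i list \<Rightarrow> 'k" where
  "hmul f g [] = f [] * g []"
| "hmul f g (i # l) = hmul (pd i f) g l + hmul f (pd i g) l"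

definition symmetric :: "('i list \<Rightarrow> 'k) \<Rightarrow> bool" where
  "symmetric f \<longleftrightarrow> (\<forall>l a b l'. f (l @ a # b # l') = f (l @ b # a # l'))"

lemma pd_apply [simp]: "pd i f l = f (i # l)"
  by (simp add: pd_def)

lemma pd_linear [simp]:
  shows "pd i (f + g) = pd i f + pd i g" "pd i (f - g) = pd i f - pd i g" "pd i (- f) = - pd i f"
    "pd i 0 = 0"
  by (auto simp: fun_eq_iff)

lemma pd_scale [simp]: "pd i (fun_scale c f) = fun_scale c (pd i f)"
  by (auto simp: fun_eq_iff)

lemma pd_sum [simp]: "pd i (\<Sum>a\<in>A. f a) = (\<Sum>a\<in>A. pd i (f a))"
  by (auto simp: fun_eq_iff sum_fun_apply)

lemma pd_hmul [simp]: "pd i (hmul f g) = hmul (pd i f) g + hmul f (pd i g)"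
  by (auto simp: fun_eq_iff)

lemma hmul_add_left: "hmul (f + g) h = hmul f h + hmul g h"
proof
  show "hmul (f + g) h l = (hmul f h + hmul g h) l" for l
    by (induction l arbitrary: f g h) (auto simp: algebra_simps)
qed

lemma hmul_commute: "hmul f g = hmul g f"
proof
  show "hmul f g l = hmul g f l" for l
    by (induction l arbitrary: f g) (auto simp: mult.commute add.commute)
qed

lemma hmul_add_right: "hmul h (f + g) = hmul h f + hmul h g"
  using hmul_add_left hmul_commute by metis

lemma hmul_assoc: "hmul (hmul f g) h = hmul f (hmul g h)"
proof
  show "hmul (hmul f g) h l = hmul f (hmul g h) l" for l
    by (induction l arbitrary: f g h) (auto simp: mult.assoc hmul_add_left hmul_add_right algebra_simps)
qed

lemma hmul_scale_left: "hmul (fun_scale c f) g = fun_scale c (hmul f g)"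
proof
  show "hmul (fun_scale c f) g l = fun_scale c (hmul f g) l" for l
    by (induction l arbitrary: f g) (auto simp: algebra_simps)
qed

lemma hmul_scale_right: "hmul g (fun_scale c f) = fun_scale c (hmul g f)"
  using hmul_scale_left hmul_commute by metis

lemma hmul_zero [simp]: "hmul 0 f = 0" "hmul f 0 = 0"
proof -
  have "hmul 0 f l = 0" for l by (induction l arbitrary: f) auto
  then show "hmul 0 f = 0" by auto
  then show "hmul f 0 = 0" using hmul_commute by metis
qed

lemma hmul_diff_left: "hmul (f - g) h = hmul f h - hmul g h"
  using hmul_add_left[of "f - g" g h] by (simp add: eq_diff_eq)

lemma hmul_diff_right: "hmul h (f - g) = hmul h f - hmul h g"
  using hmul_add_right[of h "f - g" g] by (simp add: eq_diff_eq)

lemma hmul_sum_left: "hmul (\<Sum>a\<in>A. f a) g = (\<Sum>a\<in>A. hmul (f a) g)"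
  by (induction A rule: infinite_finite_induct) (simp_all only: sum.infinite sum.empty sum.insert not_False_eq_True hmul_zero hmul_add_left)

lemma hmul_sum_right: "hmul g (\<Sum>a\<in>A. f a) = (\<Sum>a\<in>A. hmul g (f a))"
  by (induction A rule: infinite_finite_induct) (simp_all only: sum.infinite sum.empty sum.insert not_False_eq_True hmul_zero hmul_add_right)

lemma hmul_unit: "hmul (\<lambda>l. if l = [] then 1 else 0) f = f"
proof
  have "pd i (\<lambda>l. if l = [] then 1 else 0) = (0 :: 'a list \<Rightarrow> 'b)" for i by (auto simp: fun_eq_iff)
  then show "hmul (\<lambda>l. if l = [] then 1 else 0) f l = f l" for l
    by (induction l arbitrary: f) auto
qed

lemma hmul_support:
  assumes "\<And>l. f l \<noteq> 0 \<Longrightarrow> set l \<subseteq> I" "\<And>l. g l \<noteq> 0 \<Longrightarrow> set l \<subseteq> I"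
  shows "hmul f g l \<noteq> 0 \<Longrightarrow> set l \<subseteq> I"
  using assms
proof (induction l arbitrary: f g)
  case (Cons i l)
  have "hmul (pd i f) g l \<noteq> 0 \<or> hmul f (pd i g) l \<noteq> 0" using Cons.prems(1) by auto
  moreover have "i \<in> I" if nz: "pd i h \<noteq> 0" and h: "\<And>l. h l \<noteq> 0 \<Longrightarrow> set l \<subseteq> I" for h :: "'a list \<Rightarrow> 'b"
  proof -
    obtain l where "h (i # l) \<noteq> 0" using nz by (auto simp: fun_eq_iff)
    from h[OF this] show ?thesis by simp
  qed
  moreover have "pd i f \<noteq> 0 \<or> pd i g \<noteq> 0"
  proof (rule ccontr)
    assume "\<not> (pd i f \<noteq> 0 \<or> pd i g \<noteq> 0)"
    then show False using \<open>hmul (pd i f) g l \<noteq> 0 \<or> hmul f (pd i g) l \<noteq> 0\<close> by simp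
  qed
  ultimately have "i \<in> I" using Cons.prems(2,3) by blast
  moreover have "set l \<subseteq> I" if "pd i h l \<noteq> 0" "\<And>l. h l \<noteq> 0 \<Longrightarrow> set l \<subseteq> I" for l and h :: "'a list \<Rightarrow> 'b"
    using that(2)[of "i # l"] that(1) by simp
  then have "set l \<subseteq> I"
    using Cons.IH[of "pd i f" g] Cons.IH[of f "pd i g"] Cons.prems(2,3)
      \<open>hmul (pd i f) g l \<noteq> 0 \<or> hmul f (pd i g) l \<noteq> 0\<close> by blast
  ultimately show ?case by simp
qed auto

lemma hmul_degree:
  assumes "hmul f g l \<noteq> 0" "\<And>l. f l \<noteq> 0 \<Longrightarrow> int (length l) = p" "\<And>l. g l \<noteq> 0 \<Longrightarrow> int (length l) = q"
  shows "int (length l) = p + q"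
  using assms
proof (induction l arbitrary: f g p q)
  case Nil
  then have "f [] \<noteq> 0" "g [] \<noteq> 0" by auto
  from Nil.prems(2)[OF this(1)] Nil.prems(3)[OF this(2)] show ?case by simp
next
  case (Cons i l)
  have "hmul (pd i f) g l \<noteq> 0 \<or> hmul f (pd i g) l \<noteq> 0" using Cons.prems(1) by auto
  then show ?case
  proof
    assume "hmul (pd i f) g l \<noteq> 0"
    then have "int (length l) = (p - 1) + q" using Cons.prems by (intro Cons.IH) force+
    then show ?thesis by simp
  next
    assume "hmul f (pd i g) l \<noteq> 0"
    then have "int (length l) = p + (q - 1)" using Cons.prems by (intro Cons.IH) force+
    then show ?thesis by simp
  qed
qed

lemma pd_commute: "symmetric f \<Longrightarrow> pd a (pd b f) = pd b (pd a f)"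
  unfolding symmetric_def fun_eq_iff pd_def by (metis append_Nil)

lemma symmetric_pd: "symmetric f \<Longrightarrow> symmetric (pd a f)"
  unfolding symmetric_def pd_def by (metis append_Cons)

lemma symmetric_hmul:
  assumes "symmetric f" "symmetric g"
  shows "symmetric (hmul f g)"
proof -
  have "hmul f g (l @ a # b # l') = hmul f g (l @ b # a # l')" for l a b l'
    using assms
  proof (induction l arbitrary: f g)
    case Nil
    have "pd b (pd a f) = pd a (pd b f)" "pd b (pd a g) = pd a (pd b g)"
      by (rule pd_commute[OF Nil(1)] pd_commute[OF Nil(2)])+
    then show ?case by simp
  qed (auto simp: symmetric_pd)
  then show ?thesis unfolding symmetric_def by blast
qed

lemma symmetric_linear:
  shows "symmetric (0 :: _ \<Rightarrow> 'k::field)" "symmetric f \<Longrightarrow> symmetric g \<Longrightarrow> symmetric (f + g :: _ \<Rightarrow> 'k::field)"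
    "symmetric f \<Longrightarrow> symmetric g \<Longrightarrow> symmetric (f - g :: _ \<Rightarrow> 'k::field)" "symmetric f \<Longrightarrow> symmetric (fun_scale c f)"
  unfolding symmetric_def by auto

lemma symmetric_sum: "(\<And>a. a \<in> A \<Longrightarrow> symmetric (f a)) \<Longrightarrow> symmetric (\<Sum>a\<in>A. f a :: _ \<Rightarrow> 'k::field)"
  by (induction A rule: infinite_finite_induct) (simp_all only: sum.infinite sum.empty sum.insert not_False_eq_True symmetric_linear insert_iff simp_thms)

text \<open>I indexes a basis of V and C a basis of the future center; \<open>bs g i j\<close> is
  the g-th coordinate of \<omega>(e_i, e_j). So \<omega> is a family of scalar two-forms with
  constant coefficients.\<close>

locale two_form =
  fixes I :: "'i set" and C :: "'c set" and bs :: "'c \<Rightarrow> 'i \<Rightarrow> 'i \<Rightarrow> 'k::field_char_0"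
  assumes finite_I: "finite I" and finite_C: "finite C"
    and skew: "bs g i j = - bs g j i" and bs_C: "g \<notin> C \<Longrightarrow> bs g i j = 0"
begin

definition lie_derivative :: "('i \<Rightarrow> 'i list \<Rightarrow> 'k) \<Rightarrow> ('i list \<Rightarrow> 'k) \<Rightarrow> 'i list \<Rightarrow> 'k" where
  "lie_derivative P f = (\<Sum>j\<in>I. hmul (P j) (pd j f))"

definition field_bracket :: "('i \<Rightarrow> 'i list \<Rightarrow> 'k) \<Rightarrow> ('i \<Rightarrow> 'i list \<Rightarrow> 'k) \<Rightarrow> 'i \<Rightarrow> 'i list \<Rightarrow> 'k" where
  "field_bracket P Q = (\<lambda>i. lie_derivative P (Q i) - lie_derivative Q (P i))"

definition contraction :: "'c \<Rightarrow> ('i \<Rightarrow> 'i list \<Rightarrow> 'k) \<Rightarrow> 'i \<Rightarrow> 'i list \<Rightarrow> 'k" where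
  "contraction g P b = (\<Sum>k\<in>I. fun_scale (bs g k b) (P k))"

text \<open>\<omega> is evaluated on the values of the fields at the origin. Taking constant terms
  only keeps the center in the single degree -2.\<close>

definition pairing :: "'c \<Rightarrow> ('i \<Rightarrow> 'i list \<Rightarrow> 'k) \<Rightarrow> ('i \<Rightarrow> 'i list \<Rightarrow> 'k) \<Rightarrow> 'k" where
  "pairing g P Q = (\<Sum>i\<in>I. \<Sum>j\<in>I. bs g i j * P i [] * Q j [])"

text \<open>For constant \<omega>, Cartan's formula reads L_P \<omega> = d(i_P \<omega>), so
  preserving \<omega> means that the first derivatives of the one-form i_P \<omega> are
  symmetric.\<close>

definition fields :: "('i \<Rightarrow> 'i list \<Rightarrow> 'k) set" where
  "fields = {P. (\<forall>i. symmetric (P i)) \<and> (\<forall>i l. P i l \<noteq> 0 \<longrightarrow> i \<in> I \<and> set l \<subseteq> I) \<and>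
     (\<forall>g. \<forall>a\<in>I. \<forall>b\<in>I. pd a (contraction g P b) = pd b (contraction g P a))}"

lemma lie_derivative_linear:
  shows "lie_derivative P (f + g) = lie_derivative P f + lie_derivative P g"
    "lie_derivative P (f - g) = lie_derivative P f - lie_derivative P g"
    "lie_derivative P (fun_scale c f) = fun_scale c (lie_derivative P f)"
    "lie_derivative P 0 = 0"
    "lie_derivative (P + Q) f = lie_derivative P f + lie_derivative Q f"
    "lie_derivative (P - Q) f = lie_derivative P f - lie_derivative Q f"
    "lie_derivative (\<lambda>i. fun_scale c (P i)) f = fun_scale c (lie_derivative P f)"
proof -
  interpret vector_space "fun_scale :: 'k \<Rightarrow> ('i list \<Rightarrow> 'k) \<Rightarrow> _" by (rule vector_space_fun_scale)
  show "lie_derivative P (f + g) = lie_derivative P f + lie_derivative P g"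
    "lie_derivative P (f - g) = lie_derivative P f - lie_derivative P g"
    "lie_derivative P (fun_scale c f) = fun_scale c (lie_derivative P f)"
    "lie_derivative P 0 = 0"
    "lie_derivative (P + Q) f = lie_derivative P f + lie_derivative Q f"
    "lie_derivative (P - Q) f = lie_derivative P f - lie_derivative Q f"
    "lie_derivative (\<lambda>i. fun_scale c (P i)) f = fun_scale c (lie_derivative P f)"
    unfolding lie_derivative_def
    by (simp_all add: hmul_add_right hmul_add_left hmul_diff_left hmul_diff_right hmul_scale_left
        hmul_scale_right sum.distrib sum_subtractf scale_sum_right)
qed

lemma lie_derivative_sum: "lie_derivative P (\<Sum>a\<in>A. f a) = (\<Sum>a\<in>A. lie_derivative P (f a))"
  by (induction A rule: infinite_finite_induct) (simp_all only: sum.infinite sum.empty sum.insert not_False_eq_True lie_derivative_linear)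

lemma symmetric_lie_derivative:
  "(\<And>i. symmetric (P i)) \<Longrightarrow> symmetric f \<Longrightarrow> symmetric (lie_derivative P f)"
  unfolding lie_derivative_def by (intro symmetric_sum symmetric_hmul symmetric_pd)

text \<open>A composition of two derivations has a second-order part \<open>S\<close>, which is
  symmetric in the two fields because partial derivatives commute; it cancels in the
  commutator.\<close>

lemma lie_derivative_commutator:
  assumes "symmetric f"
  shows "lie_derivative (field_bracket P Q) f
    = lie_derivative P (lie_derivative Q f) - lie_derivative Q (lie_derivative P f)"
proof -
  define S where "S P Q = (\<Sum>j\<in>I. \<Sum>k\<in>I. hmul (P j) (hmul (Q k) (pd j (pd k f))))" for P Q
  have S: "S P Q = S Q P" for P Q
  proof -
    have "S P Q = (\<Sum>k\<in>I. \<Sum>j\<in>I. hmul (P j) (hmul (Q k) (pd j (pd k f))))"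
      unfolding S_def by (rule sum.swap)
    also have "\<dots> = S Q P"
      unfolding S_def
      by (intro sum.cong refl)
        (metis hmul_assoc hmul_commute pd_commute[OF assms])
    finally show ?thesis .
  qed
  have two: "lie_derivative P (lie_derivative Q f) = (\<Sum>k\<in>I. hmul (lie_derivative P (Q k)) (pd k f)) + S P Q" for P Q
  proof -
    have "lie_derivative P (lie_derivative Q f)
        = (\<Sum>j\<in>I. \<Sum>k\<in>I. hmul (P j) (hmul (pd j (Q k)) (pd k f))) + S P Q"
      unfolding lie_derivative_def S_def
      by (simp add: hmul_sum_right hmul_add_right sum.distrib)
    also have "(\<Sum>j\<in>I. \<Sum>k\<in>I. hmul (P j) (hmul (pd j (Q k)) (pd k f)))
        = (\<Sum>k\<in>I. \<Sum>j\<in>I. hmul (P j) (hmul (pd j (Q k)) (pd k f)))" by (rule sum.swap)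
    also have "\<dots> = (\<Sum>k\<in>I. hmul (lie_derivative P (Q k)) (pd k f))"
      unfolding lie_derivative_def by (simp add: hmul_sum_left hmul_assoc)
    finally show ?thesis .
  qed
  have "lie_derivative (field_bracket P Q) f
      = (\<Sum>k\<in>I. hmul (lie_derivative P (Q k)) (pd k f)) - (\<Sum>k\<in>I. hmul (lie_derivative Q (P k)) (pd k f))"
    unfolding lie_derivative_def[of "field_bracket P Q"] unfolding field_bracket_def
    by (simp add: hmul_diff_left sum_subtractf)
  then show ?thesis unfolding two S[of P Q] by simp
qed

text \<open>By \<open>lie_derivative_commutator\<close> every component becomes a sum of iterated
  Lie derivatives of components, which cancel over the cyclic sum.\<close>

lemma field_bracket_jacobi:
  assumes "\<And>i. symmetric (P i)" "\<And>i. symmetric (Q i)" "\<And>i. symmetric (R i)"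
  shows "field_bracket P (field_bracket Q R) + field_bracket Q (field_bracket R P)
    + field_bracket R (field_bracket P Q) = 0"
proof
  fix i
  show "(field_bracket P (field_bracket Q R) + field_bracket Q (field_bracket R P)
      + field_bracket R (field_bracket P Q)) i = 0 i"
    unfolding plus_fun_apply field_bracket_def[of P "field_bracket Q R"]
      field_bracket_def[of Q "field_bracket R P"] field_bracket_def[of R "field_bracket P Q"]
      lie_derivative_commutator[OF assms(1)] lie_derivative_commutator[OF assms(2)]
      lie_derivative_commutator[OF assms(3)]
    unfolding field_bracket_def lie_derivative_linear by (simp add: fun_eq_iff)
qed

text \<open>Cartan's formula \<open>i\<^bsub>[P,Q]\<^esub> \<omega> = - d (\<omega> (P, Q))\<close> for fields with \<open>d (i\<^bsub>P\<^esub> \<omega>) = d (i\<^bsub>Q\<^esub> \<omega>) = 0\<close>.\<close>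

lemma contraction_bracket:
  assumes P: "P \<in> fields" and Q: "Q \<in> fields" and a: "a \<in> I"
  shows "contraction g (field_bracket P Q) a
    = - pd a (\<Sum>j\<in>I. \<Sum>k\<in>I. fun_scale (bs g j k) (hmul (P j) (Q k)))"
proof -
  interpret vector_space "fun_scale :: 'k \<Rightarrow> ('i list \<Rightarrow> 'k) \<Rightarrow> _" by (rule vector_space_fun_scale)
  \<comment> \<open>Closedness of i_Q \<omega> exchanges the direction of differentiation with the
    component index a.\<close>
  have half: "(\<Sum>k\<in>I. fun_scale (bs g k a) (lie_derivative P (Q k)))
      = (\<Sum>j\<in>I. \<Sum>k\<in>I. fun_scale (bs g k j) (hmul (P j) (pd a (Q k))))" if Q: "Q \<in> fields" for P Q
  proof -
    have "(\<Sum>k\<in>I. fun_scale (bs g k a) (lie_derivative P (Q k))) = lie_derivative P (contraction g Q a)"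
      unfolding contraction_def lie_derivative_sum lie_derivative_linear ..
    also have "\<dots> = (\<Sum>j\<in>I. hmul (P j) (pd a (contraction g Q j)))"
      unfolding lie_derivative_def using Q a by (intro sum.cong) (auto simp: fields_def)
    also have "\<dots> = (\<Sum>j\<in>I. \<Sum>k\<in>I. fun_scale (bs g k j) (hmul (P j) (pd a (Q k))))"
      unfolding contraction_def by (simp add: hmul_sum_right hmul_scale_right)
    finally show ?thesis .
  qed
  have "contraction g (field_bracket P Q) a
      = (\<Sum>j\<in>I. \<Sum>k\<in>I. fun_scale (bs g k j) (hmul (P j) (pd a (Q k))))
        - (\<Sum>j\<in>I. \<Sum>k\<in>I. fun_scale (bs g k j) (hmul (Q j) (pd a (P k))))"
    unfolding contraction_def[of g "field_bracket P Q"] unfolding field_bracket_def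
    by (simp add: scale_right_diff_distrib sum_subtractf half[OF P] half[OF Q])
  also have "(\<Sum>j\<in>I. \<Sum>k\<in>I. fun_scale (bs g k j) (hmul (P j) (pd a (Q k))))
      = - (\<Sum>j\<in>I. \<Sum>k\<in>I. fun_scale (bs g j k) (hmul (P j) (pd a (Q k))))"
    unfolding sum_negf[symmetric] by (intro sum.cong refl) (subst skew, simp)
  also have "(\<Sum>j\<in>I. \<Sum>k\<in>I. fun_scale (bs g k j) (hmul (Q j) (pd a (P k))))
      = (\<Sum>j\<in>I. \<Sum>k\<in>I. fun_scale (bs g j k) (hmul (pd a (P j)) (Q k)))"
    by (subst sum.swap) (simp add: hmul_commute)
  finally show ?thesis
    unfolding pd_sum pd_scale pd_hmul scale_right_distrib sum.distrib
    by (simp only: minus_add_distrib diff_conv_add_uminus add.commute)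
qed

text \<open>By \<open>contraction_bracket\<close> the contraction of a bracket is an exact form,
  hence closed.\<close>

lemma bracket_fields:
  assumes P: "P \<in> fields" and Q: "Q \<in> fields"
  shows "field_bracket P Q \<in> fields"
proof -
  have sym: "symmetric (P i)" "symmetric (Q i)" for i using P Q unfolding fields_def by auto
  have suppP: "i \<in> I \<and> set l \<subseteq> I" if "P i l \<noteq> 0" for i l using that P unfolding fields_def by auto
  have suppQ: "i \<in> I \<and> set l \<subseteq> I" if "Q i l \<noteq> 0" for i l using that Q unfolding fields_def by auto
  have sup: "i \<in> I \<and> set l \<subseteq> I" if nz: "lie_derivative P (Q i) l \<noteq> 0"
    and P: "\<And>i l. P i l \<noteq> 0 \<Longrightarrow> i \<in> I \<and> set l \<subseteq> I" and Q: "\<And>i l. Q i l \<noteq> 0 \<Longrightarrow> i \<in> I \<and> set l \<subseteq> I"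
    for P Q i l
  proof -
    have "(\<Sum>j\<in>I. hmul (P j) (pd j (Q i)) l) \<noteq> 0"
      using nz unfolding lie_derivative_def sum_fun_apply .
    then obtain j where j: "hmul (P j) (pd j (Q i)) l \<noteq> 0" by (rule sum.not_neutral_contains_not_neutral)
    have "set l \<subseteq> I"
    proof (rule hmul_support[OF _ _ j])
      show "set l \<subseteq> I" if "P j l \<noteq> 0" for l using P[OF that] by simp
      show "set l \<subseteq> I" if "pd j (Q i) l \<noteq> 0" for l using Q[of i "j # l"] that by simp
    qed
    moreover have "pd j (Q i) \<noteq> 0" using j by auto
    then have "i \<in> I" using Q by (auto simp: fun_eq_iff)
    ultimately show ?thesis by simp
  qed
  have "i \<in> I \<and> set l \<subseteq> I" if "field_bracket P Q i l \<noteq> 0" for i l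
  proof -
    have "lie_derivative P (Q i) l \<noteq> 0 \<or> lie_derivative Q (P i) l \<noteq> 0"
      using that unfolding field_bracket_def by auto
    then show ?thesis using sup[of P Q i l] sup[of Q P i l] suppP suppQ by metis
  qed
  moreover have "symmetric (field_bracket P Q i)" for i
    unfolding field_bracket_def by (intro symmetric_linear symmetric_lie_derivative sym)
  moreover have "pd a (contraction g (field_bracket P Q) b) = pd b (contraction g (field_bracket P Q) a)"
    if "a \<in> I" "b \<in> I" for a b g
  proof -
    let ?O = "\<Sum>j\<in>I. \<Sum>k\<in>I. fun_scale (bs g j k) (hmul (P j) (Q k))"
    have "symmetric ?O" by (intro symmetric_sum symmetric_linear symmetric_hmul sym)
    then have "pd a (pd b ?O) = pd b (pd a ?O)" by (rule pd_commute)
    then show ?thesis by (simp only: contraction_bracket[OF P Q that(1)] contraction_bracket[OF P Q that(2)] pd_linear(3))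
  qed
  ultimately show ?thesis unfolding fields_def by blast
qed

text \<open>The closed one-form i_Q \<omega> has a symmetric matrix of first derivatives at the
  origin. In terms of these matrices each cyclic summand is a difference of two values, and the six
  values cancel in pairs.\<close>

lemma pairing_cocycle:
  assumes "P \<in> fields" "Q \<in> fields" "R \<in> fields"
  shows "pairing g (field_bracket P Q) R + pairing g (field_bracket Q R) P + pairing g (field_bracket R P) Q = 0"
proof -
  \<comment> \<open>The first derivative of i_Q \<omega> at the origin, contracted with P(0) and
    R(0).\<close>
  define T where "T P Q R = (\<Sum>j\<in>I. \<Sum>b\<in>I. P j [] * R b [] * contraction g Q b [j])" for P Q R :: "'i \<Rightarrow> 'i list \<Rightarrow> 'k"
  have T_sym: "T P Q R = T R Q P" if "Q \<in> fields" for P Q R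
  proof -
    have "contraction g Q b [j] = contraction g Q j [b]" if "j \<in> I" "b \<in> I" for j b
    proof -
      have "pd j (contraction g Q b) [] = pd b (contraction g Q j) []"
        using \<open>Q \<in> fields\<close> that unfolding fields_def by auto
      then show ?thesis by simp
    qed
    then have "T P Q R = (\<Sum>j\<in>I. \<Sum>b\<in>I. P j [] * R b [] * contraction g Q j [b])"
      unfolding T_def by (intro sum.cong) auto
    then show ?thesis unfolding T_def[of R] by (subst sum.swap) (simp add: mult.commute)
  qed
  have p: "pairing g (field_bracket P Q) R = T P Q R - T Q P R" for P Q R
  proof -
    have half: "(\<Sum>k\<in>I. \<Sum>b\<in>I. bs g k b * lie_derivative P (Q k) [] * R b []) = T P Q R" for P Q
    proof -
      have "T P Q R = (\<Sum>j\<in>I. \<Sum>b\<in>I. \<Sum>k\<in>I. bs g k b * (P j [] * Q k [j]) * R b [])"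
        unfolding T_def contraction_def sum_fun_apply by (simp add: sum_distrib_left algebra_simps)
      also have "\<dots> = (\<Sum>b\<in>I. \<Sum>j\<in>I. \<Sum>k\<in>I. bs g k b * (P j [] * Q k [j]) * R b [])" by (rule sum.swap)
      also have "\<dots> = (\<Sum>b\<in>I. \<Sum>k\<in>I. \<Sum>j\<in>I. bs g k b * (P j [] * Q k [j]) * R b [])"
        by (intro sum.cong refl sum.swap)
      also have "\<dots> = (\<Sum>k\<in>I. \<Sum>b\<in>I. \<Sum>j\<in>I. bs g k b * (P j [] * Q k [j]) * R b [])" by (rule sum.swap)
      also have "\<dots> = (\<Sum>k\<in>I. \<Sum>b\<in>I. bs g k b * lie_derivative P (Q k) [] * R b [])"
        unfolding lie_derivative_def sum_fun_apply by (simp add: sum_distrib_left sum_distrib_right)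
      finally show ?thesis ..
    qed
    show ?thesis
      unfolding half[symmetric] pairing_def field_bracket_def
      by (simp add: sum_subtractf[symmetric] algebra_simps)
  qed
  show ?thesis unfolding p using T_sym[of P] T_sym[of Q] T_sym[of R] assms by simp
qed

lemma pairing_skew: "pairing g P Q = - pairing g Q P"
proof -
  have "pairing g P Q = (\<Sum>j\<in>I. \<Sum>i\<in>I. bs g i j * P i [] * Q j [])" unfolding pairing_def by (rule sum.swap)
  also have "\<dots> = (\<Sum>j\<in>I. \<Sum>i\<in>I. - (bs g j i * Q j [] * P i []))"
    by (intro sum.cong refl) (subst skew, simp)
  finally show ?thesis unfolding pairing_def by (simp add: sum_negf)
qed

end

text \<open>The Lie axioms are inherited from a larger algebra, where they are easier to check than
  on the span of the components; what remains is that this span is closed under the bracket.\<close>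

lemma graded_lie_algebra_within:
  assumes L: "lie_algebra s br L" and sub: "\<And>p. module.subspace s (G p)" and GL: "\<And>p. G p \<subseteq> L"
    and direct: "\<And>c p. finite {p. c p \<noteq> 0} \<Longrightarrow> (\<And>p. c p \<in> G p) \<Longrightarrow> (\<Sum>p | c p \<noteq> 0. c p) = 0 \<Longrightarrow> c p = 0"
    and cmp: "\<And>x y p q. x \<in> G p \<Longrightarrow> y \<in> G q \<Longrightarrow> br x y \<in> G (p + q)"
  shows "graded_lie_algebra s br G"
proof -
  interpret lie_algebra s br L by fact
  let ?A = "\<Union>p\<in>UNIV. G p"
  have S: "span ?A \<subseteq> L" using GL subspace_L by (intro span_minimal) auto
  have c1: "br x y \<in> span ?A" if y: "y \<in> G q" and x: "x \<in> span ?A" for x y q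
  proof -
    have yL: "y \<in> L" using y GL by blast
    have "x \<in> L \<and> br x y \<in> span ?A" if "x \<in> ?A" for x
      using that cmp[OF _ y] GL span_base[of "br x y" ?A] by blast
    then have "span ?A \<subseteq> {x \<in> L. br x y \<in> span ?A}"
      using yL subspace_L
      by (intro span_minimal) (auto simp: subspace_def zero_left add_left scale_left span_zero span_add span_scale)
    then show ?thesis using x by blast
  qed
  have c2: "br x y \<in> span ?A" if x: "x \<in> span ?A" and y: "y \<in> span ?A" for x y
  proof -
    have xL: "x \<in> L" using S x by blast
    have "span ?A \<subseteq> {y \<in> L. br x y \<in> span ?A}"
      using xL subspace_L c1[OF _ x]
      by (intro span_minimal) (auto simp: subspace_def zero_right add_right scale_right span_zero span_add span_scale
          intro!: subsetD[OF GL])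
    then show ?thesis using y by blast
  qed
  show ?thesis
  proof (rule graded_lie_algebra.intro)
    show "graded_lie_algebra_axioms s br G"
      by (rule graded_lie_algebra_axioms.intro) (use sub direct cmp in blast)+
    show "lie_algebra s br (sum_cmp s UNIV G)"
    proof (intro lie_algebra.intro lie_algebra_axioms.intro vector_space_axioms)
      show "subspace (sum_cmp s UNIV G)" unfolding sum_cmp_def by blast
      show "br x y \<in> sum_cmp s UNIV G" if "x \<in> sum_cmp s UNIV G" "y \<in> sum_cmp s UNIV G" for x y
        using c2 that unfolding sum_cmp_def by blast
      show "bilinear_map_on s s (sum_cmp s UNIV G) br"
        using bilinear S unfolding bilinear_map_on_def sum_cmp_def
        by (meson semilinear_on_subset subsetD)
      show "br x x = 0" if "x \<in> sum_cmp s UNIV G" for x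
        using alternating S that unfolding sum_cmp_def by blast
      show "br x (br y z) + br y (br z x) + br z (br x y) = 0"
        if "x \<in> sum_cmp s UNIV G" "y \<in> sum_cmp s UNIV G" "z \<in> sum_cmp s UNIV G" for x y z
        using jacobi S that unfolding sum_cmp_def by blast
    qed
  qed
qed

text \<open>\<open>maximal_prolongation\<close> compares only with prolongations carried by
  \<open>'k poly\<close>, so a constructed one has to be copied there along an injective linear
  map.\<close>

lemma effective_prolongation_transport:
  fixes s :: "'k::field \<Rightarrow> 'a::ab_group_add \<Rightarrow> 'a" and t :: "'k \<Rightarrow> 'b::ab_group_add \<Rightarrow> 'b"
  assumes eff: "effective_prolongation sM brM M s br G \<iota>" and t: "vector_space t"
    and T: "linear_map_on s t (sum_cmp s UNIV G) T" "\<And>x. x \<in> sum_cmp s UNIV G \<Longrightarrow> T x = 0 \<Longrightarrow> x = 0"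
  obtains br' \<iota>' where "effective_prolongation sM brM M t br' (\<lambda>p. T ` G p) \<iota>'"
proof -
  let ?L = "sum_cmp s UNIV G"
  interpret graded_lie_algebra s br G using eff unfolding effective_prolongation_def by blast
  interpret t: vector_space t by fact
  obtain g where g: "Vector_Spaces.linear s t g" "\<And>x. x \<in> ?L \<Longrightarrow> g x = T x"
    using linear_map_on_extend[OF vector_space_axioms t subspace_L T(1)] by blast
  interpret g: Vector_Spaces.linear s t g by fact
  have inj: "inj_on g ?L"
    using g T(2) by (subst g.inj_on_iff_eq_0[OF subspace_L]) auto
  have TG: "T ` G p = g ` G p" for p using g(2) cmp_subset by (intro image_cong) auto
  define r where "r = inv_into ?L g"
  have r: "r (g x) = x" if "x \<in> ?L" for x unfolding r_def using inv_into_f_f[OF inj that] .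
  have sum: "sum_cmp t P (\<lambda>p. g ` G p) = g ` sum_cmp s P G" for P
    unfolding sum_cmp_def g.span_image[symmetric] image_UN ..
  have sub: "sum_cmp s P G \<subseteq> ?L" for P unfolding sum_cmp_def by (intro span_mono) auto
  define br' where "br' x y = g (br (r x) (r y))" for x y
  have br': "br' (g x) (g y) = g (br x y)" if "x \<in> ?L" "y \<in> ?L" for x y
    unfolding br'_def using r that by simp
  have lieT: "lie_algebra t br' (g ` ?L)"
  proof (intro lie_algebra.intro lie_algebra_axioms.intro t)
    show "t.subspace (g ` ?L)" using g.subspace_image[OF subspace_L] .
    show "br' x y \<in> g ` ?L" if "x \<in> g ` ?L" "y \<in> g ` ?L" for x y using that br' closed by auto
    show "bilinear_map_on t t (g ` ?L) br'"
      unfolding bilinear_map_on_def semilinear_on_def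
      using br' add_left add_right scale_left scale_right subspace_add[OF subspace_L] subspace_scale[OF subspace_L]
        closed by (auto simp: g.add[symmetric] g.scale[symmetric])
    show "br' x x = 0" if "x \<in> g ` ?L" for x using that br' alternating g.zero by auto
    show "br' x (br' y z) + br' y (br' z x) + br' z (br' x y) = 0"
      if xyz: "x \<in> g ` ?L" "y \<in> g ` ?L" "z \<in> g ` ?L" for x y z
    proof -
      obtain a b c where abc: "a \<in> ?L" "b \<in> ?L" "c \<in> ?L" "x = g a" "y = g b" "z = g c" using xyz by blast
      then have "br' x (br' y z) + br' y (br' z x) + br' z (br' x y)
          = g (br a (br b c) + br b (br c a) + br c (br a b))"
        using br' closed by (simp add: g.add)
      then show ?thesis using jacobi[OF abc(1-3)] g.zero by simp
    qed
  qed
  have "graded_lie_algebra t br' (\<lambda>p. g ` G p)"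
  proof (rule graded_lie_algebra_within[OF lieT])
    show "t.subspace (g ` G p)" for p using g.subspace_image[OF subspace_cmp] .
    show "g ` G p \<subseteq> g ` ?L" for p using cmp_subset by blast
    show "br' x y \<in> g ` G (p + q)" if "x \<in> g ` G p" "y \<in> g ` G q" for x y p q
      using that br' cmp_subset bracket_cmp by auto
    show "c p = 0" if c: "finite {p. c p \<noteq> 0}" "\<And>p. c p \<in> g ` G p" "(\<Sum>p | c p \<noteq> 0. c p) = 0" for c p
    proof -
      define d where "d p = r (c p)" for p
      have d: "d p \<in> G p" "g (d p) = c p" for p
        using c(2)[of p] r cmp_subset unfolding d_def by auto
      have nz: "d p \<noteq> 0 \<longleftrightarrow> c p \<noteq> 0" for p
        using d[of p] inj_onD[OF inj, of "d p" 0] cmp_subset[OF d(1)] subspace_0[OF subspace_L] g.zero by metis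
      have "g (\<Sum>p | d p \<noteq> 0. d p) = 0" using c(3) by (simp add: g.sum d nz)
      moreover have "(\<Sum>p | d p \<noteq> 0. d p) \<in> ?L"
        using d cmp_subset by (intro subspace_sum[OF subspace_L]) auto
      ultimately have "(\<Sum>p | d p \<noteq> 0. d p) = 0"
        using inj_onD[OF inj, of _ 0] subspace_0[OF subspace_L] g.zero by simp
      then have "d p = 0" using direct[of d p] d c(1) nz by simp
      then show ?thesis using d(2)[of p] g.zero by simp
    qed
  qed
  moreover have "graded_lie_hom sM brM M t br' (\<lambda>p. g ` G p) (g \<circ> \<iota>)"
    unfolding graded_lie_hom_def lie_hom_def sum
  proof (intro conjI ballI allI)
    have h: "graded_lie_hom sM brM M s br G \<iota>" using eff unfolding effective_prolongation_def by blast
    then have \<iota>L: "\<iota> ` sum_cmp sM UNIV M \<subseteq> ?L" unfolding graded_lie_hom_def lie_hom_def by blast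
    then show "(g \<circ> \<iota>) ` sum_cmp sM UNIV M \<subseteq> g ` ?L" by auto
    show "linear_map_on sM t (sum_cmp sM UNIV M) (g \<circ> \<iota>)"
      using h unfolding graded_lie_hom_def lie_hom_def semilinear_on_def by (simp add: g.add g.scale)
    show "(g \<circ> \<iota>) (brM x y) = br' ((g \<circ> \<iota>) x) ((g \<circ> \<iota>) y)"
      if "x \<in> sum_cmp sM UNIV M" "y \<in> sum_cmp sM UNIV M" for x y
      using h that br' \<iota>L unfolding graded_lie_hom_def lie_hom_def by (auto simp: image_subset_iff)
    show "(g \<circ> \<iota>) ` M p \<subseteq> g ` G p" for p
      using h unfolding graded_lie_hom_def by auto
  qed
  moreover have "inj_on (g \<circ> \<iota>) (sum_cmp sM UNIV M)"
    using eff unfolding effective_prolongation_def graded_lie_hom_def lie_hom_def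
    by (intro comp_inj_on inj_on_subset[OF inj]) auto
  moreover have "(g \<circ> \<iota>) ` sum_cmp sM UNIV M = sum_cmp t {..<0} (\<lambda>p. g ` G p)"
    using eff unfolding effective_prolongation_def sum by (metis image_comp)
  moreover have "{x \<in> sum_cmp t {0..} (\<lambda>p. g ` G p). \<forall>y\<in>g ` G (- 1). br' x y = 0} = {0}"
  proof -
    have ann: "{x \<in> sum_cmp s {0..} G. \<forall>y\<in>G (- 1). br x y = 0} = {0}"
      using eff unfolding effective_prolongation_def by blast
    have "x = 0" if "x \<in> sum_cmp s {0..} G" "\<forall>y\<in>g ` G (- 1). br' (g x) y = 0" for x
    proof -
      have xL: "x \<in> ?L" using that sub by blast
      have "br x y = 0" if y: "y \<in> G (- 1)" for y
      proof -
        have yL: "y \<in> ?L" using y cmp_subset by blast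
        have "g (br x y) = g 0" using br'[OF xL yL] that(1) y \<open>\<forall>y\<in>_. _\<close> g.zero by auto
        then show ?thesis using inj_onD[OF inj] closed[OF xL yL] subspace_0[OF subspace_L] by blast
      qed
      then show ?thesis using ann that(1) by blast
    qed
    moreover have "br' 0 y = 0" if "y \<in> g ` G (- 1)" for y
      using that br'[of 0] subspace_0[OF subspace_L] cmp_subset zero_left g.zero by auto
    moreover have "0 \<in> sum_cmp t {0..} (\<lambda>p. g ` G p)" unfolding sum_cmp_def using t.span_zero .
    ultimately show ?thesis unfolding sum
      by (intro equalityI subsetI) (auto simp: g.zero, metis g.zero)
  qed
  ultimately have "effective_prolongation sM brM M t br' (\<lambda>p. g ` G p) (g \<circ> \<iota>)"
    unfolding effective_prolongation_def by blast
  then show ?thesis using that unfolding TG by blast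
qed

text \<open>An enumeration of D sends the coordinates to distinct monomials, whose coefficients
  recover f.\<close>

lemma finsupp_embed_poly:
  fixes D :: "'b set"
  assumes "countable D"
  obtains T :: "('b \<Rightarrow> 'k::field) \<Rightarrow> 'k poly" where
    "linear_map_on fun_scale Polynomial.smult (finsupp D) T"
    "\<And>f. f \<in> finsupp D \<Longrightarrow> T f = 0 \<Longrightarrow> f = 0"
proof (rule that)
  let ?n = "to_nat_on D"
  let ?T = "lift Polynomial.smult (\<lambda>b. monom 1 (?n b)) :: ('b \<Rightarrow> 'k) \<Rightarrow> 'k poly"
  show "linear_map_on fun_scale Polynomial.smult (finsupp D) ?T"
    by (rule linear_lift[OF vector_space_poly_smult])
  show "f = 0" if f: "f \<in> finsupp D" "?T f = 0" for f
  proof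
    fix b
    show "f b = 0 b"
    proof (cases "b \<in> D")
      case True
      have "coeff (?T f) (?n b) = (\<Sum>c | f c \<noteq> 0. if c = b then f c else 0)"
        unfolding lift_def coeff_sum
        using f(1) True inj_on_eq_iff[OF inj_on_to_nat_on[OF assms]]
        by (intro sum.cong) (auto simp: finsupp_def subset_iff)
      also have "\<dots> = f b" using f(1) by (auto simp: finsupp_def)
      finally show ?thesis using f(2) by simp
    qed (use f(1) in \<open>auto simp: finsupp_def\<close>)
  qed
qed

section \<open>The central extension of the algebra of fields by the two-form\<close>

context two_form
begin

text \<open>
  Elements of the central extension are coefficient functions: \<open>Inl (i, l)\<close> indexes the coefficient
  \<open>l\<close> of the \<open>i\<close>-th component of a vector field, \<open>Inr g\<close> a coordinate on the center.
\<close>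

definition vfield :: "('i \<times> 'i list + 'c \<Rightarrow> 'k) \<Rightarrow> 'i \<Rightarrow> 'i list \<Rightarrow> 'k" where
  "vfield f i l = f (Inl (i, l))"

definition bracket :: "('i \<times> 'i list + 'c \<Rightarrow> 'k) \<Rightarrow> ('i \<times> 'i list + 'c \<Rightarrow> 'k) \<Rightarrow> 'i \<times> 'i list + 'c \<Rightarrow> 'k" where
  "bracket f h = (\<lambda>d. case d of Inl (i, l) \<Rightarrow> field_bracket (vfield f) (vfield h) i l
     | Inr g \<Rightarrow> pairing g (vfield f) (vfield h))"

definition indices :: "('i \<times> 'i list + 'c) set" where
  "indices = Inl ` (I \<times> lists I) \<union> Inr ` C"

text \<open>A field with homogeneous coefficients of degree k has degree k - 1, so that constant
  fields sit in degree -1 like V.\<close>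

fun deg :: "'i \<times> 'i list + 'c \<Rightarrow> int" where
  "deg (Inl (i, l)) = int (length l) - 1"
| "deg (Inr g) = - 2"

definition cmp :: "int \<Rightarrow> ('i \<times> 'i list + 'c \<Rightarrow> 'k) set" where
  "cmp p = {f. vfield f \<in> fields \<and> (\<forall>d. f d \<noteq> 0 \<longrightarrow> d \<in> indices \<and> deg d = p)}"

lemma vfield_bracket [simp]: "vfield (bracket f h) = field_bracket (vfield f) (vfield h)"
  by (auto simp: vfield_def bracket_def fun_eq_iff)

lemma bracket_Inr [simp]: "bracket f h (Inr g) = pairing g (vfield f) (vfield h)"
  by (simp add: bracket_def)

lemma vfield_eq_iff: "f = h \<longleftrightarrow> vfield f = vfield h \<and> (\<forall>g. f (Inr g) = h (Inr g))"
proof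
  assume *: "vfield f = vfield h \<and> (\<forall>g. f (Inr g) = h (Inr g))"
  show "f = h"
  proof
    fix d
    show "f d = h d" using * by (cases d) (auto simp: vfield_def fun_eq_iff)
  qed
qed auto

lemma vfield_linear [simp]:
  "vfield (f + h) = vfield f + vfield h" "vfield (fun_scale c f) = (\<lambda>i. fun_scale c (vfield f i))"
  "vfield 0 = 0"
  by (auto simp: vfield_def fun_eq_iff)

lemma field_bracket_linear:
  "field_bracket (P + P') Q = field_bracket P Q + field_bracket P' Q"
  "field_bracket Q (P + P') = field_bracket Q P + field_bracket Q P'"
  "field_bracket (\<lambda>i. fun_scale c (P i)) Q = (\<lambda>i. fun_scale c (field_bracket P Q i))"
  "field_bracket Q (\<lambda>i. fun_scale c (P i)) = (\<lambda>i. fun_scale c (field_bracket Q P i))"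
  unfolding field_bracket_def lie_derivative_linear plus_fun_apply
  by (auto simp: fun_eq_iff algebra_simps)

lemma pairing_linear:
  "pairing g (P + P') Q = pairing g P Q + pairing g P' Q"
  "pairing g Q (P + P') = pairing g Q P + pairing g Q P'"
  "pairing g (\<lambda>i. fun_scale c (P i)) Q = c * pairing g P Q"
  "pairing g Q (\<lambda>i. fun_scale c (P i)) = c * pairing g Q P"
  unfolding pairing_def by (simp_all add: sum.distrib sum_distrib_left algebra_simps)

lemma fields_subspace:
  shows "0 \<in> fields" "P \<in> fields \<Longrightarrow> Q \<in> fields \<Longrightarrow> P + Q \<in> fields"
    "P \<in> fields \<Longrightarrow> (\<lambda>i. fun_scale c (P i)) \<in> fields"
proof -
  interpret vector_space "fun_scale :: 'k \<Rightarrow> ('i list \<Rightarrow> 'k) \<Rightarrow> _" by (rule vector_space_fun_scale)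
  have c0: "contraction g 0 b = 0" for g b
    unfolding contraction_def by (simp only: zero_fun_apply scale_zero_right sum.neutral_const)
  have c1: "contraction g (P + Q) b = contraction g P b + contraction g Q b" for g b P Q
    unfolding contraction_def plus_fun_apply[of P] scale_right_distrib sum.distrib ..
  have c2: "contraction g (\<lambda>i. fun_scale c (P i)) b = fun_scale c (contraction g P b)" for g b P c
    unfolding contraction_def scale_sum_right by (simp only: scale_left_commute)
  show "0 \<in> fields" unfolding fields_def c0 mem_Collect_eq by (simp add: symmetric_linear)
  show "P + Q \<in> fields" if "P \<in> fields" "Q \<in> fields"
    using that unfolding fields_def mem_Collect_eq c1 plus_fun_apply[of P] pd_linear
    by (auto simp: symmetric_linear) (metis add_0 subsetD)+
  show "(\<lambda>i. fun_scale c (P i)) \<in> fields" if "P \<in> fields"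
    using that unfolding fields_def mem_Collect_eq c2 pd_scale
    by (auto simp: symmetric_linear)
qed

text \<open>The central part of the Jacobi identity is the cocycle identity of
  \<open>pairing\<close>. The carrier contains infinite series too; the homogeneous components are
  cut out of it afterwards.\<close>

lemma lie_algebra_fields: "lie_algebra fun_scale bracket {f. vfield f \<in> fields}"
proof -
  interpret vector_space "fun_scale :: 'k \<Rightarrow> ('i \<times> 'i list + 'c \<Rightarrow> 'k) \<Rightarrow> _" by (rule vector_space_fun_scale)
  show ?thesis
  proof unfold_locales
    show "subspace {f. vfield f \<in> fields}"
      unfolding subspace_def by (simp add: fields_subspace)
    show "bracket x y \<in> {f. vfield f \<in> fields}" if "x \<in> {f. vfield f \<in> fields}" "y \<in> {f. vfield f \<in> fields}" for x y
      using that bracket_fields by simp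
    show "bilinear_map_on fun_scale fun_scale {f. vfield f \<in> fields} bracket"
      unfolding bilinear_map_on_def semilinear_on_def
      by (simp add: vfield_eq_iff field_bracket_linear pairing_linear)
    show "bracket x x = 0" for x
      using pairing_skew[of _ "vfield x" "vfield x"] by (simp add: vfield_eq_iff field_bracket_def fun_eq_iff)
    show "bracket x (bracket y z) + bracket y (bracket z x) + bracket z (bracket x y) = 0"
      if "x \<in> {f. vfield f \<in> fields}" "y \<in> {f. vfield f \<in> fields}" "z \<in> {f. vfield f \<in> fields}" for x y z
    proof -
      have f: "vfield x \<in> fields" "vfield y \<in> fields" "vfield z \<in> fields" using that by auto
      have "pairing g (vfield x) (field_bracket (vfield y) (vfield z))
          + pairing g (vfield y) (field_bracket (vfield z) (vfield x))
          + pairing g (vfield z) (field_bracket (vfield x) (vfield y)) = 0" for g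
      proof -
        let ?a = "pairing g (field_bracket (vfield x) (vfield y)) (vfield z)"
        let ?b = "pairing g (field_bracket (vfield y) (vfield z)) (vfield x)"
        let ?c = "pairing g (field_bracket (vfield z) (vfield x)) (vfield y)"
        have "pairing g (vfield x) (field_bracket (vfield y) (vfield z))
          + pairing g (vfield y) (field_bracket (vfield z) (vfield x))
          + pairing g (vfield z) (field_bracket (vfield x) (vfield y)) = - ?b + - ?c + - ?a"
          by (simp only: pairing_skew[of g _ "field_bracket _ _"])
        also have "\<dots> = - (?a + ?b + ?c)" by simp
        finally show ?thesis using pairing_cocycle[OF f] by simp
      qed
      moreover have "field_bracket (vfield x) (field_bracket (vfield y) (vfield z))
          + field_bracket (vfield y) (field_bracket (vfield z) (vfield x))
          + field_bracket (vfield z) (field_bracket (vfield x) (vfield y)) = 0"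
        using f unfolding fields_def by (intro field_bracket_jacobi) auto
      ultimately show ?thesis unfolding vfield_eq_iff by simp
    qed
  qed
qed

lemma bracket_degree:
  assumes "f \<in> cmp p" "h \<in> cmp q"
  shows "bracket f h \<in> cmp (p + q)"
proof -
  have f: "vfield f \<in> fields" "vfield h \<in> fields" using assms unfolding cmp_def by auto
  have b: "field_bracket (vfield f) (vfield h) \<in> fields" using bracket_fields f .
  have df: "int (length l) = p + 1" if "vfield f i l \<noteq> 0" for i l
    using assms(1) that unfolding cmp_def vfield_def by force
  have dh: "int (length l) = q + 1" if "vfield h i l \<noteq> 0" for i l
    using assms(2) that unfolding cmp_def vfield_def by force
  have half: "int (length l) = p + q + 1" if nz: "lie_derivative P (Q i) l \<noteq> 0"
    and dP: "\<And>i l. P i l \<noteq> 0 \<Longrightarrow> int (length l) = p + 1" and dQ: "\<And>i l. Q i l \<noteq> 0 \<Longrightarrow> int (length l) = q + 1"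
    for P Q i l p q
  proof -
    have "(\<Sum>j\<in>I. hmul (P j) (pd j (Q i)) l) \<noteq> 0"
      using nz unfolding lie_derivative_def sum_fun_apply .
    then obtain j where j: "hmul (P j) (pd j (Q i)) l \<noteq> 0" by (rule sum.not_neutral_contains_not_neutral)
    have "int (length l) = (p + 1) + q"
    proof (rule hmul_degree[OF j])
      show "int (length l) = q" if "pd j (Q i) l \<noteq> 0" for l using dQ[of i "j # l"] that by simp
    qed (rule dP)
    then show ?thesis by simp
  qed
  have "d \<in> indices \<and> deg d = p + q" if nz: "bracket f h d \<noteq> 0" for d
  proof (cases d)
    case (Inl x)
    obtain i l where d: "d = Inl (i, l)" using Inl by (cases x) auto
    have nz': "field_bracket (vfield f) (vfield h) i l \<noteq> 0" using nz unfolding d bracket_def by simp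
    then have "i \<in> I" "set l \<subseteq> I" using b unfolding fields_def by auto
    moreover have "lie_derivative (vfield f) (vfield h i) l \<noteq> 0 \<or> lie_derivative (vfield h) (vfield f i) l \<noteq> 0"
      using nz' unfolding field_bracket_def by auto
    then have "int (length l) = p + q + 1"
      using half[of "vfield f" "vfield h" i l p q] half[of "vfield h" "vfield f" i l q p] df dh by auto
    ultimately show ?thesis unfolding d indices_def by auto
  next
    case (Inr g)
    then have nz': "pairing g (vfield f) (vfield h) \<noteq> 0" using nz by simp
    then have "(\<Sum>i\<in>I. \<Sum>j\<in>I. bs g i j * vfield f i [] * vfield h j []) \<noteq> 0" unfolding pairing_def .
    then obtain i where "(\<Sum>j\<in>I. bs g i j * vfield f i [] * vfield h j []) \<noteq> 0"
      by (rule sum.not_neutral_contains_not_neutral)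
    then obtain j where "bs g i j * vfield f i [] * vfield h j [] \<noteq> 0"
      by (rule sum.not_neutral_contains_not_neutral)
    then have nz'': "bs g i j \<noteq> 0" "vfield f i [] \<noteq> 0" "vfield h j [] \<noteq> 0" by auto
    then have "g \<in> C" using bs_C by blast
    then show ?thesis using df[OF nz''(2)] dh[OF nz''(3)] unfolding Inr indices_def by auto
  qed
  then show ?thesis unfolding cmp_def using b by simp
qed

lemma cmp_finsupp: "cmp p \<subseteq> finsupp indices"
proof
  fix f assume f: "f \<in> cmp p"
  have "{d. f d \<noteq> 0} \<subseteq> Inl ` (I \<times> {l. set l \<subseteq> I \<and> length l = nat (p + 1)}) \<union> Inr ` C"
  proof
    fix d assume "d \<in> {d. f d \<noteq> 0}"
    then have "d \<in> indices" "deg d = p" using f unfolding cmp_def by auto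
    then show "d \<in> Inl ` (I \<times> {l. set l \<subseteq> I \<and> length l = nat (p + 1)}) \<union> Inr ` C"
      unfolding indices_def by (auto simp: lists_eq_set)
  qed
  moreover have "finite (Inl ` (I \<times> {l. set l \<subseteq> I \<and> length l = nat (p + 1)}) \<union> Inr ` C)"
    using finite_I finite_C finite_lists_length_eq[OF finite_I] by auto
  ultimately have "finite {d. f d \<noteq> 0}" by (rule finite_subset)
  then show "f \<in> finsupp indices" using f unfolding finsupp_def cmp_def by auto
qed

lemma subspace_cmp: "module.subspace fun_scale (cmp p)"
proof -
  interpret vector_space "fun_scale :: 'k \<Rightarrow> ('i \<times> 'i list + 'c \<Rightarrow> 'k) \<Rightarrow> _" by (rule vector_space_fun_scale)
  have "f d + h d \<noteq> 0 \<Longrightarrow> f d \<noteq> 0 \<or> h d \<noteq> 0" for f h :: "'i \<times> 'i list + 'c \<Rightarrow> 'k" and d by auto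
  then show ?thesis
    unfolding subspace_def cmp_def by (simp add: fields_subspace) blast
qed

lemma graded_lie_algebra_cmp: "graded_lie_algebra fun_scale bracket cmp"
proof (rule graded_lie_algebra_within[OF lie_algebra_fields subspace_cmp])
  show "cmp p \<subseteq> {f. vfield f \<in> fields}" for p unfolding cmp_def by blast
  show "bracket x y \<in> cmp (p + q)" if "x \<in> cmp p" "y \<in> cmp q" for x y p q
    using bracket_degree that .
  show "c p = 0" if c: "finite {p. c p \<noteq> 0}" "\<And>p. c p \<in> cmp p" "(\<Sum>p | c p \<noteq> 0. c p) = 0" for c p
  proof
    fix d
    have *: "c q d = 0" if "q \<noteq> deg d" for q using c(2)[of q] that unfolding cmp_def by auto
    show "c p d = 0 d"
    proof (cases "p = deg d")
      case True
      have "(\<Sum>q | c q \<noteq> 0. c q d) = (\<Sum>q | c q \<noteq> 0. if q = p then c p d else 0)"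
        using * True by (intro sum.cong) auto
      also have "\<dots> = c p d" using c(1) by auto
      finally show ?thesis using c(3) sum_fun_apply[of c "{q. c q \<noteq> 0}" d] by simp
    qed (use * in auto)
  qed
qed

lemma constant_field:
  assumes "\<And>d. f d \<noteq> 0 \<Longrightarrow> \<exists>i\<in>I. d = Inl (i, [])"
  shows "f \<in> cmp (- 1)"
proof -
  have z: "vfield f i l = 0" if "l \<noteq> [] \<or> i \<notin> I" for i l using assms[of "Inl (i, l)"] that unfolding vfield_def by auto
  have "pd a (contraction g (vfield f) b) = 0" for a b g
    unfolding contraction_def by (simp add: fun_eq_iff sum_fun_apply z)
  moreover have "symmetric (vfield f i)" for i unfolding symmetric_def by (simp add: z)
  moreover have "i \<in> I \<and> set l \<subseteq> I" if "vfield f i l \<noteq> 0" for i l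
    using z[of l i] that by (cases "l = []") auto
  ultimately have "vfield f \<in> fields" unfolding fields_def by simp
  then show ?thesis unfolding cmp_def indices_def using assms by force
qed

text \<open>The bracket with the constant field e_j is minus the partial derivative in direction j.
  What commutes with all constant fields is therefore constant, and has no part in nonnegative
  degrees.\<close>

lemma cmp_effective:
  "{x \<in> sum_cmp fun_scale {0..} cmp. \<forall>y\<in>cmp (- 1). bracket x y = 0} = {0}"
proof -
  interpret graded_lie_algebra fun_scale bracket cmp by (rule graded_lie_algebra_cmp)
  have "f = 0" if f: "f \<in> sum_cmp fun_scale {0..} cmp" and ann: "\<forall>y\<in>cmp (- 1). bracket f y = 0" for f
  proof -
    let ?N = "{f. vfield f \<in> fields \<and> (\<forall>d. deg d < 0 \<longrightarrow> f d = 0)}"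
    have "sum_cmp fun_scale {0..} cmp \<subseteq> ?N"
      unfolding sum_cmp_def
      by (intro span_minimal) (auto simp: cmp_def subspace_def fields_subspace)
    then have fN: "vfield f \<in> fields" "\<And>d. deg d < 0 \<Longrightarrow> f d = 0" using f by auto
    have "vfield f i (j # l) = 0" if j: "j \<in> I" for i j l
    proof -
      define e where "e = (\<lambda>d :: 'i \<times> 'i list + 'c. if d = Inl (j, []) then 1 else (0::'k))"
      have e: "e \<in> cmp (- 1)" using j by (intro constant_field) (auto simp: e_def split: if_splits)
      have ve: "vfield e k = (if k = j then (\<lambda>l. if l = [] then 1 else 0) else 0)" for k
        unfolding vfield_def e_def by (auto simp: fun_eq_iff)
      have pe: "pd k (vfield e i) = 0" for k i unfolding ve by (auto simp: fun_eq_iff)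
      have "lie_derivative (vfield e) (vfield f i) = (\<Sum>k\<in>I. if k = j then pd j (vfield f i) else 0)"
        unfolding lie_derivative_def ve by (intro sum.cong refl) (auto simp: hmul_unit)
      also have "\<dots> = pd j (vfield f i)" using finite_I j by (simp only: sum.delta if_True)
      finally have "field_bracket (vfield f) (vfield e) i = - pd j (vfield f i)"
        unfolding field_bracket_def lie_derivative_def[of "vfield f"] pe hmul_zero
        by (simp only: sum.neutral_const diff_0)
      moreover have "vfield (bracket f e) = 0" using ann e by simp
      ultimately have "- pd j (vfield f i) = 0" by simp
      then show ?thesis by (metis neg_equal_0_iff_equal pd_apply zero_fun_apply)
    qed
    moreover have "vfield f i (j # l) = 0" if "j \<notin> I" for i j l
    proof (rule ccontr)
      assume "vfield f i (j # l) \<noteq> 0"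
      then have "set (j # l) \<subseteq> I" using fN(1) unfolding fields_def by blast
      then show False using that by simp
    qed
    moreover have "vfield f i [] = 0" "f (Inr g) = 0" for i g unfolding vfield_def by (auto intro: fN(2))
    ultimately have "vfield f i l = 0" for i l by (cases l) blast+
    then show "f = 0" using \<open>\<And>g. f (Inr g) = 0\<close> unfolding vfield_eq_iff by (simp add: fun_eq_iff)
  qed
  moreover have "bracket 0 y = 0" if "y \<in> cmp (- 1)" for y using zero_left cmp_subset that by blast
  moreover have "0 \<in> sum_cmp fun_scale {0..} cmp" unfolding sum_cmp_def by (rule span_zero)
  ultimately show ?thesis by blast
qed

lemma countable_indices: "countable indices"
  unfolding indices_def using finite_I finite_C by (auto intro: countable_finite)

text \<open>
  Over the closure the field \<open>\<xi>\<^sup>p\<^sup>+\<^sup>1 c\<close> preserves the form; a linear functional on the closure, applied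
  to its coefficients, carries it to a field over \<open>'k\<close>.
\<close>

lemma cmp_nonzero:
  fixes c \<xi> :: "'i \<Rightarrow> 'k alg_closure"
  assumes rank: "\<And>g k. k \<in> I \<Longrightarrow> (\<Sum>i\<in>I. c i * to_ac (bs g i k)) = \<xi> k * u g"
    and i0: "i0 \<in> I" "c i0 \<noteq> 0" and k0: "k0 \<in> I" "\<xi> k0 \<noteq> 0" and p: "p \<ge> 0"
  shows "cmp p \<noteq> {0}"
proof -
  define m where "m = nat (p + 1)"
  have m: "int m = p + 1" using p unfolding m_def by simp
  have "c i0 * \<xi> k0 ^ m \<noteq> 0" using i0 k0 by simp
  then obtain r :: "'k alg_closure \<Rightarrow> 'k" where l: "\<And>x y. r (x + y) = r x + r y" "\<And>a x. r (to_ac a * x) = a * r x"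
    "r 0 = 0" "r (c i0 * \<xi> k0 ^ m) = 1"
    using ac_functional by metis
  \<comment> \<open>These are the derivatives at the origin of
    \<open>(\<xi>\<^sup>m / m!) c\<close>, with r applied to each of them; the encoding by
    derivatives absorbs the factorial.\<close>
  define P where "P i l = (if i \<in> I \<and> set l \<subseteq> I \<and> length l = m then r (c i * prod_list (map \<xi> l)) else 0)"
    for i l
  define f :: "'i \<times> 'i list + 'c \<Rightarrow> 'k" where "f = (\<lambda>d. case d of Inl (i, l) \<Rightarrow> P i l | Inr g \<Rightarrow> (0::'k))"
  have vf: "vfield f = P" unfolding f_def vfield_def by (simp add: fun_eq_iff)
  \<comment> \<open>The derivative index a and the component b enter only through the product \<xi>
    a * \<xi> b, whose symmetry is the closedness of the contraction.\<close>
  have con: "contraction g P b (a # l)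
      = (if set l \<subseteq> I \<and> Suc (length l) = m then r (\<xi> a * \<xi> b * u g * prod_list (map \<xi> l)) else 0)"
    if "a \<in> I" "b \<in> I" for a b g l
  proof (cases "set l \<subseteq> I \<and> Suc (length l) = m")
    case True
    have "contraction g P b (a # l) = (\<Sum>k\<in>I. bs g k b * r (c k * (\<xi> a * prod_list (map \<xi> l))))"
      unfolding contraction_def sum_fun_apply fun_scale_apply using True that
      by (intro sum.cong) (auto simp: P_def)
    also have "\<dots> = r (\<Sum>k\<in>I. to_ac (bs g k b) * (c k * (\<xi> a * prod_list (map \<xi> l))))"
      unfolding ac_functional_sum[OF l(1,3)] l(2) ..
    also have "(\<Sum>k\<in>I. to_ac (bs g k b) * (c k * (\<xi> a * prod_list (map \<xi> l))))
        = (\<Sum>k\<in>I. c k * to_ac (bs g k b)) * (\<xi> a * prod_list (map \<xi> l))"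
      unfolding sum_distrib_right by (intro sum.cong refl) (simp add: algebra_simps)
    also have "\<dots> = \<xi> a * \<xi> b * u g * prod_list (map \<xi> l)" unfolding rank[OF that(2)] by simp
    finally show ?thesis using True by simp
  next
    case False
    then have "P k (a # l) = 0" for k unfolding P_def by auto
    then show ?thesis unfolding contraction_def sum_fun_apply fun_scale_apply using False by auto
  qed
  have "P \<in> fields"
    unfolding fields_def
  proof (intro CollectI conjI allI ballI impI)
    show "symmetric (P i)" for i unfolding symmetric_def P_def by (auto simp: mult.left_commute)
    show "i \<in> I" "set l \<subseteq> I" if "P i l \<noteq> 0" for i l using that unfolding P_def by (auto split: if_splits)
    show "pd a (contraction g P b) = pd b (contraction g P a)" if "a \<in> I" "b \<in> I" for g a b
      using con[of a b g] con[of b a g] that by (auto simp: fun_eq_iff mult.commute mult.left_commute)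
  qed
  moreover have "d \<in> indices \<and> deg d = p" if "f d \<noteq> 0" for d
    using that m unfolding f_def P_def indices_def by (auto split: sum.splits prod.splits if_splits)
  ultimately have "f \<in> cmp p" unfolding cmp_def mem_Collect_eq vf by blast
  moreover have "f (Inl (i0, replicate m k0)) = 1"
    using i0 k0 l(4) unfolding f_def P_def by (auto simp: set_replicate_conv_if)
  then have "f \<noteq> 0" by auto
  ultimately show ?thesis by blast
qed

end

subsection \<open>Prolongations of graded Lie algebras of depth two\<close>

text \<open>The structure constants of M form a two-form, and M becomes the constant fields and the
  center of its central extension. Degeneracy of the form makes every degree p \<ge> 0 nonzero, and
  the result is copied into \<open>'k poly\<close>.\<close>

theorem rank_one_infinite_prolongation:
  fixes sM :: "'k::field_char_0 \<Rightarrow> 'm::ab_group_add \<Rightarrow> 'm" and c \<xi> u :: "'m \<Rightarrow> 'k alg_closure"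
  assumes gM: "graded_lie_algebra sM brM M" and M0: "\<And>p. p \<noteq> - 1 \<Longrightarrow> p \<noteq> - 2 \<Longrightarrow> M p = {0}"
    and B: "finite B" "\<not> module.dependent sM B" "module.span sM B = M (- 1)"
    and C: "finite C" "\<not> module.dependent sM C" "module.span sM C = M (- 2)"
    and rank: "\<And>g k. g \<in> C \<Longrightarrow> k \<in> B \<Longrightarrow>
      (\<Sum>i\<in>B. c i * to_ac (module.representation sM C (brM i k) g)) = \<xi> k * u g"
    and i0: "i0 \<in> B" "c i0 \<noteq> 0" and k0: "k0 \<in> B" "\<xi> k0 \<noteq> 0"
  obtains brH H \<kappa> where "effective_prolongation sM brM M (Polynomial.smult :: 'k \<Rightarrow> 'k poly \<Rightarrow> 'k poly) brH H \<kappa>"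
    "\<And>p. p \<ge> 0 \<Longrightarrow> H p \<noteq> {0}"
proof -
  interpret graded_lie_algebra sM brM M by fact
  let ?L = "sum_cmp sM UNIV M"
  define D where "D = B \<union> C"
  define Bs where "Bs p = (if p = - 1 then B else if p = - 2 then C else {})" for p :: int
  have Bs: "independent (Bs p)" "span (Bs p) = M p" for p
    using B C M0[of p] by (auto simp: Bs_def independent_empty)
  have UBs: "(\<Union>p. Bs p) = D" unfolding Bs_def D_def by (auto split: if_splits; metis)
  have D: "independent D" "span D = ?L" "B \<inter> C = {}"
    using union_basis[OF Bs] union_basis(3)[OF Bs, of "- 1" "- 2"] unfolding UBs by (auto simp: Bs_def)
  have BC: "b \<notin> B" if "b \<in> C" for b using D(3) that by blast
  have CB: "b \<notin> C" if "b \<in> B" for b using D(3) that by blast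
  have fD: "finite D" unfolding D_def using B C by simp
  let ?r = "representation D"
  have rB: "?r x b = 0" if "x \<in> M (- 1)" "b \<notin> B" for x b
    using representation_extend[OF D(1), of x B] representation_ne_zero[of B x b] that B unfolding D_def by auto
  have rC': "?r x = representation C x" if "x \<in> M (- 2)" for x
    using representation_extend[OF D(1), of x C] that C unfolding D_def by auto
  have rC: "?r x b = 0" if "x \<in> M (- 2)" "b \<notin> C" for x b
    using rC' representation_ne_zero[of C x b] that by auto
  have BM: "b \<in> M (- 1)" "b \<in> ?L" if "b \<in> B" for b using that B span_base cmp_subset by blast+
  have CM: "b \<in> M (- 2)" "b \<in> ?L" if "b \<in> C" for b using that C span_base cmp_subset by blast+
  have DL: "b \<in> ?L" if "b \<in> D" for b using that BM CM unfolding D_def by blast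
  have brB: "brM i j \<in> M (- 2)" if "i \<in> B" "j \<in> B" for i j
    using bracket_cmp'[of i "- 1" j "- 1"] BM that by auto
  have br0: "brM i j = 0" if ij: "i \<in> D" "j \<in> D" "i \<in> C \<or> j \<in> C" for i j
  proof -
    consider "i \<in> B" "j \<in> C" | "i \<in> C" "j \<in> B" | "i \<in> C" "j \<in> C" using ij unfolding D_def by blast
    then have "brM i j \<in> M (- 3) \<or> brM i j \<in> M (- 4)"
      using bracket_cmp'[of i "- 1" j "- 2"] bracket_cmp'[of i "- 2" j "- 1"] bracket_cmp'[of i "- 2" j "- 2"] BM CM
      by cases auto
    then show ?thesis using M0 by auto
  qed
  define bs where "bs g i j = (if g \<in> C \<and> i \<in> B \<and> j \<in> B then ?r (brM i j) g else 0)" for g i j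
  \<comment> \<open>Brackets with degree -2 vanish, so only the coordinates in B of the two
    arguments matter.\<close>
  have br_rep: "?r (brM x y) d = (\<Sum>i\<in>B. \<Sum>j\<in>B. ?r x i * ?r y j * ?r (brM i j) d)" if "x \<in> ?L" "y \<in> ?L" for x y d
  proof -
    have ex: "z = (\<Sum>i\<in>D. sM (?r z i) i)" if "z \<in> ?L" for z
      using sum_representation_eq[OF D(1), of z D] that D(2) fD by simp
    have "brM x y = (\<Sum>i\<in>D. sM (?r x i) (brM i y))"
      by (subst ex[OF that(1)], rule semilinear_on_sum[OF linear_left[OF that(2)] vector_space_axioms subspace_L fD DL])
    also have "\<dots> = (\<Sum>i\<in>D. sM (?r x i) (\<Sum>j\<in>D. sM (?r y j) (brM i j)))"
    proof (intro sum.cong refl arg_cong[where f = "sM _"])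
      fix i assume i: "i \<in> D"
      show "brM i y = (\<Sum>j\<in>D. sM (?r y j) (brM i j))"
        by (subst ex[OF that(2)], rule semilinear_on_sum[OF linear_right[OF DL[OF i]] vector_space_axioms subspace_L fD DL])
    qed
    finally have eq: "brM x y = (\<Sum>i\<in>D. \<Sum>j\<in>D. sM (?r x i * ?r y j) (brM i j))"
      by (simp add: scale_sum_right)
    have inL: "brM i j \<in> span D" if "i \<in> D" "j \<in> D" for i j using closed DL that D(2) by simp
    have "?r (brM x y) d = (\<Sum>i\<in>D. ?r (\<Sum>j\<in>D. sM (?r x i * ?r y j) (brM i j)) d)"
      unfolding eq by (rule representation_sum[OF D(1), THEN fun_cong]) (auto intro!: span_sum span_scale inL)
    also have "\<dots> = (\<Sum>i\<in>D. \<Sum>j\<in>D. ?r (sM (?r x i * ?r y j) (brM i j)) d)"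
      by (intro sum.cong refl representation_sum[OF D(1), THEN fun_cong]) (auto intro!: span_scale inL)
    also have "\<dots> = (\<Sum>i\<in>D. \<Sum>j\<in>D. ?r x i * ?r y j * ?r (brM i j) d)"
      by (intro sum.cong refl) (simp add: representation_scale[OF D(1) inL])
    also have "\<dots> = (\<Sum>i\<in>B. \<Sum>j\<in>D. ?r x i * ?r y j * ?r (brM i j) d)"
      using fD br0 D(3) unfolding D_def
      by (intro sum.mono_neutral_right) (auto simp: representation_zero intro!: sum.neutral)
    also have "\<dots> = (\<Sum>i\<in>B. \<Sum>j\<in>B. ?r x i * ?r y j * ?r (brM i j) d)"
      using fD br0 D(3) unfolding D_def
      by (intro sum.cong refl sum.mono_neutral_right) (auto simp: representation_zero)
    finally show ?thesis .
  qed
  interpret W: two_form B C bs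
  proof
    show "bs g i j = - bs g j i" for g i j
    proof (cases "g \<in> C \<and> i \<in> B \<and> j \<in> B")
      case True
      then have "brM i j = - brM j i" using anticommute[of i j] BM by blast
      moreover have "brM j i \<in> span D" using True closed BM D(2) by blast
      ultimately show ?thesis using True representation_neg[OF D(1)] unfolding bs_def by simp
    qed (auto simp: bs_def)
  qed (use B C bs_def in auto)
  \<comment> \<open>Coordinates of degree -1 become constant fields, those of degree -2 become
    central.\<close>
  define \<kappa> :: "'m \<Rightarrow> 'm \<times> 'm list + 'm \<Rightarrow> 'k" where "\<kappa> m = (\<lambda>d. case d of Inl (i, l) \<Rightarrow> if l = [] \<and> i \<in> B then ?r m i else 0
      | Inr g \<Rightarrow> if g \<in> C then ?r m g else 0)" for m
  have \<kappa>_lin: "linear_map_on sM fun_scale ?L \<kappa>"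
    unfolding semilinear_on_def D(2)[symmetric] \<kappa>_def
    by (auto simp: fun_eq_iff representation_add[OF D(1)] representation_scale[OF D(1)] split: sum.split)
  have \<kappa>_inj: "m = 0" if "m \<in> ?L" "\<kappa> m = 0" for m
  proof -
    have "?r m b = 0" for b
    proof (cases "b \<in> D")
      case True
      then show ?thesis
        using fun_cong[OF that(2), of "Inl (b, [])"] fun_cong[OF that(2), of "Inr b"]
        unfolding \<kappa>_def D_def by (auto split: if_splits)
    qed (use representation_ne_zero in blast)
    then show ?thesis using sum_nonzero_representation_eq[OF D(1), of m] that(1) D(2) by simp
  qed
  have v\<kappa>: "W.vfield (\<kappa> m) i l = (if l = [] \<and> i \<in> B then ?r m i else 0)" for m i l
    unfolding W.vfield_def \<kappa>_def by simp
  interpret Wg: graded_lie_algebra fun_scale W.bracket W.cmp by (rule W.graded_lie_algebra_cmp)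
  have \<kappa>_cmp: "\<kappa> x \<in> W.cmp p" if x: "x \<in> M p" for x p
  proof -
    consider "p = - 1" | "p = - 2" | "x = 0" using M0 x by blast
    then show ?thesis
    proof cases
      case 1
      then show ?thesis using rB[of x] x BC unfolding \<kappa>_def
        by (auto intro!: W.constant_field split: sum.splits if_splits)
    next
      case 2
      then have "W.vfield (\<kappa> x) = 0" using rC[of x] x CB v\<kappa> by (auto simp: fun_eq_iff)
      then have "W.vfield (\<kappa> x) \<in> W.fields" by (simp add: W.fields_subspace)
      then show ?thesis using 2 rC[of x] x CB unfolding W.cmp_def \<kappa>_def W.indices_def
        by (auto split: sum.splits if_splits)
    next
      case 3
      then have "\<kappa> x = 0" unfolding \<kappa>_def by (auto simp: fun_eq_iff representation_zero split: sum.splits)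
      then show ?thesis using Wg.subspace_0[OF Wg.subspace_cmp] by simp
    qed
  qed
  have \<kappa>_hom: "\<kappa> (brM x y) = W.bracket (\<kappa> x) (\<kappa> y)" if xy: "x \<in> ?L" "y \<in> ?L" for x y
  proof -
    have pd0: "pd j (W.vfield (\<kappa> z) i) = 0" for j z i by (auto simp: fun_eq_iff v\<kappa>)
    have "W.field_bracket (W.vfield (\<kappa> x)) (W.vfield (\<kappa> y)) = 0"
      unfolding W.field_bracket_def W.lie_derivative_def pd0 hmul_zero by (auto simp: fun_eq_iff)
    moreover have "W.vfield (\<kappa> (brM x y)) = 0"
    proof -
      have "?r (brM x y) i = 0" if "i \<in> B" for i
        unfolding br_rep[OF xy] using rC[OF brB] CB that by (auto intro!: sum.neutral)
      then show ?thesis by (auto simp: fun_eq_iff v\<kappa>)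
    qed
    moreover have "\<kappa> (brM x y) (Inr g) = W.pairing g (W.vfield (\<kappa> x)) (W.vfield (\<kappa> y))" for g
      unfolding W.pairing_def v\<kappa> using br_rep[OF xy, of g]
      by (auto simp: \<kappa>_def bs_def algebra_simps intro!: sum.cong)
    ultimately show ?thesis unfolding W.vfield_eq_iff by simp
  qed
  have \<kappa>L: "\<kappa> ` ?L \<subseteq> sum_cmp fun_scale {..<0} W.cmp"
  proof -
    have "\<kappa> ` span (\<Union>p\<in>UNIV. M p) \<subseteq> Wg.span (\<kappa> ` (\<Union>p\<in>UNIV. M p))"
      using \<kappa>_lin unfolding sum_cmp_def by (rule semilinear_image_span[OF Wg.vector_space_axioms])
    also have "\<dots> \<subseteq> Wg.span (\<Union>p\<in>{..<0}. W.cmp p)"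
    proof (rule Wg.span_minimal[OF _ Wg.subspace_span], safe)
      fix x p assume x: "x \<in> M p"
      show "\<kappa> x \<in> Wg.span (\<Union>p\<in>{..<0}. W.cmp p)"
      proof (cases "p < 0")
        case True
        then show ?thesis using \<kappa>_cmp[OF x] by (intro Wg.span_base) auto
      next
        case False
        then have "x \<in> M (- 1)" using x M0[of p] subspace_0[OF subspace_cmp] by auto
        then show ?thesis using \<kappa>_cmp[of x "- 1"] by (intro Wg.span_base) auto
      qed
    qed
    finally show ?thesis unfolding sum_cmp_def .
  qed
  have L\<kappa>: "sum_cmp fun_scale {..<0} W.cmp \<subseteq> \<kappa> ` ?L"
  proof -
    let ?N = "{f. \<forall>d. f d \<noteq> 0 \<longrightarrow> d \<in> W.indices \<and> W.deg d < 0} :: ('m \<times> 'm list + 'm \<Rightarrow> 'k) set"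
    have nz: "f d + h d \<noteq> 0 \<Longrightarrow> f d \<noteq> 0 \<or> h d \<noteq> 0" for f h :: "'m \<times> 'm list + 'm \<Rightarrow> 'k" and d by auto
    have "Wg.subspace ?N" unfolding Wg.subspace_def using nz by simp blast
    then have "sum_cmp fun_scale {..<0} W.cmp \<subseteq> ?N"
      unfolding sum_cmp_def by (intro Wg.span_minimal) (auto simp: W.cmp_def)
    moreover have "f \<in> \<kappa> ` ?L" if f: "f \<in> ?N" for f
    proof -
      \<comment> \<open>The coordinates of the preimage of f: constant terms of the field on B,
        central coordinates on C.\<close>
      define a where "a b = (if b \<in> B then f (Inl (b, [])) else f (Inr b))" for b
      define m where "m = (\<Sum>b\<in>D. sM (a b) b)"
      have mL: "m \<in> ?L" unfolding m_def D(2)[symmetric] by (intro span_sum span_scale span_base)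
      have rm: "?r m d = a d" if "d \<in> D" for d
      proof -
        have "?r m d = (\<Sum>b\<in>D. ?r (sM (a b) b) d)"
          unfolding m_def by (rule representation_sum[OF D(1), THEN fun_cong]) (intro span_scale span_base)
        also have "\<dots> = (\<Sum>b\<in>D. if b = d then a b else 0)"
          by (intro sum.cong refl) (simp add: representation_scale[OF D(1)] span_base representation_basis[OF D(1)])
        finally show ?thesis using fD that by simp
      qed
      have z: "f d = 0" if "d \<notin> W.indices \<or> W.deg d \<ge> 0" for d using f that by force
      have "\<kappa> m d = f d" for d
      proof (cases d)
        case (Inl x)
        obtain i l where d: "d = Inl (i, l)" using Inl by (cases x) auto
        show ?thesis
        proof (cases "l = [] \<and> i \<in> B")
          case True
          then show ?thesis using rm[of i] unfolding d \<kappa>_def a_def D_def by simp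
        next
          case False
          then have "f d = 0" unfolding d by (intro z) (cases l; auto simp: W.indices_def)
          then show ?thesis using False unfolding d \<kappa>_def by auto
        qed
      next
        case (Inr g)
        show ?thesis
        proof (cases "g \<in> C")
          case True
          then show ?thesis using rm[of g] D(3) unfolding Inr \<kappa>_def a_def D_def by auto
        next
          case False
          then have "f d = 0" unfolding Inr by (intro z) (auto simp: W.indices_def)
          then show ?thesis using False unfolding Inr \<kappa>_def by auto
        qed
      qed
      then have "f = \<kappa> m" by auto
      then show ?thesis using mL by blast
    qed
    ultimately show ?thesis by blast
  qed
  have neg: "sum_cmp fun_scale {..<0} W.cmp \<subseteq> sum_cmp fun_scale UNIV W.cmp"
    unfolding sum_cmp_def by (intro Wg.span_mono) auto
  have inj: "inj_on \<kappa> ?L"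
  proof (rule inj_onI)
    fix x y assume xy: "x \<in> ?L" "y \<in> ?L" "\<kappa> x = \<kappa> y"
    then have "\<kappa> (x - y) = 0" "x - y \<in> ?L"
      using semilinear_on_diff[OF \<kappa>_lin vector_space_axioms subspace_L] subspace_diff[OF subspace_L] by auto
    then show "x = y" using \<kappa>_inj by fastforce
  qed
  have eff: "effective_prolongation sM brM M fun_scale W.bracket W.cmp \<kappa>"
    unfolding effective_prolongation_def graded_lie_hom_def lie_hom_def
  proof (intro conjI ballI allI)
    show "\<kappa> ` ?L \<subseteq> sum_cmp fun_scale UNIV W.cmp" using \<kappa>L neg by blast
    show "\<kappa> ` M p \<subseteq> W.cmp p" for p using \<kappa>_cmp by blast
    show "\<kappa> ` ?L = sum_cmp fun_scale {..<0} W.cmp" using \<kappa>L L\<kappa> by (rule equalityI)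
  qed (use \<kappa>_hom in \<open>simp_all add: W.graded_lie_algebra_cmp W.cmp_effective \<kappa>_lin inj\<close>)
  obtain T :: "('m \<times> 'm list + 'm \<Rightarrow> 'k) \<Rightarrow> 'k poly" where
    T: "linear_map_on fun_scale Polynomial.smult (finsupp W.indices) T"
      "\<And>f. f \<in> finsupp W.indices \<Longrightarrow> T f = 0 \<Longrightarrow> f = 0"
    using finsupp_embed_poly[OF W.countable_indices] by blast
  have sub: "sum_cmp fun_scale UNIV W.cmp \<subseteq> finsupp W.indices"
    unfolding sum_cmp_def using W.cmp_finsupp subspace_finsupp by (intro Wg.span_minimal) auto
  obtain brH \<kappa>' where H: "effective_prolongation sM brM M (Polynomial.smult :: 'k \<Rightarrow> 'k poly \<Rightarrow> 'k poly) brH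
      (\<lambda>p. T ` W.cmp p) \<kappa>'"
  proof (rule effective_prolongation_transport[OF eff vector_space_poly_smult semilinear_on_subset[OF T(1) sub]])
    show "f = 0" if "f \<in> sum_cmp fun_scale UNIV W.cmp" "T f = 0" for f using T(2) sub that by blast
  qed blast
  moreover have "T ` W.cmp p \<noteq> {0}" if "p \<ge> 0" for p
  proof -
    have "W.cmp p \<noteq> {0}"
    proof (rule W.cmp_nonzero[where c = c and \<xi> = \<xi>, OF _ i0 k0 that])
      \<comment> \<open>u is cut off outside C, where \<open>bs\<close> vanishes.\<close>
      show "(\<Sum>i\<in>B. c i * to_ac (bs g i k)) = \<xi> k * (if g \<in> C then u g else 0)" if "k \<in> B" for g k
        using rank[of g k] that brB rC' by (auto simp: bs_def intro!: sum.cong)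
    qed
    moreover have "0 \<in> W.cmp p" using Wg.subspace_0[OF Wg.subspace_cmp] .
    ultimately obtain f where "f \<in> W.cmp p" "f \<noteq> 0" by blast
    then show ?thesis using T(2) W.cmp_finsupp by blast
  qed
  ultimately show ?thesis using that by blast
qed

section \<open>Finite dimension of images, kernels and graded sums\<close>

lemma linear_map_on_image:
  assumes "vector_space s" "vector_space t" "module.subspace s E" "linear_map_on s t E f" "S \<subseteq> E"
  shows "module.span t (f ` S) = f ` module.span s S"
proof -
  interpret vs: vector_space s by fact
  interpret vt: vector_space t by fact
  obtain g where g: "Vector_Spaces.linear s t g" "\<And>x. x \<in> E \<Longrightarrow> g x = f x"
    using linear_map_on_extend[OF assms(1-4)] by blast
  interpret g: Vector_Spaces.linear s t g by fact
  have "vs.span S \<subseteq> E" using assms vs.span_minimal by blast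
  then have "f ` S = g ` S" "f ` vs.span S = g ` vs.span S"
    using g(2) assms(5) by (auto intro!: image_cong)
  then show ?thesis using g.span_image by simp
qed

lemma (in vector_space) finite_dimensional_image:
  assumes "vector_space t" "finite_dimensional scale E" "linear_map_on scale t E f"
  shows "finite_dimensional t (f ` E)"
proof -
  obtain B where B: "finite B" "span B = E" using assms(2) unfolding finite_dimensional_def by blast
  have "module.span t (f ` B) = f ` E"
    using linear_map_on_image[OF vector_space_axioms assms(1) _ assms(3), of B] B span_superset by auto
  then show ?thesis unfolding finite_dimensional_def using B(1) by blast
qed

lemma (in vector_space) finite_dimensional_span_subset:
  assumes "finite A" "S \<subseteq> span A" "subspace S"
  shows "finite_dimensional scale S"
  using finite_dimensional_subset[OF _ assms(3,2)] assms(1) unfolding finite_dimensional_def by blast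

text \<open>Preimages of generators of the image together with generators of the kernel span E. This
  bounds the components of a prolongation degree by degree.\<close>

lemma finite_dimensional_kernel:
  assumes "vector_space s" "module.subspace s E" "linear_map_on s s E f" "f ` E \<subseteq> E'"
    "finite_dimensional s E'" "finite_dimensional s {x \<in> E. f x = 0}"
  shows "finite_dimensional s E"
proof -
  interpret vector_space s by fact
  obtain g where g: "Vector_Spaces.linear s s g" "\<And>x. x \<in> E \<Longrightarrow> g x = f x"
    using linear_map_on_extend[OF assms(1,1-3)] by blast
  interpret g: Vector_Spaces.linear s s g by fact
  have "f ` E = g ` E" using g(2) by (intro image_cong) auto
  then have "subspace (f ` E)" using g.subspace_image[OF assms(2)] by simp
  then obtain A where A: "finite A" "A \<subseteq> f ` E" "span A = f ` E"
    using finite_dimensional_basis[OF finite_dimensional_subset[OF assms(5) _ assms(4)]] by metis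
  then obtain A' where A': "A' \<subseteq> E" "finite A'" "A = f ` A'" by (meson finite_subset_image)
  obtain B where B: "finite B" "span B = {x \<in> E. f x = 0}"
    using assms(6) unfolding finite_dimensional_def by blast
  have "E \<subseteq> span (A' \<union> B)"
  proof
    fix x assume x: "x \<in> E"
    have "f x \<in> f ` span A'"
      using x A(3) A' linear_map_on_image[OF assms(1,1-3) A'(1)] by auto
    then obtain y where y: "y \<in> span A'" "f x = f y" by blast
    have yE: "y \<in> E" using y A' assms(2) span_minimal by blast
    have "x - y \<in> span B"
      unfolding B(2) using x yE y subspace_diff[OF assms(2)] semilinear_on_diff[OF assms(3,1,2)] by simp
    then have "x - y \<in> span (A' \<union> B)" "y \<in> span (A' \<union> B)" using y span_mono by blast+
    then show "x \<in> span (A' \<union> B)" using span_add[of "x - y" "A' \<union> B" y] by simp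
  qed
  then show ?thesis using finite_dimensional_span_subset[OF _ _ assms(2)] A' B by blast
qed

lemma (in lie_algebra) bracket_span:
  assumes "A \<subseteq> L" "x \<in> span A" "y \<in> span A"
  shows "br x y \<in> span {br a b | a b. a \<in> A \<and> b \<in> A}"
proof -
  let ?S = "span {br a b | a b. a \<in> A \<and> b \<in> A}"
  have S: "span A \<subseteq> L" using assms(1) subspace_L span_minimal by blast
  have c1: "br x b \<in> ?S" if b: "b \<in> A" and x: "x \<in> span A" for x b
  proof -
    have bL: "b \<in> L" using b assms by blast
    have "br a b \<in> ?S" if "a \<in> A" for a using that b by (intro span_base) blast
    then have "span A \<subseteq> {x \<in> L. br x b \<in> ?S}"
      using bL subspace_L assms(1)
      by (intro span_minimal) (auto simp: subspace_def zero_left add_left scale_left span_zero span_add span_scale)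
    then show ?thesis using x by blast
  qed
  have xL: "x \<in> L" using S assms by blast
  have "span A \<subseteq> {y \<in> L. br x y \<in> ?S}"
    using xL subspace_L c1[OF _ assms(2)] assms(1)
    by (intro span_minimal) (auto simp: subspace_def zero_right add_right scale_right span_zero span_add span_scale)
  then show ?thesis using assms(3) by blast
qed

context graded_lie_algebra
begin

lemma homogeneous_bases:
  obtains B where "\<And>p. independent (B p)" "\<And>p. span (B p) = G p"
proof -
  have "\<exists>B. independent B \<and> span B = G p" for p
    using maximal_independent_subset[of "G p"] span_subspace[OF _ _ subspace_cmp] by metis
  then show ?thesis using that by metis
qed

text \<open>In a homogeneous basis the coordinates of x are confined to degrees in P and also to
  degrees in Q.\<close>

lemma sum_cmp_disjoint:
  assumes x: "x \<in> sum_cmp s P G" "x \<in> sum_cmp s Q G" and PQ: "P \<inter> Q = {}"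
  shows "x = 0"
proof -
  obtain B where B: "\<And>p. independent (B p)" "\<And>p. span (B p) = G p" using homogeneous_bases by blast
  note U = union_basis[OF B]
  let ?B = "\<Union>p. B p"
  have span: "sum_cmp s R G \<subseteq> span (\<Union>p\<in>R. B p)" for R
    unfolding sum_cmp_def
  proof (intro span_minimal UN_least subspace_span)
    show "G p \<subseteq> span (\<Union>p\<in>R. B p)" if "p \<in> R" for p
      using B(2)[of p] span_mono[of "B p" "\<Union>p\<in>R. B p"] that by blast
  qed
  have z: "representation ?B x b = 0" if "x \<in> sum_cmp s R G" "b \<notin> (\<Union>p\<in>R. B p)" for x b R
  proof -
    have "x \<in> span (\<Union>p\<in>R. B p)" using span that(1) by blast
    then have "representation ?B x = representation (\<Union>p\<in>R. B p) x"
      by (rule representation_extend[OF U(1)]) blast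
    then show ?thesis using representation_ne_zero[of "\<Union>p\<in>R. B p" x b] that(2) by metis
  qed
  have "representation ?B x b = 0" for b
  proof (cases "b \<in> (\<Union>p\<in>P. B p)")
    case True
    then obtain p where p: "p \<in> P" "b \<in> B p" by blast
    have "b \<notin> (\<Union>p\<in>Q. B p)"
    proof
      assume "b \<in> (\<Union>p\<in>Q. B p)"
      then obtain r where r: "r \<in> Q" "b \<in> B r" by blast
      then have "p \<noteq> r" using p PQ by blast
      then show False using U(3)[of p r] p r by blast
    qed
    then show ?thesis by (rule z[OF x(2)])
  next
    case False
    then show ?thesis by (rule z[OF x(1)])
  qed
  moreover have "x \<in> span ?B" using x(1) span[of P] span_mono[of "\<Union>p\<in>P. B p" ?B] by blast
  ultimately show ?thesis using sum_nonzero_representation_eq[OF U(1), of x] by simp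
qed

lemma cmp_sum_cmp: "x \<in> G p \<Longrightarrow> p \<in> P \<Longrightarrow> x \<in> sum_cmp s P G"
  unfolding sum_cmp_def by (intro span_base) auto

lemma subspace_sum_cmp: "subspace (sum_cmp s P G)"
  unfolding sum_cmp_def by (rule subspace_span)

lemma sum_cmp_mono: "P \<subseteq> Q \<Longrightarrow> sum_cmp s P G \<subseteq> sum_cmp s Q G"
  unfolding sum_cmp_def by (intro span_mono) auto

text \<open>One basis vector from each nonzero component gives an independent family. The finiteness
  of the prolongation thereby becomes a question about nonvanishing in high degrees.\<close>

lemma finite_dimensional_sum_cmp_iff:
  assumes "\<And>p. finite_dimensional s (G p)"
  shows "finite_dimensional s (sum_cmp s UNIV G) \<longleftrightarrow> finite {p. G p \<noteq> {0}}"
proof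
  obtain B where B: "\<And>p. independent (B p)" "\<And>p. span (B p) = G p" using homogeneous_bases by blast
  note U = union_basis[OF B]
  have ne: "B p \<noteq> {}" if "G p \<noteq> {0}" for p using B(2)[of p] that by auto
  assume "finite_dimensional s (sum_cmp s UNIV G)"
  then have fin: "finite (\<Union>p. B p)" using independent_card_bound(1)[OF _ U(1)] span_superset[of "\<Union>p. B p"] unfolding U(2) by blast
  define b where "b p = (SOME b. b \<in> B p)" for p
  have b: "b p \<in> B p" if "G p \<noteq> {0}" for p
    using ne[OF that] unfolding b_def by (simp add: some_in_eq)
  have "inj_on b {p. G p \<noteq> {0}}"
  proof (rule inj_onI)
    fix p r assume "p \<in> {p. G p \<noteq> {0}}" "r \<in> {p. G p \<noteq> {0}}" "b p = b r"
    then show "p = r" using b[of p] b[of r] U(3)[of p r] by auto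
  qed
  moreover have "b ` {p. G p \<noteq> {0}} \<subseteq> (\<Union>p. B p)" using b by blast
  ultimately show "finite {p. G p \<noteq> {0}}" by (rule inj_on_finite[OF _ _ fin])
next
  assume fin: "finite {p. G p \<noteq> {0}}"
  have "\<exists>B. finite B \<and> span B = G p" for p using assms unfolding finite_dimensional_def by blast
  then obtain B where B: "\<And>p. finite (B p)" "\<And>p. span (B p) = G p" by metis
  let ?B = "\<Union>p\<in>{p. G p \<noteq> {0}}. B p"
  have "G p \<subseteq> span ?B" for p
  proof (cases "G p = {0}")
    case False
    then show ?thesis using B(2)[of p] span_mono[of "B p" ?B] by blast
  qed (simp add: span_zero)
  then have "sum_cmp s UNIV G \<subseteq> span ?B" unfolding sum_cmp_def by (intro span_minimal) auto
  then show "finite_dimensional s (sum_cmp s UNIV G)"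
    using finite_dimensional_span_subset[of ?B] fin B(1) subspace_L by blast
qed

end

text \<open>K lies in degrees at most -2, so V survives in the quotient; K contains all degrees at
  most -3, so nothing below degree -2 does. That brackets of V span degree -2 comes from V
  generating the free Lie algebra.\<close>

lemma depth_two_quotient:
  fixes sF :: "'k::field_char_0 \<Rightarrow> 'f::ab_group_add \<Rightarrow> 'f" and sM :: "'k \<Rightarrow> 'm::ab_group_add \<Rightarrow> 'm"
  assumes free: "free_lie_algebra sF brF F V" and fdV: "finite_dimensional sF V"
    and K2: "module.subspace sF K2" "K2 \<subseteq> F (- 2)"
    and K: "K = {x + y | x y. x \<in> K2 \<and> y \<in> sum_cmp sF {..- 3} F}"
    and M: "lie_quotient sF brF (sum_cmp sF UNIV F) K sM brM (sum_cmp sM UNIV M) q"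
           "\<And>p. M p = q ` F p"
  shows "graded_lie_algebra sM brM M" "\<And>p. p \<noteq> - 1 \<Longrightarrow> p \<noteq> - 2 \<Longrightarrow> M p = {0}"
    "finite_dimensional sM (M (- 1))" "finite_dimensional sM (M (- 2))"
    "M (- 2) \<subseteq> module.span sM {brM x y | x y. x \<in> M (- 1) \<and> y \<in> M (- 1)}"
    "linear_map_on sF sM V q" "inj_on q V" "M (- 1) = q ` V"
proof -
  interpret F: graded_lie_algebra sF brF F using free unfolding free_lie_algebra_def by blast
  interpret L: lie_algebra sM brM "sum_cmp sM UNIV M" using M(1) unfolding lie_quotient_def by blast
  have V: "F (- 1) = V" and F0': "\<forall>p\<ge>0. F p = {0}"
    and gen': "\<forall>S. F.subspace S \<and> V \<subseteq> S \<and> (\<forall>x\<in>S. \<forall>y\<in>S. brF x y \<in> S) \<longrightarrow> sum_cmp sF UNIV F \<subseteq> S"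
    using free unfolding free_lie_algebra_def by - (elim conjE, assumption)+
  have F0: "\<And>p. p \<ge> 0 \<Longrightarrow> F p = {0}" using F0' by blast
  have gen: "\<And>S. F.subspace S \<Longrightarrow> V \<subseteq> S \<Longrightarrow> (\<And>x y. x \<in> S \<Longrightarrow> y \<in> S \<Longrightarrow> brF x y \<in> S)
      \<Longrightarrow> sum_cmp sF UNIV F \<subseteq> S"
    using gen' by blast
  let ?LF = "sum_cmp sF UNIV F"
  have q_lin: "linear_map_on sF sM ?LF q" and q_hom: "\<And>x y. x \<in> ?LF \<Longrightarrow> y \<in> ?LF \<Longrightarrow> q (brF x y) = brM (q x) (q y)"
    and ker: "{x \<in> ?LF. q x = 0} = K"
    using M(1) unfolding lie_quotient_def lie_hom_def by blast+
  have FL: "F p \<subseteq> ?LF" for p using F.cmp_subset by blast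
  have q0: "q 0 = 0" using semilinear_on_zero[OF q_lin F.subspace_0[OF F.subspace_L]] .
  show M1: "M (- 1) = q ` V" using M(2) V by simp
  show "linear_map_on sF sM V q" using semilinear_on_subset[OF q_lin] FL V by blast
  have T_K: "x \<in> K" if "x \<in> sum_cmp sF {..- 3} F" for x
    unfolding K using that F.module_axioms F.subspace_0[OF K2(1)] by force
  have K_sum: "K \<subseteq> sum_cmp sF {..- 2} F"
  proof
    fix z assume "z \<in> K"
    then obtain x y where xy: "z = x + y" "x \<in> K2" "y \<in> sum_cmp sF {..- 3} F" unfolding K by blast
    have "x \<in> sum_cmp sF {..- 2} F" using xy K2(2) F.cmp_sum_cmp[of x "- 2"] by auto
    moreover have "y \<in> sum_cmp sF {..- 2} F" using xy(3) F.sum_cmp_mono[of "{..- 3}" "{..- 2}"] by auto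
    ultimately show "z \<in> sum_cmp sF {..- 2} F" unfolding xy using F.subspace_add[OF F.subspace_sum_cmp] by blast
  qed
  have V_disj: "x = 0" if "x \<in> V" "x \<in> sum_cmp sF {..- 2} F" for x
    using F.sum_cmp_disjoint[of x "{- 1}" "{..- 2}"] that F.cmp_sum_cmp[of x "- 1" "{- 1}"] V by auto
  have sV: "F.subspace V" using F.subspace_cmp V by metis
  show "inj_on q V"
  proof (rule inj_onI)
    fix x y assume xy: "x \<in> V" "y \<in> V" "q x = q y"
    then have d: "x - y \<in> V" using F.subspace_diff[OF sV] by blast
    have "q (x - y) = 0"
      using semilinear_on_diff[OF q_lin F.vector_space_axioms F.subspace_L] xy FL V by (metis diff_self subsetD)
    then have "x - y \<in> K" using ker d FL V by blast
    then show "x = y" using V_disj[OF d] K_sum by auto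
  qed
  show M0: "M p = {0}" if "p \<noteq> - 1" "p \<noteq> - 2" for p
  proof (cases "p \<ge> 0")
    case True
    then show ?thesis using M(2) F0 q0 by simp
  next
    case False
    then have "F p \<subseteq> sum_cmp sF {..- 3} F" using that F.cmp_sum_cmp[of _ p] by auto
    then have "q ` F p \<subseteq> {0}" using T_K ker by blast
    moreover have "0 \<in> F p" using F.subspace_0[OF F.subspace_cmp] .
    ultimately show ?thesis using M(2) q0 by auto
  qed
  have q_image: "L.span (q ` S) = q ` F.span S" if "S \<subseteq> ?LF" for S
    using linear_map_on_image[OF F.vector_space_axioms L.vector_space_axioms F.subspace_L q_lin that] .
  have subM: "L.subspace (M p)" for p
  proof -
    have "M p = L.span (q ` F p)" using q_image[OF FL] M(2) F.subspace_cmp by (metis F.span_eq_iff)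
    then show ?thesis using L.subspace_span by metis
  qed
  show gM: "graded_lie_algebra sM brM M"
  proof (rule graded_lie_algebra_within[OF L.lie_algebra_axioms subM])
    show "M p \<subseteq> sum_cmp sM UNIV M" for p unfolding sum_cmp_def by (auto intro: L.span_base)
    show "brM x y \<in> M (p + r)" if "x \<in> M p" "y \<in> M r" for x y p r
    proof -
      obtain a b where ab: "x = q a" "y = q b" "a \<in> F p" "b \<in> F r" using \<open>x \<in> M p\<close> \<open>y \<in> M r\<close> M(2) by blast
      then have "brM x y = q (brF a b)" using q_hom[OF subsetD[OF FL] subsetD[OF FL]] by metis
      then show ?thesis using F.bracket_cmp[OF ab(3,4)] M(2) by auto
    qed
    show "c p = 0" if c: "finite {p. c p \<noteq> 0}" "\<And>p. c p \<in> M p" "(\<Sum>p | c p \<noteq> 0. c p) = 0" for c p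
    proof -
      have z: "c p = 0" if "p \<noteq> - 1" "p \<noteq> - 2" for p using M0[OF that] c(2)[of p] by simp
      then have "(\<Sum>p | c p \<noteq> 0. c p) = (\<Sum>p\<in>{- 1, - 2}. c p)" by (intro sum.mono_neutral_left) auto
      then have sum0: "c (- 1) + c (- 2) = 0" using c(3) by simp
      obtain a b where ab: "c (- 1) = q a" "a \<in> V" "c (- 2) = q b" "b \<in> F (- 2)"
        using c(2)[of "- 1"] c(2)[of "- 2"] M(2) V by blast
      \<comment> \<open>The lifted relation a + b lies in K, hence in degrees at most -2, which
        makes its part a of degree -1 vanish.\<close>
      have "q (a + b) = 0" using semilinear_onD(1)[OF q_lin, of a b] ab sum0 FL V by (metis subsetD)
      moreover have "a + b \<in> ?LF" using ab FL V F.subspace_add[OF F.subspace_L] by blast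
      ultimately have "a + b \<in> sum_cmp sF {..- 2} F" using ker K_sum by blast
      moreover have "b \<in> sum_cmp sF {..- 2} F" using ab F.cmp_sum_cmp[of b "- 2"] by auto
      ultimately have "a \<in> sum_cmp sF {..- 2} F"
        using F.subspace_diff[OF F.subspace_sum_cmp] by (metis add_diff_cancel_right')
      then have "a = 0" using V_disj ab(2) by blast
      then have "c (- 1) = 0" using ab q0 by simp
      then show ?thesis using sum0 z[of p] by fastforce
    qed
  qed
  show fd1: "finite_dimensional sM (M (- 1))"
    unfolding M1
    using F.finite_dimensional_image[OF L.vector_space_axioms fdV semilinear_on_subset[OF q_lin]] FL V by blast
  define VV where "VV = {brF x y | x y. x \<in> V \<and> y \<in> V}"
  have VV: "VV \<subseteq> F (- 2)" unfolding VV_def using F.bracket_cmp'[of _ "- 1" _ "- 1"] V by auto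
  have F2: "F (- 2) \<subseteq> F.span VV"
  proof -
    \<comment> \<open>This set is closed under brackets: apart from brackets of two elements of V,
      every bracket has degree at most -3. So its span is the whole algebra, and comparing parts of
      degree -2 leaves the span of \<open>VV\<close>.\<close>
    let ?A = "V \<union> VV \<union> (\<Union>p\<in>{..- 3}. F p)"
    have A_cmp: "\<exists>p<0. a \<in> F p \<and> (p = - 1 \<longrightarrow> a \<in> V)" if a: "a \<in> ?A" for a
    proof -
      consider "a \<in> V" | "a \<in> VV" | p where "p \<le> - 3" "a \<in> F p" using a by auto
      then show ?thesis
      proof cases
        case 1
        then show ?thesis using V by (intro exI[of _ "- 1"]) auto
      next
        case 2
        then show ?thesis using VV by (intro exI[of _ "- 2"]) auto
      next
        case 3
        then show ?thesis by (intro exI[of _ p]) auto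
      qed
    qed
    have AL: "?A \<subseteq> ?LF" using V VV FL by blast
    have br: "brF a b \<in> ?A" if ab: "a \<in> ?A" "b \<in> ?A" for a b
    proof -
      obtain p r where pr: "p < 0" "r < 0" "a \<in> F p" "b \<in> F r" "p = - 1 \<longrightarrow> a \<in> V" "r = - 1 \<longrightarrow> b \<in> V"
        using A_cmp[OF ab(1)] A_cmp[OF ab(2)] by blast
      show ?thesis
      proof (cases "p = - 1 \<and> r = - 1")
        case True
        then show ?thesis using pr unfolding VV_def by blast
      next
        case False
        then have "p + r \<le> - 3" using pr by auto
        then show ?thesis using F.bracket_cmp[OF pr(3,4)] by blast
      qed
    qed
    have "brF x y \<in> F.span ?A" if "x \<in> F.span ?A" "y \<in> F.span ?A" for x y
    proof -
      have "{brF a b | a b. a \<in> ?A \<and> b \<in> ?A} \<subseteq> ?A" using br by auto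
      then show ?thesis using F.bracket_span[OF AL that] F.span_mono by blast
    qed
    then have LS: "?LF \<subseteq> F.span ?A" using gen[of "F.span ?A"] F.span_superset[of ?A] by blast
    show ?thesis
    proof
      fix x assume x: "x \<in> F (- 2)"
      then have "x \<in> F.span ?A" using LS FL by blast
      then obtain v w t where vwt: "x = v + w + t" "v \<in> F.span V" "w \<in> F.span VV" "t \<in> sum_cmp sF {..- 3} F"
        unfolding F.span_Un sum_cmp_def by auto
      have w: "w \<in> F (- 2)" using vwt(3) VV F.span_minimal[OF VV F.subspace_cmp] by blast
      have v: "v \<in> V" using vwt(2) F.span_eq_iff[THEN iffD2, OF sV] by blast
      have "x - w \<in> sum_cmp sF {- 2} F"
        using F.cmp_sum_cmp[of "x - w" "- 2" "{- 2}"] F.subspace_diff[OF F.subspace_cmp x w] by simp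
      moreover have "v + t \<in> sum_cmp sF (- {- 2}) F"
        using F.subspace_add[OF F.subspace_sum_cmp, of v "- {- 2}" t] F.cmp_sum_cmp[of v "- 1" "- {- 2}"] v V
          vwt(4) F.sum_cmp_mono[of "{..- 3}" "- {- 2}"] by auto
      moreover have "x - w = v + t" using vwt(1) by simp
      ultimately have "x - w = 0" using F.sum_cmp_disjoint[of "x - w" "{- 2}" "- {- 2}"] by auto
      then show "x \<in> F.span VV" using vwt(3) by simp
    qed
  qed
  have qVV: "q ` VV \<subseteq> {brM x y | x y. x \<in> M (- 1) \<and> y \<in> M (- 1)}"
    unfolding VV_def M1 using q_hom FL V by blast
  show M2: "M (- 2) \<subseteq> L.span {brM x y | x y. x \<in> M (- 1) \<and> y \<in> M (- 1)}"
  proof -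
    have "M (- 2) \<subseteq> q ` F.span VV" using F2 M(2) by blast
    also have "\<dots> = L.span (q ` VV)" using q_image VV FL by blast
    finally show ?thesis using L.span_mono[OF qVV] by blast
  qed
  show "finite_dimensional sM (M (- 2))"
  proof -
    obtain B where B: "finite B" "L.span B = M (- 1)" using fd1 unfolding finite_dimensional_def by blast
    let ?BB = "{brM a b | a b. a \<in> B \<and> b \<in> B}"
    have fin: "finite ?BB" by (rule finite_image_set2) (simp_all add: B(1))
    have BL: "B \<subseteq> sum_cmp sM UNIV M"
      using B(2) L.span_superset[of B] L.span_superset[of "\<Union>p. M p"] unfolding sum_cmp_def by blast
    have "{brM x y | x y. x \<in> M (- 1) \<and> y \<in> M (- 1)} \<subseteq> L.span ?BB"
      using L.bracket_span[OF BL] B(2) by auto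
    then have "M (- 2) \<subseteq> L.span ?BB" using M2 L.span_minimal[OF _ L.subspace_span] by blast
    then show ?thesis using L.finite_dimensional_span_subset[OF fin _ subM] by blast
  qed
qed

text \<open>Negative components of G are found by comparing homogeneous parts with the image of M.
  Finite dimension rests on effectiveness: an element of nonnegative degree is determined by its
  brackets with a basis of degree -1.\<close>

lemma effective_prolongation_transitive:
  fixes sM :: "'k::field \<Rightarrow> 'm::ab_group_add \<Rightarrow> 'm" and sG :: "'k \<Rightarrow> 'g::ab_group_add \<Rightarrow> 'g"
  assumes gM: "graded_lie_algebra sM brM M" and M0: "\<And>p. p \<noteq> - 1 \<Longrightarrow> p \<noteq> - 2 \<Longrightarrow> M p = {0}"
    and fd: "finite_dimensional sM (M (- 1))" "finite_dimensional sM (M (- 2))"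
    and M2: "M (- 2) \<subseteq> module.span sM {brM x y | x y. x \<in> M (- 1) \<and> y \<in> M (- 1)}"
    and eff: "effective_prolongation sM brM M sG brG G \<iota>"
  shows "transitive_depth_two sG brG G" "\<And>p. p < 0 \<Longrightarrow> G p = \<iota> ` M p"
proof -
  interpret M: graded_lie_algebra sM brM M by fact
  interpret G: graded_lie_algebra sG brG G using eff unfolding effective_prolongation_def by blast
  let ?L = "sum_cmp sM UNIV M"
  have \<iota>_lin: "linear_map_on sM sG ?L \<iota>" and hom: "\<forall>x\<in>?L. \<forall>y\<in>?L. \<iota> (brM x y) = brG (\<iota> x) (\<iota> y)"
    and \<iota>_cmp': "\<forall>p. \<iota> ` M p \<subseteq> G p" and \<iota>_im: "\<iota> ` ?L = sum_cmp sG {..<0} G"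
    and ann: "{x \<in> sum_cmp sG {0..} G. \<forall>y\<in>G (- 1). brG x y = 0} = {0}"
    using eff unfolding effective_prolongation_def graded_lie_hom_def lie_hom_def by - (elim conjE, assumption)+
  have \<iota>_hom: "\<iota> (brM x y) = brG (\<iota> x) (\<iota> y)" if "x \<in> ?L" "y \<in> ?L" for x y using hom that by blast
  have \<iota>_cmp: "\<iota> ` M p \<subseteq> G p" for p using \<iota>_cmp' by blast
  have M_sub: "M p \<subseteq> ?L" for p using M.cmp_subset by blast
  have \<iota>0: "\<iota> 0 = 0" using semilinear_on_zero[OF \<iota>_lin M.subspace_0[OF M.subspace_L]] .
  have decomp: "\<exists>m1\<in>M (- 1). \<exists>m2\<in>M (- 2). m = m1 + m2" if "m \<in> ?L" for m
  proof -
    have "(\<Union>p\<in>UNIV. M p) \<subseteq> M.span (M (- 1) \<union> M (- 2))"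
    proof (rule UN_least)
      show "M p \<subseteq> M.span (M (- 1) \<union> M (- 2))" for p
        using M0[of p] M.span_superset[of "M (- 1) \<union> M (- 2)"] M.span_zero[of "M (- 1) \<union> M (- 2)"]
        by (cases "p = - 1 \<or> p = - 2") auto
    qed
    then have "m \<in> M.span (M (- 1) \<union> M (- 2))"
      using that M.span_minimal unfolding sum_cmp_def by blast
    then show ?thesis unfolding M.span_Un M.span_eq_iff[THEN iffD2, OF M.subspace_cmp] by blast
  qed
  show G_neg: "G p = \<iota> ` M p" if p: "p < 0" for p
  proof
    show "\<iota> ` M p \<subseteq> G p" by (rule \<iota>_cmp)
    show "G p \<subseteq> \<iota> ` M p"
    proof
      fix x assume x: "x \<in> G p"
      then have "x \<in> sum_cmp sG {..<0} G" using G.cmp_sum_cmp p by blast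
      then obtain m where m: "m \<in> ?L" "x = \<iota> m" using \<iota>_im by blast
      obtain m1 m2 where m12: "m1 \<in> M (- 1)" "m2 \<in> M (- 2)" "m = m1 + m2" using decomp[OF m(1)] by blast
      have x_eq: "x = \<iota> m1 + \<iota> m2" using m m12 semilinear_onD(1)[OF \<iota>_lin] M_sub by blast
      have i12: "\<iota> m1 \<in> G (- 1)" "\<iota> m2 \<in> G (- 2)" using m12 \<iota>_cmp by blast+
      \<comment> \<open>Since components of different degrees meet only in 0, at most the summand of
        degree p survives in \<iota> m1 + \<iota> m2.\<close>
      consider "p = - 1" | "p = - 2" | "p \<noteq> - 1" "p \<noteq> - 2" by blast
      then show "x \<in> \<iota> ` M p"
      proof cases
        case 1
        then have "\<iota> m2 \<in> G (- 1)" using x x_eq i12 G.subspace_diff[OF G.subspace_cmp, of x "- 1" "\<iota> m1"] by simp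
        then have "\<iota> m2 = 0" using G.cmp_disjoint[of _ "- 1" "- 2"] i12 by simp
        then show ?thesis using x_eq m12 1 by simp
      next
        case 2
        then have "\<iota> m1 \<in> G (- 2)" using x x_eq i12 G.subspace_diff[OF G.subspace_cmp, of x "- 2" "\<iota> m2"] by simp
        then have "\<iota> m1 = 0" using G.cmp_disjoint[of _ "- 1" "- 2"] i12 by simp
        then show ?thesis using x_eq m12 2 by simp
      next
        case 3
        have "x \<in> sum_cmp sG {- 1, - 2} G"
          unfolding x_eq using i12 by (intro G.subspace_add[OF G.subspace_sum_cmp] G.cmp_sum_cmp[of _ _ "{- 1, - 2}"]) auto
        moreover have "x \<in> sum_cmp sG {p} G" using x G.cmp_sum_cmp by blast
        ultimately have "x = 0" using G.sum_cmp_disjoint[of x "{p}" "{- 1, - 2}"] 3 by auto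
        then show ?thesis using M0[OF 3] \<iota>0 by simp
      qed
    qed
  qed
  have G1: "G (- 1) = \<iota> ` M (- 1)" and G2: "G (- 2) = \<iota> ` M (- 2)" using G_neg by simp_all
  have trans: "x = 0" if p: "p \<ge> 0" and x: "x \<in> G p" and k: "\<And>v. v \<in> G (- 1) \<Longrightarrow> brG v x = 0" for p x
  proof -
    have "brG x v = 0" if "v \<in> G (- 1)" for v
      using G.anticommute[OF G.cmp_subset[OF x] G.cmp_subset[OF that]] k[OF that] by simp
    then show ?thesis using ann x G.cmp_sum_cmp[OF x, of "{0..}"] p by auto
  qed
  have fdG1: "finite_dimensional sG (G (- 1))" and fdG2: "finite_dimensional sG (G (- 2))"
    unfolding G1 G2 using fd semilinear_on_subset[OF \<iota>_lin M_sub]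
    by (auto intro!: M.finite_dimensional_image[OF G.vector_space_axioms])
  have fd0: "finite_dimensional sG {0}" unfolding finite_dimensional_def using G.span_empty by blast
  have step: "finite_dimensional sG (G (int n))" if fdn: "finite_dimensional sG (G (int n - 1))" for n
  proof -
    obtain B where B: "finite B" "G.span B = G (- 1)" "B \<subseteq> G (- 1)" using G.finite_dimensional_basis[OF fdG1] by metis
    \<comment> \<open>The basis vectors are released one at a time. Elements killed by all of B
      vanish, and releasing v enlarges the space by at most a copy of the component one degree
      below.\<close>
    have ind: "finite_dimensional sG (G.annihilator (B - S) (int n))" if "finite S" "S \<subseteq> B" for S
      using that
    proof (induction S)
      case empty
      have "G.annihilator B (int n) \<subseteq> {0}"
      proof
        fix x assume "x \<in> G.annihilator B (int n)"
        then have x: "x \<in> G (int n)" "\<And>v. v \<in> G.span B \<Longrightarrow> brG v x = 0"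
          using G.annihilator_span[OF B(3), of "int n"] unfolding G.annihilator_def by blast+
        then show "x \<in> {0}" using trans[OF _ x(1)] B(2) by auto
      qed
      then show ?case using G.finite_dimensional_subset[OF fd0 G.subspace_annihilator[OF B(3)]] by simp
    next
      case (insert v S)
      let ?E = "G.annihilator (B - insert v S) (int n)"
      have BS: "B - insert v S \<subseteq> G (- 1)" and v: "v \<in> G (- 1)" using B insert by auto
      show ?case
      proof (rule finite_dimensional_kernel[where f = "brG v" and E' = "G (int n - 1)"])
        show "module.subspace sG ?E" by (rule G.subspace_annihilator[OF BS])
        show "linear_map_on sG sG ?E (brG v)"
          using semilinear_on_subset[OF G.linear_cmp[OF v] G.annihilator_subset] .
        show "brG v ` ?E \<subseteq> G (int n - 1)"
          using G.bracket_cmp'[OF v, of _ "int n" "int n - 1"] G.annihilator_subset by fastforce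
        have "{x \<in> ?E. brG v x = 0} = G.annihilator (B - S) (int n)"
          using insert unfolding G.annihilator_def by auto
        then show "finite_dimensional sG {x \<in> ?E. brG v x = 0}" using insert by simp
      qed (use fdn G.vector_space_axioms in auto)
    qed
    from ind[OF B(1) order_refl] show ?thesis unfolding G.annihilator_def by simp
  qed
  \<comment> \<open>The shift by one lets the induction over naturals start in degree -1.\<close>
  have fdn: "finite_dimensional sG (G (int n - 1))" for n
    by (induction n) (use fdG1 step in simp_all)
  have fdG: "finite_dimensional sG (G p)" for p
  proof -
    consider "p \<ge> - 1" | "p = - 2" | "p < - 2" by linarith
    then show ?thesis
    proof cases
      case 1
      then show ?thesis using fdn[of "nat (p + 1)"] by simp
    next
      case 3
      then show ?thesis using G_neg[of p] M0[of p] \<iota>0 fd0 by simp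
    qed (use fdG2 in simp)
  qed
  show "transitive_depth_two sG brG G"
  proof unfold_locales
    show "finite_dimensional sG (G p)" for p by (rule fdG)
    show "G p = {0}" if "p < - 2" for p using G_neg[of p] M0[of p] \<iota>0 that by simp
    show "x = 0" if "p \<ge> 0" "x \<in> G p" "\<And>v. v \<in> G (- 1) \<Longrightarrow> brG v x = 0" for p x using trans that .
    let ?A = "{brM x y | x y. x \<in> M (- 1) \<and> y \<in> M (- 1)}"
    have AL: "?A \<subseteq> ?L" using M.closed M_sub by blast
    have "G (- 2) \<subseteq> \<iota> ` M.span ?A" unfolding G2 using M2 by blast
    also have "\<dots> = G.span (\<iota> ` ?A)"
      using linear_map_on_image[OF M.vector_space_axioms G.vector_space_axioms M.subspace_L \<iota>_lin AL] by simp
    also have "\<dots> \<subseteq> G.span {brG x y | x y. x \<in> G (- 1) \<and> y \<in> G (- 1)}"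
      unfolding G1 using \<iota>_hom M_sub by (intro G.span_mono) blast
    finally show "G (- 2) \<subseteq> G.span {brG x y | x y. x \<in> G (- 1) \<and> y \<in> G (- 1)}" .
  qed
qed

text \<open>The universal property is stated for maps into polynomials, so a scalar functional is
  sent through constant polynomials and read off as the coefficient of degree 0.\<close>

lemma scalar_extension_functional:
  fixes sW :: "'k::field alg_closure \<Rightarrow> 'w::ab_group_add \<Rightarrow> 'w" and \<chi> :: "'a::ab_group_add \<Rightarrow> 'k alg_closure"
  assumes "scalar_extension s U sW W j" "semilinear_on to_ac s (*) U \<chi>"
  obtains f where "linear_map_on sW (*) W f" "\<And>x. x \<in> U \<Longrightarrow> f (j x) = \<chi> x"
proof -
  have "semilinear_on to_ac s Polynomial.smult U (\<lambda>x. [:\<chi> x:])"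
    using assms(2) unfolding semilinear_on_def by simp
  then obtain \<psi> where \<psi>: "linear_map_on sW Polynomial.smult W \<psi>" "\<forall>x\<in>U. \<psi> (j x) = [:\<chi> x:]"
    using assms(1) unfolding scalar_extension_def by blast
  have "linear_map_on sW (*) W (\<lambda>w. coeff (\<psi> w) 0)"
    using \<psi>(1) unfolding semilinear_on_def by simp
  then show ?thesis using that[of "\<lambda>w. coeff (\<psi> w) 0"] \<psi>(2) by simp
qed

lemma scalar_extension_span:
  assumes U: "scalar_extension s U sW W j" and s: "vector_space s" and B: "module.span s B = U"
  shows "W = module.span sW (j ` B)"
proof -
  interpret vector_space s by fact
  interpret W: vector_space sW using U unfolding scalar_extension_def by blast
  have j: "semilinear_on to_ac s sW (span B) j" and W: "W = W.span (j ` span B)"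
    using U B unfolding scalar_extension_def by blast+
  have "j ` span B \<subseteq> W.span (j ` B)" using semilinear_image_span[OF W.vector_space_axioms j] .
  then have "W.span (j ` span B) \<subseteq> W.span (j ` B)" by (intro W.span_minimal) auto
  moreover have "W.span (j ` B) \<subseteq> W.span (j ` span B)"
    using span_superset by (intro W.span_mono image_mono)
  ultimately show ?thesis using W by blast
qed

text \<open>The coefficients are indexed by A and not by its image, so f may repeat values.\<close>

lemma (in vector_space) span_image_finite:
  assumes "finite A" "x \<in> span (f ` A)"
  obtains c where "x = (\<Sum>a\<in>A. scale (c a) (f a))"
proof -
  let ?S = "range (\<lambda>c. \<Sum>a\<in>A. scale (c a) (f a))"
  have "subspace ?S"
    unfolding subspace_def
  proof (intro conjI ballI allI)
    show "0 \<in> ?S" by (intro range_eqI[of _ _ "\<lambda>_. 0"]) simp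
    fix x y assume "x \<in> ?S" "y \<in> ?S"
    then obtain c d where "x = (\<Sum>a\<in>A. scale (c a) (f a))" "y = (\<Sum>a\<in>A. scale (d a) (f a))" by blast
    then show "x + y \<in> ?S"
      by (intro range_eqI[of _ _ "\<lambda>a. c a + d a"]) (simp add: scale_left_distrib sum.distrib)
  next
    fix k x assume "x \<in> ?S"
    then obtain c where "x = (\<Sum>a\<in>A. scale (c a) (f a))" by blast
    then show "scale k x \<in> ?S"
      by (intro range_eqI[of _ _ "\<lambda>a. k * c a"]) (simp add: scale_sum_right)
  qed
  moreover have "f ` A \<subseteq> ?S"
  proof
    fix y assume "y \<in> f ` A"
    then obtain b where b: "b \<in> A" "y = f b" by blast
    have "(\<Sum>a\<in>A. scale (if a = b then 1 else 0) (f a)) = (\<Sum>a\<in>A. if a = b then f b else 0)"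
      by (intro sum.cong) auto
    also have "\<dots> = y" using assms(1) b by simp
    finally show "y \<in> ?S" by (intro range_eqI[of _ _ "\<lambda>a. if a = b then 1 else 0"]) simp
  qed
  ultimately have "span (f ` A) \<subseteq> ?S" using span_minimal by blast
  then show ?thesis using assms(2) that by blast
qed

lemma (in vector_space) dim_le_one:
  assumes "finite_dimensional scale S" "dim S < 2"
  obtains u where "u \<in> S" "S \<subseteq> span {u}"
proof -
  obtain B where B: "finite B" "B \<subseteq> S" "span B = S" "card B = dim S"
    using finite_dimensional_basis[OF assms(1)] by metis
  show ?thesis
  proof (cases "B = {}")
    case True
    then show ?thesis using B that[of 0] by auto
  next
    case False
    then have "card B = 1" using B assms(2) by (metis One_nat_def card_gt_0_iff less_2_cases not_less_zero)
    then obtain u where "B = {u}" using card_1_singletonE by blast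
    then show ?thesis using B that[of u] by auto
  qed
qed

theorem theorem4p8:
  fixes n :: nat
    and sF :: "'k::field_char_0 \<Rightarrow> 'f::ab_group_add \<Rightarrow> 'f"
    and brF :: "'f \<Rightarrow> 'f \<Rightarrow> 'f" and F :: "int \<Rightarrow> 'f set"
    and V K2 K :: "'f set"
    and sM :: "'k \<Rightarrow> 'm::ab_group_add \<Rightarrow> 'm"
    and brM :: "'m \<Rightarrow> 'm \<Rightarrow> 'm" and M :: "int \<Rightarrow> 'm set" and q :: "'f \<Rightarrow> 'm"
    and sG :: "'k \<Rightarrow> 'g::ab_group_add \<Rightarrow> 'g"
    and brG :: "'g \<Rightarrow> 'g \<Rightarrow> 'g" and G :: "int \<Rightarrow> 'g set" and \<iota> :: "'m \<Rightarrow> 'g"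
    and sW :: "'k alg_closure \<Rightarrow> 'w::ab_group_add \<Rightarrow> 'w" and W :: "'w set" and j :: "'f \<Rightarrow> 'w"
    and sU :: "'k alg_closure \<Rightarrow> 'u::ab_group_add \<Rightarrow> 'u" and U :: "'u set" and h :: "'m \<Rightarrow> 'u"
    and \<beta> :: "'w \<Rightarrow> 'w \<Rightarrow> 'u"
  assumes free: "free_lie_algebra sF brF F V"
    and dim_V: "finite_dimensional sF V" "vector_space.dim sF V = n" "n \<ge> 2"
    and K2: "Modules.module.subspace sF K2" "K2 \<subset> F (- 2)"
    and K: "K = {x + y | x y. x \<in> K2 \<and> y \<in> sum_cmp sF {..- 3} F}"
    and M: "lie_quotient sF brF (sum_cmp sF UNIV F) K sM brM (sum_cmp sM UNIV M) q"
           "\<And>p. M p = q ` F p"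
    and G: "maximal_prolongation sM brM M sG brG G \<iota>"
    and W: "scalar_extension sF V sW W j"
    and U: "scalar_extension sM (M (- 2)) sU U h"
    and \<beta>: "bilinear_map_on sW sU W \<beta>"
           "\<And>x y. x \<in> V \<Longrightarrow> y \<in> V \<Longrightarrow> \<beta> (j x) (j y) = h (brM (q x) (q y))"
  shows "finite_dimensional sG (sum_cmp sG UNIV G) \<longleftrightarrow> minimum_rank sU W \<beta> \<ge> 2"
proof -
  interpret F: graded_lie_algebra sF brF F using free unfolding free_lie_algebra_def by blast
  note Q = depth_two_quotient[OF free dim_V(1) K2(1) psubset_imp_subset[OF K2(2)] K M]
  have eff: "effective_prolongation sM brM M sG brG G \<iota>"
    using G unfolding maximal_prolongation_def by blast
  note T = effective_prolongation_transitive[OF Q(1-5) eff]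
  interpret M: graded_lie_algebra sM brM M by (rule Q(1))
  interpret G: transitive_depth_two sG brG G by (rule T(1))
  interpret W: vector_space sW using W unfolding scalar_extension_def by blast
  interpret U: vector_space sU using U unfolding scalar_extension_def by blast
  have j: "semilinear_on to_ac sF sW V j" and W_span: "W = W.span (j ` V)"
    using W unfolding scalar_extension_def by blast+
  have h: "semilinear_on to_ac sM sU (M (- 2)) h" and U_span: "U = U.span (h ` M (- 2))"
    using U unfolding scalar_extension_def by blast+
  have sV: "F.subspace V" using F.finite_dimensional_subspace dim_V(1) by blast
  have sW: "W.subspace W" unfolding W_span by (rule W.subspace_span)
  have sU: "U.subspace U" unfolding U_span by (rule U.subspace_span)
  have jW: "j x \<in> W" if "x \<in> V" for x unfolding W_span using that by (intro W.span_base) auto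
  have \<beta>_right: "linear_map_on sW sU W (\<beta> z)" and \<beta>_left: "linear_map_on sW sU W (\<lambda>y. \<beta> y z)" if "z \<in> W" for z
    using \<beta>(1) that unfolding bilinear_map_on_def by auto
  have qM: "q x \<in> M (- 1)" if "x \<in> V" for x using Q(8) that by blast
  have brM2: "brM x y \<in> M (- 2)" if "x \<in> M (- 1)" "y \<in> M (- 1)" for x y
    using M.bracket_cmp'[OF that] by simp
  have \<beta>_sum: "\<beta> (\<Sum>a\<in>A. sW (c a) (j (r a))) (j x) = (\<Sum>a\<in>A. sU (c a) (h (brM (q (r a)) (q x))))"
    if "finite A" "\<And>a. a \<in> A \<Longrightarrow> r a \<in> V" "x \<in> V" for A :: "'b set" and c r x
  proof -
    have "\<beta> (\<Sum>a\<in>A. sW (c a) (j (r a))) (j x) = (\<Sum>a\<in>A. sU (c a) (\<beta> (j (r a)) (j x)))"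
      using that jW by (intro semilinear_on_sum[OF \<beta>_left[OF jW[OF that(3)]] W.vector_space_axioms sW]) auto
    then show ?thesis using that \<beta>(2) by simp
  qed
  have \<beta>_range: "\<beta> z ` W \<subseteq> S" if "z \<in> W" "U.subspace S" "\<And>x. x \<in> V \<Longrightarrow> \<beta> z (j x) \<in> S" for z S
  proof -
    have "W.span (j ` V) \<subseteq> {y \<in> W. \<beta> z y \<in> S}"
      using that(2,3) jW sW semilinear_onD[OF \<beta>_right[OF that(1)]]
        semilinear_on_zero[OF \<beta>_right[OF that(1)] W.subspace_0[OF sW]]
      by (intro W.span_minimal) (auto simp: W.subspace_def U.subspace_def)
    then show ?thesis using W_span by blast
  qed
  have \<iota>_lin: "linear_map_on sM sG (sum_cmp sM UNIV M) \<iota>"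
    and \<iota>_hom: "\<forall>x\<in>sum_cmp sM UNIV M. \<forall>y\<in>sum_cmp sM UNIV M. \<iota> (brM x y) = brG (\<iota> x) (\<iota> y)"
    and \<iota>_inj: "inj_on \<iota> (sum_cmp sM UNIV M)"
    using eff unfolding effective_prolongation_def graded_lie_hom_def lie_hom_def
    by - (elim conjE, assumption)+
  obtain BV where BV: "finite BV" "F.independent BV" "BV \<subseteq> V" "F.span BV = V" "card BV = F.dim V"
    using F.finite_dimensional_basis[OF dim_V(1)] .
  define ranks where "ranks = {U.dim (\<beta> z ` W) | z. z \<in> W \<and> z \<noteq> 0}"
  have rank: "minimum_rank sU W \<beta> = Inf ranks" unfolding minimum_rank_def ranks_def ..
  show ?thesis
  proof
    assume fin: "finite_dimensional sG (sum_cmp sG UNIV G)"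
    show "minimum_rank sU W \<beta> \<ge> 2"
    proof (rule ccontr)
      assume "\<not> minimum_rank sU W \<beta> \<ge> 2"
      \<comment> \<open>An infimum of naturals is attained over a nonempty set, so a nonzero vector
        of W has to be exhibited: the functional extending the coordinate at b takes the value 1 at
        j b.\<close>
      moreover have "ranks \<noteq> {}"
      proof -
        have "BV \<noteq> {}" using BV(5) dim_V by auto
        then obtain b where b: "b \<in> BV" by blast
        have "semilinear_on to_ac sF (*) V (\<lambda>x. to_ac (F.representation BV x b))"
          unfolding semilinear_on_def using BV(2,4) by (simp add: F.representation_add F.representation_scale)
        then obtain f where f: "linear_map_on sW (*) W f" "\<And>x. x \<in> V \<Longrightarrow> f (j x) = to_ac (F.representation BV x b)"
          using scalar_extension_functional[OF W] by blast
        have "f (j b) = 1" using f(2)[of b] b BV F.representation_basis[OF BV(2) b] by auto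
        then have "j b \<noteq> 0" using semilinear_on_zero[OF f(1) W.subspace_0[OF sW]] by auto
        then show ?thesis unfolding ranks_def using jW b BV(3) by blast
      qed
      ultimately obtain z where z: "z \<in> W" "z \<noteq> 0" "U.dim (\<beta> z ` W) < 2"
        using Inf_nat_def1[of ranks] unfolding rank by (auto simp: ranks_def)
      have "finite_dimensional sW W"
        unfolding finite_dimensional_def scalar_extension_span[OF W F.vector_space_axioms BV(4)] using BV(1) by blast
      then have "finite_dimensional sU (\<beta> z ` W)"
        using W.finite_dimensional_image[OF U.vector_space_axioms _ \<beta>_right[OF z(1)]] by blast
      then obtain u where u: "u \<in> \<beta> z ` W" "\<beta> z ` W \<subseteq> U.span {u}"
        using U.dim_le_one z(3) by blast
      obtain c where c: "z = (\<Sum>v\<in>BV. sW (c v) (j v))"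
        using W.span_image_finite[OF BV(1), of z j] z(1) scalar_extension_span[OF W F.vector_space_axioms BV(4)] by blast
      have \<beta>z: "\<beta> z (j x) = (\<Sum>v\<in>BV. sU (c v) (h (brM (q v) (q x))))" if "x \<in> V" for x
        unfolding c using \<beta>_sum[OF BV(1), of "\<lambda>v. v"] BV(3) that by auto
      have hU: "h m \<in> U" if "m \<in> M (- 2)" for m unfolding U_span using that by (intro U.span_base) auto
      have uU: "u \<in> U"
        using \<beta>_range[OF z(1) sU] u(1) \<beta>z hU brM2 qM BV(3) U.subspace_sum[OF sU] U.subspace_scale[OF sU]
        by (smt (verit, ccfv_threshold) subsetD)
      obtain v0 where v0: "v0 \<in> BV" "c v0 \<noteq> 0"
        using z(2) unfolding c by (metis (no_types, lifting) W.scale_zero_left sum.neutral)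
      have "\<exists>k. \<beta> z (j v) = sU k u" if "v \<in> BV" for v
        using u(2) jW that BV(3) unfolding U.span_singleton by blast
      then obtain \<xi> where \<xi>: "\<And>v. v \<in> BV \<Longrightarrow> \<beta> z (j v) = sU (\<xi> v) u" by metis
      obtain C where C: "finite C" "M.independent C" "C \<subseteq> M (- 2)" "M.span C = M (- 2)"
        using M.finite_dimensional_basis[OF Q(4)] by metis
      \<comment> \<open>Coordinate functionals on U turn the vector equation [z, y] = \<xi>(y) u
        into the scalar equations that \<open>rank_one_infinite_prolongation\<close>
        expects.\<close>
      have "\<exists>f. linear_map_on sU (*) U f \<and> (\<forall>m\<in>M (- 2). f (h m) = to_ac (M.representation C m g))" for g
      proof -
        have "semilinear_on to_ac sM (*) (M (- 2)) (\<lambda>m. to_ac (M.representation C m g))"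
          unfolding semilinear_on_def C(4)[symmetric]
          using C(2) by (simp add: M.representation_add M.representation_scale)
        then show ?thesis using scalar_extension_functional[OF U] by metis
      qed
      then obtain f where f: "\<And>g. linear_map_on sU (*) U (f g)"
        "\<And>g m. m \<in> M (- 2) \<Longrightarrow> f g (h m) = to_ac (M.representation C m g)" by metis
      have eq: "(\<Sum>v\<in>BV. c v * to_ac (M.representation C (brM (q v) (q w)) g)) = \<xi> w * f g u" if w: "w \<in> BV" for w g
      proof -
        have m: "brM (q v) (q w) \<in> M (- 2)" if "v \<in> BV" for v using brM2 qM that w BV(3) by blast
        have "f g (\<beta> z (j w)) = (\<Sum>v\<in>BV. c v * f g (h (brM (q v) (q w))))"
          using \<beta>z[of w] w BV(3) semilinear_on_sum[OF f(1) U.vector_space_axioms sU BV(1) hU[OF m], where c = c] by auto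
        also have "\<dots> = (\<Sum>v\<in>BV. c v * to_ac (M.representation C (brM (q v) (q w)) g))"
          using f(2) m by simp
        finally show ?thesis using \<xi>[OF w] semilinear_onD(2)[OF f(1) uU] by simp
      qed
      \<comment> \<open>If \<xi> vanishes on the basis, z has rank zero. The construction asks for a
        nonzero linear form, and together with u' = 0 the constant value 1 serves.\<close>
      obtain \<xi>' u' where eq': "\<And>w g. w \<in> BV \<Longrightarrow>
          (\<Sum>v\<in>BV. c v * to_ac (M.representation C (brM (q v) (q w)) g)) = \<xi>' w * u' g"
        and \<xi>': "\<exists>w\<in>BV. \<xi>' w \<noteq> 0"
      proof (cases "\<exists>w\<in>BV. \<xi> w \<noteq> 0")
        case True
        then show ?thesis using that[of \<xi> "\<lambda>g. f g u"] eq by blast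
      next
        case False
        then show ?thesis using that[of "\<lambda>_. 1" "\<lambda>_. 0"] eq v0(1) by auto
      qed
      obtain w0 where w0: "w0 \<in> BV" "\<xi>' w0 \<noteq> 0" using \<xi>' by blast
      have injq: "inj_on q BV" using Q(7) BV(3) inj_on_subset by blast
      \<comment> \<open>The basis of degree -1 of M is q applied to BV; r carries its indices
        back.\<close>
      define r where "r = inv_into BV q"
      have r: "r (q v) = v" if "v \<in> BV" for v unfolding r_def using inv_into_f_f[OF injq that] .
      have B: "M.independent (q ` BV)" "M.span (q ` BV) = M (- 1)"
      proof -
        obtain q' where q': "Vector_Spaces.linear sF sM q'" "\<And>x. x \<in> V \<Longrightarrow> q' x = q x"
          using linear_map_on_extend[OF F.vector_space_axioms M.vector_space_axioms sV Q(6)] by blast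
        interpret q': Vector_Spaces.linear sF sM q' by fact
        have "inj_on q' V" using Q(7) q'(2) by (metis inj_on_cong)
        then have "M.independent (q' ` BV)" using q'.independent_injective_image[OF BV(2)] BV(4) by simp
        moreover have "q' ` BV = q ` BV" using q'(2) BV(3) by (intro image_cong) auto
        ultimately show "M.independent (q ` BV)" by simp
        show "M.span (q ` BV) = M (- 1)"
          using linear_map_on_image[OF F.vector_space_axioms M.vector_space_axioms sV Q(6) BV(3)] BV(4) Q(8) by simp
      qed
      have rank1: "(\<Sum>i\<in>q ` BV. c (r i) * to_ac (M.representation C (brM i k) g)) = \<xi>' (r k) * u' g"
        if k: "k \<in> q ` BV" for g k
      proof -
        have "(\<Sum>i\<in>q ` BV. c (r i) * to_ac (M.representation C (brM i k) g))
            = (\<Sum>v\<in>BV. c v * to_ac (M.representation C (brM (q v) k) g))"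
          using r by (simp add: sum.reindex[OF injq])
        then show ?thesis using eq' k r by auto
      qed
      obtain brH H \<kappa> where H: "effective_prolongation sM brM M (Polynomial.smult :: 'k \<Rightarrow> 'k poly \<Rightarrow> 'k poly) brH H \<kappa>"
        "\<And>p. p \<ge> 0 \<Longrightarrow> H p \<noteq> {0}"
      proof (rule rank_one_infinite_prolongation[OF Q(1,2) finite_imageI[OF BV(1)] B C(1,2,4)])
        show "(\<Sum>i\<in>q ` BV. c (r i) * to_ac (M.representation C (brM i k) g)) = \<xi>' (r k) * u' g"
          if "k \<in> q ` BV" for g k using rank1[OF that] .
        show "q v0 \<in> q ` BV" "q w0 \<in> q ` BV" using v0 w0 by auto
        show "c (r (q v0)) \<noteq> 0" "\<xi>' (r (q w0)) \<noteq> 0" using v0 w0 r by auto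
      qed (assumption | rule that)+
      \<comment> \<open>Maximality embeds the constructed prolongation into G, which is thereby
        nonzero in every degree p \<ge> 0.\<close>
      obtain \<phi> where \<phi>: "graded_lie_hom Polynomial.smult brH H sG brG G \<phi>"
        "inj_on \<phi> (sum_cmp Polynomial.smult UNIV H)"
        using G H(1) unfolding maximal_prolongation_def by blast
      interpret H: graded_lie_algebra "Polynomial.smult :: 'k \<Rightarrow> 'k poly \<Rightarrow> 'k poly" brH H
        using H(1) unfolding effective_prolongation_def by blast
      have "G p \<noteq> {0}" if p: "p \<ge> 0" for p
      proof -
        obtain x where x: "x \<in> H p" "x \<noteq> 0" using H(2)[OF p] H.subspace_0[OF H.subspace_cmp, of p] by blast
        have "\<phi> 0 = 0"
          using \<phi>(1) semilinear_on_zero H.subspace_0[OF H.subspace_L] unfolding graded_lie_hom_def lie_hom_def by blast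
        then have "\<phi> x \<noteq> 0"
          using inj_onD[OF \<phi>(2), of x 0] x H.cmp_subset[OF x(1)] H.subspace_0[OF H.subspace_L] by auto
        moreover have "\<phi> x \<in> G p" using \<phi>(1) x(1) unfolding graded_lie_hom_def by blast
        ultimately show ?thesis by blast
      qed
      then have "{0..} \<subseteq> {p. G p \<noteq> {0}}" by auto
      moreover have "finite {p. G p \<noteq> {0}}" using G.finite_dimensional_sum_cmp_iff[OF G.finite_cmp] fin by blast
      ultimately show False using infinite_Ici finite_subset by blast
    qed
  next
    assume rank2: "minimum_rank sU W \<beta> \<ge> 2"
    show "finite_dimensional sG (sum_cmp sG UNIV G)"
    proof (rule ccontr)
      assume "\<not> finite_dimensional sG (sum_cmp sG UNIV G)"
      then have infG: "infinite {p. G p \<noteq> {0}}"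
        using G.finite_dimensional_sum_cmp_iff[OF G.finite_cmp] by blast
      have inf: "\<exists>p\<ge>N. G p \<noteq> {0}" for N
      proof (rule ccontr)
        assume "\<not> ?thesis"
        then have z: "G p = {0}" if "p \<ge> N" for p using that by blast
        have "{p. G p \<noteq> {0}} \<subseteq> {- 2..N}"
        proof
          fix p assume "p \<in> {p. G p \<noteq> {0}}"
          then show "p \<in> {- 2..N}" using G.depth[of p] z[of p] by force
        qed
        then show False using infG finite_subset by blast
      qed
      \<comment> \<open>This is h read on G (- 2) through \<iota>, so that the rank-one statement
        about G speaks of U.\<close>
      define \<phi> where "\<phi> x = h (inv_into (sum_cmp sM UNIV M) \<iota> x)" for x
      have \<phi>: "\<phi> (\<iota> m) = h m" if "m \<in> M (- 2)" for m
        unfolding \<phi>_def using inv_into_f_f[OF \<iota>_inj M.cmp_subset[OF that]] by simp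
      have G2: "G (- 2) = \<iota> ` M (- 2)" and G1: "G (- 1) = \<iota> ` M (- 1)" using T(2) by simp_all
      have \<phi>_lin: "semilinear_on to_ac sG sU (G (- 2)) \<phi>"
        unfolding semilinear_on_def G2
      proof (intro conjI ballI allI)
        fix x y c assume "x \<in> \<iota> ` M (- 2)"
        then obtain m where m: "m \<in> M (- 2)" "x = \<iota> m" by blast
        have "\<iota> (sM c m) = sG c (\<iota> m)" using semilinear_onD(2)[OF \<iota>_lin M.cmp_subset[OF m(1)]] .
        then show "\<phi> (sG c x) = sU (to_ac c) (\<phi> x)"
          using \<phi>[of "sM c m"] \<phi>[OF m(1)] M.subspace_scale[OF M.subspace_cmp m(1)] semilinear_onD(2)[OF h m(1)] m(2) by metis
        assume "y \<in> \<iota> ` M (- 2)"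
        then obtain m' where m': "m' \<in> M (- 2)" "y = \<iota> m'" by blast
        have "\<iota> (m + m') = \<iota> m + \<iota> m'"
          using semilinear_onD(1)[OF \<iota>_lin M.cmp_subset[OF m(1)] M.cmp_subset[OF m'(1)]] .
        then show "\<phi> (x + y) = \<phi> x + \<phi> y"
          using \<phi>[of "m + m'"] \<phi>[OF m(1)] \<phi>[OF m'(1)] M.subspace_add[OF M.subspace_cmp m(1) m'(1)]
            semilinear_onD(1)[OF h m(1) m'(1)] m(2) m'(2) by metis
      qed
      obtain A c u where A: "finite A" "A \<noteq> {}" "A \<subseteq> G (- 1)" "G.independent A" "\<And>a. a \<in> A \<Longrightarrow> c a \<noteq> 0"
        and u: "\<And>x. x \<in> G (- 1) \<Longrightarrow> (\<Sum>a\<in>A. sU (c a) (\<phi> (brG a x))) \<in> U.span {u}"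
        by (rule transitive_depth_two_rank_one_closure[OF T(1) inf U.vector_space_axioms \<phi>_lin])
          (assumption | rule that)+
      have "\<exists>v\<in>V. \<iota> (q v) = a" if "a \<in> A" for a
      proof -
        have "a \<in> \<iota> ` q ` V" using that A(3) unfolding G1 Q(8) by blast
        then show ?thesis by blast
      qed
      then obtain r where r: "\<And>a. a \<in> A \<Longrightarrow> r a \<in> V \<and> \<iota> (q (r a)) = a" by metis
      define z where "z = (\<Sum>a\<in>A. sW (c a) (j (r a)))"
      have zW: "z \<in> W" unfolding z_def using r jW by (intro W.subspace_sum[OF sW] W.subspace_scale[OF sW]) auto
      \<comment> \<open>Independence of A passes to W through a functional: the coordinate at some b
        in A, extended to W, takes the nonzero value c b at z.\<close>
      have "z \<noteq> 0"
      proof -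
        obtain b where b: "b \<in> A" using A(2) by blast
        obtain B where B: "A \<subseteq> B" "B \<subseteq> G (- 1)" "G.independent B" "G (- 1) \<subseteq> G.span B"
          using G.maximal_independent_subset_extend[OF A(3,4)] by blast
        have iq: "\<iota> (q x) \<in> G.span B" if "x \<in> V" for x using that qM G1 B(4) by blast
        have "linear_map_on sF sG V (\<lambda>x. \<iota> (q x))"
          using semilinear_onD[OF Q(6)] semilinear_onD[OF \<iota>_lin] M.cmp_subset[OF qM]
          unfolding semilinear_on_def by simp
        then have "semilinear_on to_ac sF (*) V (\<lambda>x. to_ac (G.representation B (\<iota> (q x)) b))"
          using iq unfolding semilinear_on_def
          by (simp add: G.representation_add[OF B(3)] G.representation_scale[OF B(3)])
        then obtain f where f: "linear_map_on sW (*) W f"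
          "\<And>x. x \<in> V \<Longrightarrow> f (j x) = to_ac (G.representation B (\<iota> (q x)) b)"
          using scalar_extension_functional[OF W] by blast
        have "f z = (\<Sum>a\<in>A. c a * f (j (r a)))"
          unfolding z_def using r jW by (intro semilinear_on_sum[OF f(1) W.vector_space_axioms sW A(1)]) auto
        also have "\<dots> = (\<Sum>a\<in>A. if a = b then c b else 0)"
        proof (intro sum.cong refl)
          fix a assume a: "a \<in> A"
          then have "f (j (r a)) = to_ac (G.representation B a b)" using f(2) r by simp
          then show "c a * f (j (r a)) = (if a = b then c b else 0)"
            using G.representation_basis[OF B(3), of a] a B(1) by auto
        qed
        also have "\<dots> = c b" using A(1) b by simp
        finally show ?thesis
          using A(5)[OF b] semilinear_on_zero[OF f(1) W.subspace_0[OF sW]] by auto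
      qed
      moreover have "\<beta> z ` W \<subseteq> U.span {u}"
      proof (rule \<beta>_range[OF zW U.subspace_span])
        fix x assume x: "x \<in> V"
        have "\<beta> z (j x) = (\<Sum>a\<in>A. sU (c a) (h (brM (q (r a)) (q x))))"
          unfolding z_def using \<beta>_sum[OF A(1)] r x by blast
        also have "\<dots> = (\<Sum>a\<in>A. sU (c a) (\<phi> (brG a (\<iota> (q x)))))"
        proof (intro sum.cong refl)
          fix a assume a: "a \<in> A"
          have "brG a (\<iota> (q x)) = \<iota> (brM (q (r a)) (q x))"
            using \<iota>_hom M.cmp_subset[OF qM] r[OF a] x by metis
          then show "sU (c a) (h (brM (q (r a)) (q x))) = sU (c a) (\<phi> (brG a (\<iota> (q x))))"
            using \<phi> brM2 qM r[OF a] x by simp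
        qed
        also have "\<dots> \<in> U.span {u}" using u qM[OF x] G1 by blast
        finally show "\<beta> z (j x) \<in> U.span {u}" .
      qed
      then have "U.dim (\<beta> z ` W) \<le> 1" using U.dim_le_card[of "\<beta> z ` W" "{u}"] by simp
      moreover have "minimum_rank sU W \<beta> \<le> U.dim (\<beta> z ` W)"
        unfolding rank using zW \<open>z \<noteq> 0\<close> by (intro cInf_lower) (auto simp: ranks_def)
      ultimately show False using rank2 by simp
    qed
  qed
qed

end
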